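(* For every state $\rho^{AB}$ on a finite-dimensional bipartite Hilbert space $\mathcal{H}_A\otimes\mathcal{H}_B$, the squashed entanglement is upper bounded by the entanglement cost: $$E_{sq}(\rho^{AB})\le E_C(\rho^{AB}).$$
   Context: All Hilbert spaces are finite dimensional. For a state $\rho$ on a tensor product of systems, $\rho^X$ denotes its reduced state on the subsystem $X$, and $S(X)=S(\rho^X)=-\operatorname{Tr}\rho^X\log\rho^X$ is the von Neumann entropy ($\log$ to base 2). For a tripartite state $\rho^{ABE}$ the quantum conditional mutual information is $I(A;B|E)=S(AE)+S(BE)-S(ABE)-S(E)$. The squashed entanglement of a state $\rho^{AB}$ on $\mathcal{H}_A\otimes\mathcal{H}_B$ is $$E_{sq}(\rho^{AB})=\inf\left\{\tfrac12 I(A;B|E)\;:\;\rho^{ABE}\text{ a state on }\mathcal{H}_A\otimes\mathcal{H}_B\otimes\mathcal{H}_E\text{ with }\operatorname{Tr}_E\rho^{ABE}=\rho^{AB}\right\},$$ where the infimum is over all extensions $\rho^{ABE}$, with $\mathcal{H}_E$ of arbitrary (a priori unbounded) finite dimension. An LOCC operation with respect to the cut between parties $A$ and $B$ is a completely positive trace-preserving map obtained by finitely many rounds, in each of which one party applies to its own system a quantum instrument (a finite family of completely positive maps, possibly changing that party's Hilbert space, whose sum is trace preserving) and communicates the outcome to the other party, where the instrument used may depend on all earlier outcomes; at the end the outcome record may be discarded. The entanglement cost $E_C(\rho^{AB})$ is the asymptotic rate of maximal entanglement needed to create copies of $\rho^{AB}$ by LOCC: it is the infimum of $\limsup_{n\to\infty}\frac1n\log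 s_n$ over all sequences of positive integers $s_n$ and LOCC operations $\Lambda_n$ (mapping states on $\mathbb{C}^{s_n}\otimes\mathbb{C}^{s_n}$ to states on $\mathcal{H}_A^{\otimes n}\otimes\mathcal{H}_B^{\otimes n}$) such that $\|\Lambda_n(|s_n\rangle\langle s_n|)-(\rho^{AB})^{\otimes n}\|_1\to 0$, where $|s\rangle=\frac{1}{\sqrt s}\sum_{i=1}^s|i\rangle\otimes|i\rangle$ is a maximally entangled state of Schmidt rank $s$ and $\|\cdot\|_1$ is the trace norm. *)

theory Defs
  imports
    "HOL-Library.Extended_Real"
    "Jordan_Normal_Form.Schur_Decomposition"
begin

section \<open>States\<close>

text \<open>
  A Hilbert space of dimension d is represented by its coordinate space, operators on it by
  d x d complex matrices. A tensor product of spaces of dimensions m and n has dimension m * n,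
  its basis vector (i, j) having index i * n + j (Kronecker ordering). Iterated products are
  then strictly associative: (i, j, k) has index (i * n + j) * r + k = i * (n * r) + (j * r + k).
\<close>

definition mat_trace :: "complex mat \<Rightarrow> complex" where
  "mat_trace M = (\<Sum>i<dim_row M. M $$ (i, i))"

text \<open>The order on complex numbers is the one for which 0 \<le> z means that z is real and
  nonnegative, so Hermiticity is part of this condition.\<close>

definition positive_op :: "nat \<Rightarrow> complex mat \<Rightarrow> bool" where
  "positive_op d M \<longleftrightarrow>
     M \<in> carrier_mat d d \<and> (\<forall>v \<in> carrier_vec d. 0 \<le> (M *\<^sub>v v) \<bullet>c v)"

definition state :: "nat \<Rightarrow> complex mat \<Rightarrow> bool" where
  "state d \<rho> \<longleftrightarrow> positive_op d \<rho> \<and> mat_trace \<rho> = 1"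

text \<open>Trace over the middle factor of a tensor product of spaces of dimensions l, d, r;
  taking l = 1 or r = 1 traces out the first or the last factor.\<close>

definition partial_trace :: "nat \<Rightarrow> nat \<Rightarrow> nat \<Rightarrow> complex mat \<Rightarrow> complex mat" where
  "partial_trace l d r M = mat (l * r) (l * r) (\<lambda>(i, j).
     \<Sum>k<d. M $$ ((i div r * d + k) * r + i mod r, (j div r * d + k) * r + j mod r))"

section \<open>Functional calculus, entropy, trace norm\<close>

definition unitary_op :: "nat \<Rightarrow> complex mat \<Rightarrow> bool" where
  "unitary_op d U \<longleftrightarrow> U \<in> carrier_mat d d \<and>
     U * mat_adjoint U = 1\<^sub>m d \<and> mat_adjoint U * U = 1\<^sub>m d"

text \<open>The operator f(M) for Hermitian M, obtained by applying f to the eigenvalues in a unitary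
  diagonalisation; the result does not depend on the diagonalisation.\<close>

definition spectral_fun :: "(real \<Rightarrow> real) \<Rightarrow> complex mat \<Rightarrow> complex mat" where
  "spectral_fun f M = (SOME N. \<exists>U (e :: nat \<Rightarrow> real).
     unitary_op (dim_row M) U \<and>
     M = U * mat_diag (dim_row M) (\<lambda>i. of_real (e i)) * mat_adjoint U \<and>
     N = U * mat_diag (dim_row M) (\<lambda>i. of_real (f (e i))) * mat_adjoint U)"

text \<open>Whatever the value of log 2 0, a zero eigenvalue contributes 0 to the trace, in accordance
  with the convention 0 log 0 = 0.\<close>

definition entropy :: "complex mat \<Rightarrow> real" where
  "entropy \<rho> = - Re (mat_trace (\<rho> * spectral_fun (log 2) \<rho>))"

definition trace_norm :: "complex mat \<Rightarrow> real" where
  "trace_norm M = Re (mat_trace (spectral_fun sqrt (mat_adjoint M * M)))"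

section \<open>Squashed entanglement\<close>

text \<open>I(A;B|E) for a state on a tensor product A, B, E of dimensions a, b, e.\<close>

definition cond_mutual_info :: "nat \<Rightarrow> nat \<Rightarrow> nat \<Rightarrow> complex mat \<Rightarrow> real" where
  "cond_mutual_info a b e \<rho> =
     entropy (partial_trace a b e \<rho>) + entropy (partial_trace 1 a (b * e) \<rho>)
     - entropy \<rho> - entropy (partial_trace 1 (a * b) e \<rho>)"

definition squashed_entanglement :: "nat \<Rightarrow> nat \<Rightarrow> complex mat \<Rightarrow> ereal" where
  "squashed_entanglement a b \<rho> =
     Inf {ereal (cond_mutual_info a b e \<sigma> / 2) | e \<sigma>.
            state (a * b * e) \<sigma> \<and> partial_trace (a * b) e 1 \<sigma> = \<rho>}"

section \<open>LOCC operations\<close>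

definition linear_op_map :: "nat \<Rightarrow> nat \<Rightarrow> (complex mat \<Rightarrow> complex mat) \<Rightarrow> bool" where
  "linear_op_map d d' E \<longleftrightarrow>
     (\<forall>X \<in> carrier_mat d d. E X \<in> carrier_mat d' d') \<and>
     (\<forall>X \<in> carrier_mat d d. \<forall>Y \<in> carrier_mat d d. E (X + Y) = E X + E Y) \<and>
     (\<forall>c. \<forall>X \<in> carrier_mat d d. E (c \<cdot>\<^sub>m X) = c \<cdot>\<^sub>m E X)"

text \<open>The map id \<otimes> E \<otimes> id, with identities on operators on spaces of dimensions l and r:
  E is applied to each d x d block of M obtained by fixing the basis indices of the outer
  factors, here (i div (d' * r), i mod r) for the row and likewise with j for the column.\<close>

definition local_map ::
  "nat \<Rightarrow> nat \<Rightarrow> nat \<Rightarrow> nat \<Rightarrow> (complex mat \<Rightarrow> complex mat) \<Rightarrow> complex mat \<Rightarrow> complex mat" where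
  "local_map l r d d' E M = mat (l * d' * r) (l * d' * r) (\<lambda>(i, j).
     E (mat d d (\<lambda>(p, q). M $$ ((i div (d' * r) * d + p) * r + i mod r,
                                 (j div (d' * r) * d + q) * r + j mod r)))
       $$ (i div r mod d', j div r mod d'))"

definition completely_positive :: "nat \<Rightarrow> nat \<Rightarrow> (complex mat \<Rightarrow> complex mat) \<Rightarrow> bool" where
  "completely_positive d d' E \<longleftrightarrow> linear_op_map d d' E \<and>
     (\<forall>k M. positive_op (k * d) M \<longrightarrow> positive_op (k * d') (local_map k 1 d d' E M))"

text \<open>Outcomes are numbered 0, ..., m - 1.\<close>

definition instrument ::
  "nat \<Rightarrow> nat \<Rightarrow> nat \<Rightarrow> (nat \<Rightarrow> complex mat \<Rightarrow> complex mat) \<Rightarrow> bool" where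
  "instrument d d' m E \<longleftrightarrow>
     (\<forall>x<m. completely_positive d d' (E x)) \<and>
     (\<forall>X \<in> carrier_mat d d. (\<Sum>x<m. mat_trace (E x X)) = mat_trace X)"

definition mat_sum :: "nat \<Rightarrow> nat \<Rightarrow> (nat \<Rightarrow> complex mat) \<Rightarrow> complex mat" where
  "mat_sum d m F = mat d d (\<lambda>ij. \<Sum>x<m. F x $$ ij)"

text \<open>In locc a b a' b' T, the map T takes operators on a space of dimension a * b to operators
  on one of dimension a' * b'. A protocol is a finite tree: after a party has applied an
  instrument, the protocol T x that follows may depend on the outcome x, hence each instrument
  depends on all outcomes before it. Summing over x discards the outcome record; a party can
  keep outcomes by writing them to its own system.\<close>

inductive locc ::
  "nat \<Rightarrow> nat \<Rightarrow> nat \<Rightarrow> nat \<Rightarrow> (complex mat \<Rightarrow> complex mat) \<Rightarrow> bool" where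
  locc_id: "locc a b a b (\<lambda>\<rho>. \<rho>)"
| locc_A: "instrument a c m E \<Longrightarrow> (\<And>x. x < m \<Longrightarrow> locc c b a' b' (T x)) \<Longrightarrow>
     locc a b a' b' (\<lambda>\<rho>. mat_sum (a' * b') m (\<lambda>x. T x (local_map 1 b a c (E x) \<rho>)))"
| locc_B: "instrument b c m E \<Longrightarrow> (\<And>x. x < m \<Longrightarrow> locc a c a' b' (T x)) \<Longrightarrow>
     locc a b a' b' (\<lambda>\<rho>. mat_sum (a' * b') m (\<lambda>x. T x (local_map a 1 b c (E x) \<rho>)))"

section \<open>Entanglement cost\<close>

definition projector :: "complex vec \<Rightarrow> complex mat" where
  "projector v = mat (dim_vec v) (dim_vec v) (\<lambda>(i, j). v $ i * cnj (v $ j))"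

definition max_entangled_vec :: "nat \<Rightarrow> complex vec" where
  "max_entangled_vec s =
     vec (s * s) (\<lambda>i. if i div s = i mod s then of_real (1 / sqrt (real s)) else 0)"

text \<open>The n-fold tensor power of an operator on A \<otimes> B, with the factors regrouped to
  give an operator on the tensor product of the n-fold powers of A and B. A basis index i splits
  into i div b ^ n for the A part and i mod b ^ n for the B part; their base a and base b digits
  number k are the basis indices for one of the n copies.\<close>

definition copy_index :: "nat \<Rightarrow> nat \<Rightarrow> nat \<Rightarrow> nat \<Rightarrow> nat \<Rightarrow> nat" where
  "copy_index a b n k i = (i div b ^ n) div a ^ k mod a * b + (i mod b ^ n) div b ^ k mod b"

definition bipartite_power :: "nat \<Rightarrow> nat \<Rightarrow> nat \<Rightarrow> complex mat \<Rightarrow> complex mat" where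
  "bipartite_power a b n \<rho> = mat (a ^ n * b ^ n) (a ^ n * b ^ n) (\<lambda>(i, j).
     \<Prod>k<n. \<rho> $$ (copy_index a b n k i, copy_index a b n k j))"

definition entanglement_cost :: "nat \<Rightarrow> nat \<Rightarrow> complex mat \<Rightarrow> ereal" where
  "entanglement_cost a b \<rho> =
     Inf {limsup (\<lambda>n. ereal (log 2 (real (s n)) / real n)) | (s :: nat \<Rightarrow> nat) T.
            (\<forall>n. 0 < s n \<and> locc (s n) (s n) (a ^ n) (b ^ n) (T n)) \<and>
            (\<lambda>n. trace_norm (T n (projector (max_entangled_vec (s n)))
                              - bipartite_power a b n \<rho>)) \<longlonglongrightarrow> 0}"

end

theory Submission
  imports Defs "Jordan_Normal_Form.Spectral_Radius"
begin

text \<open>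
  A maximally entangled state of rank s is turned by LOCC into a mixture of vectors of Schmidt
  rank at most s. If this mixture is close to the n-th power of \<rho>, then the power is itself a
  mixture of vectors which on average are close to vectors of Schmidt rank at most s, so that
  their entropy of entanglement is at most 1 + log s + o(n). Extending the power by a classical
  record of the vector therefore gives I(A;B|E) / 2 \<le> 1 + log s + o(n). By the chain rule and
  strong subadditivity, this is at least n times the squashed entanglement of \<rho>.

  Strong subadditivity follows from the monotonicity of relative entropy under partial traces,
  for which relative entropy is written as an integral of suprema of linear functions.
\<close>

section \<open>Orthonormal families and the spectral theorem\<close>

text \<open>The usual route combines monotonicity under LOCC, additivity and asymptotic continuity
  of squashed entanglement. The obstacle is continuity: the extending system has no dimension bound,
  so an error estimate in terms of its dimension would be worthless. Here no two states of an
  extending system are ever compared. An ensemble of the approximating operator is carried over,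
  vector by vector, to an ensemble of the power, with total squared distance controlled by the trace
  norm. The entropy of each vector is then estimated through a subspace of dimension at most s. The
  loss is that distance times the logarithm of the local dimensions, hence linear in n with an
  arbitrarily small factor; after division by n it is negligible, and so is the additive 1. The
  number of vectors in the ensemble never enters.

  All ensembles are unnormalised, probabilities being squared norms. The \<open>eta\<close> terms
  that normalisation would remove cancel in the conditional mutual information, which leaves bounds
  linear in norms and distances that can be summed over the ensemble.\<close>

text \<open>Operators are functions of two indices, of which only the values on a finite index set
  matter. Tensor factors are then components of tuples, and reordering them is a bijection of
  the index set.\<close>

definition ip :: "'i set \<Rightarrow> ('i \<Rightarrow> complex) \<Rightarrow> ('i \<Rightarrow> complex) \<Rightarrow> complex" where
  "ip I f g = (\<Sum>i\<in>I. cnj (f i) * g i)"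

definition sesq :: "'i set \<Rightarrow> ('i \<Rightarrow> complex) \<Rightarrow> ('i \<Rightarrow> 'i \<Rightarrow> complex) \<Rightarrow> ('i \<Rightarrow> complex) \<Rightarrow> complex" where
  "sesq I f M g = (\<Sum>i\<in>I. \<Sum>j\<in>I. cnj (f i) * M i j * g j)"

definition orthonormal :: "'i set \<Rightarrow> 'k set \<Rightarrow> ('k \<Rightarrow> 'i \<Rightarrow> complex) \<Rightarrow> bool" where
  "orthonormal I K u \<longleftrightarrow> (\<forall>k\<in>K. \<forall>l\<in>K. ip I (u k) (u l) = (if k = l then 1 else 0))"

definition complete_family :: "'i set \<Rightarrow> 'k set \<Rightarrow> ('k \<Rightarrow> 'i \<Rightarrow> complex) \<Rightarrow> bool" where
  "complete_family I K u \<longleftrightarrow>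
     (\<forall>i\<in>I. \<forall>j\<in>I. (\<Sum>k\<in>K. u k i * cnj (u k j)) = (if i = j then 1 else 0))"

definition hermitian_on :: "'i set \<Rightarrow> ('i \<Rightarrow> 'i \<Rightarrow> complex) \<Rightarrow> bool" where
  "hermitian_on I M \<longleftrightarrow> (\<forall>i\<in>I. \<forall>j\<in>I. M j i = cnj (M i j))"

text \<open>The family u need not be complete: eigenvectors for the eigenvalue 0 may be left out.\<close>

definition spectral_on :: "'i set \<Rightarrow> 'k set \<Rightarrow> ('k \<Rightarrow> 'i \<Rightarrow> complex) \<Rightarrow> ('k \<Rightarrow> real)
    \<Rightarrow> ('i \<Rightarrow> 'i \<Rightarrow> complex) \<Rightarrow> bool" where
  "spectral_on I K u e M \<longleftrightarrow> finite K \<and> orthonormal I K u \<and>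
     (\<forall>i\<in>I. \<forall>j\<in>I. M i j = (\<Sum>k\<in>K. of_real (e k) * u k i * cnj (u k j)))"

lemma hermitian_onD: "hermitian_on I M \<Longrightarrow> i \<in> I \<Longrightarrow> j \<in> I \<Longrightarrow> M j i = cnj (M i j)"
  unfolding hermitian_on_def by blast

lemma hermitian_onI: "(\<And>i j. i \<in> I \<Longrightarrow> j \<in> I \<Longrightarrow> M j i = cnj (M i j)) \<Longrightarrow> hermitian_on I M"
  unfolding hermitian_on_def by blast

lemma cnj_ip: "cnj (ip I f g) = ip I g f"
  by (simp add: ip_def mult.commute)

lemma ip_cong: "(\<And>i. i \<in> I \<Longrightarrow> f i = f' i) \<Longrightarrow> (\<And>i. i \<in> I \<Longrightarrow> g i = g' i) \<Longrightarrow> ip I f g = ip I f' g'"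
  by (simp add: ip_def)

lemma ip_self: "ip I f f = of_real (\<Sum>i\<in>I. (cmod (f i))\<^sup>2)"
  unfolding ip_def of_real_sum
  by (intro sum.cong refl) (metis complex_norm_square mult.commute)

lemma ip_sum_right: "ip I f (\<lambda>i. \<Sum>k\<in>K. c k * g k i) = (\<Sum>k\<in>K. c k * ip I f (g k))"
proof -
  have "ip I f (\<lambda>i. \<Sum>k\<in>K. c k * g k i) = (\<Sum>i\<in>I. \<Sum>k\<in>K. c k * (cnj (f i) * g k i))"
    unfolding ip_def by (simp add: sum_distrib_left mult.left_commute)
  also have "\<dots> = (\<Sum>k\<in>K. \<Sum>i\<in>I. c k * (cnj (f i) * g k i))"
    by (rule sum.swap)
  finally show ?thesis unfolding ip_def by (simp add: sum_distrib_left)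
qed

lemma ip_sum_left: "ip I (\<lambda>i. \<Sum>k\<in>K. c k * g k i) f = (\<Sum>k\<in>K. cnj (c k) * ip I (g k) f)"
proof -
  have "ip I (\<lambda>i. \<Sum>k\<in>K. c k * g k i) f = cnj (ip I f (\<lambda>i. \<Sum>k\<in>K. c k * g k i))"
    by (simp add: cnj_ip)
  also have "\<dots> = (\<Sum>k\<in>K. cnj (c k) * ip I (g k) f)"
    unfolding ip_sum_right by (simp add: cnj_ip)
  finally show ?thesis .
qed

lemma sesq_eq_ip: "sesq I f M g = ip I f (\<lambda>i. \<Sum>j\<in>I. M i j * g j)"
  unfolding sesq_def ip_def by (simp add: sum_distrib_left mult.assoc)

text \<open>Pairing with \<open>w k\<close> recovers the coefficients, those beyond
  \<open>r0\<close> being 0. An expansion found at one stage of the Gram-Schmidt process thus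
  survives later enlargements of the family.\<close>

lemma orthonormal_expand:
  fixes w :: "nat \<Rightarrow> 'i \<Rightarrow> complex"
  assumes "orthonormal I {..<r} w" "r0 \<le> r" "\<forall>i\<in>I. f i = (\<Sum>k<r0. c k * w k i)" "i \<in> I"
  shows "f i = (\<Sum>k<r. ip I (w k) f * w k i)"
proof -
  have c: "ip I (w k) f = (if k < r0 then c k else 0)" if k: "k < r" for k
  proof -
    have "ip I (w k) f = ip I (w k) (\<lambda>i. \<Sum>k<r0. c k * w k i)"
      using assms(3) by (intro ip_cong) auto
    also have "\<dots> = (\<Sum>l<r0. c l * ip I (w k) (w l))" by (rule ip_sum_right)
    also have "\<dots> = (\<Sum>l<r0. if k = l then c l else 0)"
    proof (intro sum.cong refl)
      fix l assume "l \<in> {..<r0}"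
      then have "ip I (w k) (w l) = (if k = l then 1 else 0)"
        using assms(1) k less_le_trans[of l r0 r] assms(2) by (auto simp: orthonormal_def)
      then show "c l * ip I (w k) (w l) = (if k = l then c l else 0)" by simp
    qed
    also have "\<dots> = (if k < r0 then c k else 0)" by (simp add: sum.delta)
    finally show ?thesis .
  qed
  have "(\<Sum>k<r. ip I (w k) f * w k i) = (\<Sum>k<r. if k < r0 then c k * w k i else 0)"
    by (intro sum.cong refl) (simp add: c)
  also have "\<dots> = (\<Sum>k<r0. c k * w k i)"
    using assms(2) by (intro sum.mono_neutral_cong_right) auto
  finally show ?thesis using assms(3,4) by simp
qed

text \<open>One Gram-Schmidt step: subtract the projection and normalise the residual
  \<open>g\<close>. If \<open>g\<close> vanishes, the family stays as it is, whence
  \<open>r' \<le> Suc r\<close> and not equality.\<close>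

lemma orthonormal_step:
  fixes w :: "nat \<Rightarrow> 'i \<Rightarrow> complex"
  assumes fin: "finite I" and w: "orthonormal I {..<r} w"
  shows "\<exists>r' w' c. r \<le> r' \<and> r' \<le> Suc r \<and> orthonormal I {..<r'} w' \<and> (\<forall>k<r. w' k = w k) \<and>
    (\<forall>i\<in>I. f i = (\<Sum>k<r'. c k * w' k i))"
proof -
  define g where "g i = f i - (\<Sum>k<r. ip I (w k) f * w k i)" for i
  define N where "N = (\<Sum>i\<in>I. (cmod (g i))\<^sup>2)"
  have orth: "ip I (w l) g = 0" if l: "l < r" for l
  proof -
    have "ip I (w l) g = ip I (w l) f - ip I (w l) (\<lambda>i. \<Sum>k<r. ip I (w k) f * w k i)"
      unfolding ip_def g_def by (simp add: algebra_simps sum_subtractf)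
    also have "ip I (w l) (\<lambda>i. \<Sum>k<r. ip I (w k) f * w k i) = (\<Sum>k<r. ip I (w k) f * ip I (w l) (w k))"
      by (rule ip_sum_right)
    also have "\<dots> = (\<Sum>k<r. if l = k then ip I (w k) f else 0)"
      using w l by (intro sum.cong refl) (auto simp: orthonormal_def)
    also have "\<dots> = ip I (w l) f" using l by (simp add: sum.delta)
    finally show ?thesis by simp
  qed
  show ?thesis
  proof (cases "N = 0")
    case True
    then have "\<forall>i\<in>I. g i = 0" using fin by (simp add: N_def sum_nonneg_eq_0_iff)
    then have "\<forall>i\<in>I. f i = (\<Sum>k<r. ip I (w k) f * w k i)" by (simp add: g_def)
    then show ?thesis using w by (intro exI[of _ r] exI[of _ w] exI[of _ "\<lambda>k. ip I (w k) f"]) simp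
  next
    case False
    then have N: "N > 0" unfolding N_def by (metis less_eq_real_def sum_nonneg zero_le_power2)
    define h where "h i = g i * of_real (1 / sqrt N)" for i
    define w' where "w' k = (if k = r then h else w k)" for k
    have gh: "ip I v h = ip I v g * of_real (1 / sqrt N)" for v
      unfolding ip_def h_def by (simp add: sum_distrib_right sum_divide_distrib)
    have hg: "ip I h v = ip I g v * of_real (1 / sqrt N)" for v
      by (metis cnj_ip gh complex_cnj_mult complex_cnj_complex_of_real)
    have hh: "ip I h h = 1"
    proof -
      have "ip I h h = of_real (N * (1 / sqrt N) * (1 / sqrt N))"
        unfolding hg[of h] unfolding gh[of g] unfolding ip_self N_def[symmetric] of_real_mult ..
      also have "N * (1 / sqrt N) * (1 / sqrt N) = 1" using N by (simp add: field_simps)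
      finally show ?thesis by simp
    qed
    have h0: "ip I (w l) h = 0" "ip I h (w l) = 0" if "l < r" for l
    proof -
      show "ip I (w l) h = 0" unfolding gh[of "w l"] orth[OF that] by simp
      then show "ip I h (w l) = 0" using cnj_ip[of I "w l" h] by simp
    qed
    have on: "orthonormal I {..<Suc r} w'"
      using w h0 hh unfolding orthonormal_def w'_def by auto
    have ex: "\<forall>i\<in>I. f i = (\<Sum>k<Suc r. (if k = r then of_real (sqrt N) else ip I (w k) f) * w' k i)"
    proof
      fix i assume "i \<in> I"
      have "(\<Sum>k<Suc r. (if k = r then of_real (sqrt N) else ip I (w k) f) * w' k i)
          = (\<Sum>k<r. ip I (w k) f * w k i) + of_real (sqrt N) * h i"
        by (simp add: w'_def)
      also have "of_real (sqrt N) * h i = g i" using N by (simp add: h_def)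
      finally show "f i = (\<Sum>k<Suc r. (if k = r then of_real (sqrt N) else ip I (w k) f) * w' k i)"
        by (simp add: g_def)
    qed
    show ?thesis
      by (intro exI[of _ "Suc r"] exI[of _ w']
            exI[of _ "\<lambda>k. if k = r then of_real (sqrt N) else ip I (w k) f"]) (use on ex in \<open>auto simp: w'_def\<close>)
  qed
qed

text \<open>The bound on \<open>r'\<close> will show that the span of the s left factors of a vector
  of Schmidt rank at most s has dimension at most s.\<close>

lemma orthonormal_extend:
  fixes w :: "nat \<Rightarrow> 'i \<Rightarrow> complex"
  assumes fin: "finite I" and w: "orthonormal I {..<r} w"
  shows "\<exists>r' w'. r \<le> r' \<and> r' \<le> r + length fs \<and> orthonormal I {..<r'} w' \<and> (\<forall>k<r. w' k = w k) \<and>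
    (\<forall>f\<in>set fs. \<forall>i\<in>I. f i = (\<Sum>k<r'. ip I (w' k) f * w' k i))"
  using w
proof (induction fs arbitrary: r w)
  case Nil
  then show ?case by (intro exI[of _ r] exI[of _ w]) simp
next
  case (Cons f fs)
  obtain r1 w1 c where 1: "r \<le> r1" "r1 \<le> Suc r" "orthonormal I {..<r1} w1" "\<forall>k<r. w1 k = w k"
    "\<forall>i\<in>I. f i = (\<Sum>k<r1. c k * w1 k i)"
    using orthonormal_step[OF fin Cons.prems, of f] by blast
  obtain r2 w2 where 2: "r1 \<le> r2" "r2 \<le> r1 + length fs" "orthonormal I {..<r2} w2" "\<forall>k<r1. w2 k = w1 k"
    "\<forall>f\<in>set fs. \<forall>i\<in>I. f i = (\<Sum>k<r2. ip I (w2 k) f * w2 k i)"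
    using Cons.IH[OF 1(3)] by blast
  have "\<forall>i\<in>I. f i = (\<Sum>k<r1. c k * w2 k i)" using 1(5) 2(4) by simp
  from orthonormal_expand[OF 2(3) 2(1) this]
  have "\<forall>i\<in>I. f i = (\<Sum>k<r2. ip I (w2 k) f * w2 k i)" by blast
  with 1 2 show ?case by (intro exI[of _ r2] exI[of _ w2]) auto
qed

text \<open>Gram-Schmidt is applied to the coordinate vectors \<open>\<delta> j\<close>. That they
  lie in the span is completeness.\<close>

lemma orthonormal_completion:
  fixes w :: "nat \<Rightarrow> 'i \<Rightarrow> complex"
  assumes fin: "finite I" and w: "orthonormal I {..<r} w"
  shows "r \<le> card I \<and>
    (\<exists>w'. orthonormal I {..<card I} w' \<and> complete_family I {..<card I} w' \<and> (\<forall>k<r. w' k = w k))"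
proof -
  define \<delta> where "\<delta> j = (\<lambda>i::'i. if i = j then 1 else 0 :: complex)" for j
  obtain xs where xs: "set xs = I" using fin finite_list by auto
  obtain r' w' where *: "r \<le> r'" "orthonormal I {..<r'} w'" "\<forall>k<r. w' k = w k"
    "\<forall>f\<in>set (map \<delta> xs). \<forall>i\<in>I. f i = (\<Sum>k<r'. ip I (w' k) f * w' k i)"
    using orthonormal_extend[OF fin w, of "map \<delta> xs"] by blast
  have ipd: "ip I v (\<delta> j) = cnj (v j)" if "j \<in> I" for v j
    using that fin unfolding ip_def \<delta>_def by (simp add: if_distrib[of "\<lambda>x. _ * x"] cong: if_cong)
  have comp: "complete_family I {..<r'} w'"
    unfolding complete_family_def
  proof (intro ballI)
    fix i j assume ij: "i \<in> I" "j \<in> I"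
    have "\<delta> j i = (\<Sum>k<r'. ip I (w' k) (\<delta> j) * w' k i)" using *(4) ij xs by auto
    then have "\<delta> j i = (\<Sum>k<r'. cnj (w' k j) * w' k i)" unfolding ipd[OF ij(2)] .
    then show "(\<Sum>k<r'. w' k i * cnj (w' k j)) = (if i = j then 1 else 0)"
      by (simp add: mult.commute \<delta>_def)
  qed
  \<comment> \<open>The trace of the resolution of the identity, counted over \<open>I\<close> and
    over the family, gives the size of the family.\<close>
  have "(of_nat (card I) :: complex) = (\<Sum>i\<in>I. \<Sum>k<r'. w' k i * cnj (w' k i))"
    using comp by (simp add: complete_family_def)
  also have "\<dots> = (\<Sum>k<r'. ip I (w' k) (w' k))"
    unfolding ip_def by (subst sum.swap) (simp add: mult.commute)
  also have "\<dots> = of_nat r'" using *(2) by (simp add: orthonormal_def)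
  finally have "card I = r'" by simp
  then show ?thesis using * comp by auto
qed

section \<open>Parseval's identity and dual bases\<close>

lemma parseval:
  assumes "finite I" "complete_family I K u"
  shows "ip I f g = (\<Sum>k\<in>K. cnj (ip I (u k) f) * ip I (u k) g)"
proof -
  have "(\<Sum>k\<in>K. cnj (ip I (u k) f) * ip I (u k) g)
      = (\<Sum>k\<in>K. \<Sum>i\<in>I. \<Sum>j\<in>I. (u k i * cnj (u k j)) * (cnj (f i) * g j))"
    unfolding cnj_ip unfolding ip_def unfolding sum_product by (simp only: mult_ac)
  also have "\<dots> = (\<Sum>i\<in>I. \<Sum>j\<in>I. \<Sum>k\<in>K. (u k i * cnj (u k j)) * (cnj (f i) * g j))"
    by (subst sum.swap) (intro sum.cong refl sum.swap)
  also have "\<dots> = (\<Sum>i\<in>I. \<Sum>j\<in>I. (if i = j then 1 else 0) * (cnj (f i) * g j))"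
    using assms(2) by (simp add: sum_distrib_right[symmetric] complete_family_def)
  also have "\<dots> = ip I f g"
    using assms(1) unfolding ip_def by (simp add: if_distrib[of "\<lambda>x. x * _"] cong: if_cong)
  finally show ?thesis by simp
qed

lemma parseval_norm:
  assumes "finite I" "complete_family I K u"
  shows "(\<Sum>i\<in>I. (cmod (f i))\<^sup>2) = (\<Sum>k\<in>K. (cmod (ip I (u k) f))\<^sup>2)"
proof -
  have "complex_of_real (\<Sum>i\<in>I. (cmod (f i))\<^sup>2) = (\<Sum>k\<in>K. cnj (ip I (u k) f) * ip I (u k) f)"
    using parseval[OF assms, of f f] by (simp add: ip_self)
  also have "\<dots> = of_real (\<Sum>k\<in>K. (cmod (ip I (u k) f))\<^sup>2)"
    unfolding of_real_sum by (intro sum.cong refl) (metis complex_norm_square mult.commute)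
  finally show ?thesis using of_real_eq_iff by blast
qed

text \<open>\<open>s\<close> and \<open>t\<close> are dual bases. For an orthonormal basis they
  coincide; two different ones occur in \<open>dominated_decomposition\<close>, where they arise
  from an orthonormal basis through a square root of an operator and its inverse.\<close>

lemma biorthogonal_expand:
  assumes fin: "finite I" and d: "\<And>i j. i \<in> I \<Longrightarrow> j \<in> I \<Longrightarrow> (\<Sum>m\<in>K. s m i * cnj (t m j)) = (if i = j then 1 else 0)"
    and i: "i \<in> I"
  shows "f i = (\<Sum>m\<in>K. ip I (t m) f * s m i)"
proof -
  have "(\<Sum>m\<in>K. ip I (t m) f * s m i) = (\<Sum>m\<in>K. \<Sum>j\<in>I. (s m i * cnj (t m j)) * f j)"
    unfolding ip_def sum_distrib_right by (simp only: mult_ac)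
  also have "\<dots> = (\<Sum>j\<in>I. (if i = j then 1 else 0) * f j)"
    by (subst sum.swap) (simp add: sum_distrib_right[symmetric] d i)
  also have "\<dots> = f i" using fin i by (simp add: if_distrib[of "\<lambda>x. x * _"] cong: if_cong)
  finally show ?thesis by simp
qed

lemma biorthogonal_kernel_expand:
  assumes fin: "finite I" and d: "\<And>i j. i \<in> I \<Longrightarrow> j \<in> I \<Longrightarrow> (\<Sum>m\<in>K. s m i * cnj (t m j)) = (if i = j then 1 else 0)"
    and ij: "i \<in> I" "j \<in> I"
  shows "M i j = (\<Sum>m\<in>K. \<Sum>m'\<in>K. sesq I (t m) M (t m') * s m i * cnj (s m' j))"
proof -
  have d': "(\<Sum>m\<in>K. t m q * cnj (s m j)) = (if q = j then 1 else 0)" if "q \<in> I" for q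
  proof -
    have "(\<Sum>m\<in>K. t m q * cnj (s m j)) = cnj (\<Sum>m\<in>K. s m j * cnj (t m q))" by (simp add: mult.commute)
    then show ?thesis using d[OF ij(2) that] by auto
  qed
  have "(\<Sum>m\<in>K. \<Sum>m'\<in>K. sesq I (t m) M (t m') * s m i * cnj (s m' j))
    = (\<Sum>m\<in>K. \<Sum>m'\<in>K. \<Sum>p\<in>I. \<Sum>q\<in>I. M p q * (s m i * cnj (t m p)) * (t m' q * cnj (s m' j)))"
    unfolding sesq_def sum_distrib_right by (simp only: mult_ac)
  also have "\<dots> = (\<Sum>m\<in>K. \<Sum>p\<in>I. \<Sum>q\<in>I. \<Sum>m'\<in>K. M p q * (s m i * cnj (t m p)) * (t m' q * cnj (s m' j)))"
    by (rule sum.cong[OF refl]) (subst sum.swap, intro sum.cong[OF refl] sum.swap)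
  also have "\<dots> = (\<Sum>p\<in>I. \<Sum>q\<in>I. \<Sum>m\<in>K. \<Sum>m'\<in>K. M p q * (s m i * cnj (t m p)) * (t m' q * cnj (s m' j)))"
    by (subst sum.swap) (intro sum.cong[OF refl] sum.swap)
  also have "\<dots> = (\<Sum>p\<in>I. \<Sum>q\<in>I. M p q * (if i = p then 1 else 0) * (if q = j then 1 else 0))"
    using ij by (intro sum.cong refl) (simp add: sum_distrib_left[symmetric] sum_distrib_right[symmetric] d d' mult.assoc)
  also have "\<dots> = (\<Sum>p\<in>I. if i = p then (\<Sum>q\<in>I. if q = j then M p q else 0) else 0)"
    by (intro sum.cong refl) (auto intro!: sum.cong)
  also have "\<dots> = M i j" using fin ij by simp
  finally show ?thesis by simp
qed

section \<open>Eigenvectors of Hermitian kernels\<close>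

lemma cnj_sesq:
  assumes "hermitian_on I M"
  shows "cnj (sesq I f M g) = sesq I g M f"
proof -
  have "cnj (sesq I f M g) = (\<Sum>i\<in>I. \<Sum>j\<in>I. f i * M j i * cnj (g j))"
    unfolding sesq_def cnj_sum complex_cnj_mult complex_cnj_cnj
  proof (intro sum.cong refl)
    fix i j assume "i \<in> I" "j \<in> I"
    then have "M j i = cnj (M i j)" by (intro hermitian_onD[OF assms])
    then show "f i * cnj (M i j) * cnj (g j) = f i * M j i * cnj (g j)" by simp
  qed
  also have "\<dots> = (\<Sum>j\<in>I. \<Sum>i\<in>I. f i * M j i * cnj (g j))" by (rule sum.swap)
  also have "\<dots> = sesq I g M f" unfolding sesq_def by (simp only: mult_ac)
  finally show ?thesis .
qed

text \<open>A complex matrix has nonempty spectrum. The index set is an initial segment of the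
  naturals so that the kernel can be read as a matrix.\<close>

lemma hermitian_eigenvector:
  fixes M :: "nat \<Rightarrow> nat \<Rightarrow> complex"
  assumes n: "n > 0" and h: "hermitian_on {..<n} M"
  obtains x and lam :: real where "ip {..<n} x x = 1"
    "\<And>i. i < n \<Longrightarrow> (\<Sum>j<n. M i j * x j) = of_real lam * x i"
proof -
  define A where "A = mat n n (\<lambda>(i, j). M i j)"
  have A: "A \<in> carrier_mat n n" by (simp add: A_def)
  obtain k where "eigenvalue A k" using spectrum_non_empty[OF A n] unfolding spectrum_def by auto
  then obtain v where v: "v \<in> carrier_vec n" "v \<noteq> 0\<^sub>v n" "A *\<^sub>v v = k \<cdot>\<^sub>v v"
    unfolding eigenvalue_def eigenvector_def using A by auto
  have dv: "dim_vec v = n" using v(1) by simp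
  have ev: "(\<Sum>j<n. M i j * v $ j) = k * v $ i" if i: "i < n" for i
  proof -
    have "(A *\<^sub>v v) $ i = (\<Sum>j<n. M i j * v $ j)"
      using i v(1) A by (auto simp: A_def scalar_prod_def atLeast0LessThan intro!: sum.cong)
    then show ?thesis using v i by simp
  qed
  define N where "N = (\<Sum>i<n. (cmod (v $ i))\<^sup>2)"
  obtain i0 where "i0 < n" "v $ i0 \<noteq> 0" using v(2) dv by (metis eq_vecI index_zero_vec)
  then have N: "N > 0" unfolding N_def by (intro sum_pos2[of _ i0]) auto
  have vv: "ip {..<n} (\<lambda>i. v $ i) (\<lambda>i. v $ i) = of_real N" by (simp add: ip_self N_def)
  have s: "sesq {..<n} (\<lambda>i. v $ i) M (\<lambda>i. v $ i) = k * of_real N"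
  proof -
    have "sesq {..<n} (\<lambda>i. v $ i) M (\<lambda>i. v $ i) = ip {..<n} (\<lambda>i. v $ i) (\<lambda>i. k * v $ i)"
      unfolding sesq_eq_ip by (intro ip_cong) (auto simp: ev)
    also have "\<dots> = k * ip {..<n} (\<lambda>i. v $ i) (\<lambda>i. v $ i)"
      by (simp add: ip_def sum_distrib_left mult_ac)
    finally show ?thesis by (simp add: vv)
  qed
  \<comment> \<open>A Hermitian form is real on the diagonal, and its value at the eigenvector is
    \<open>k\<close> times the positive number \<open>N\<close>.\<close>
  have "cnj (k * of_real N) = k * of_real N" using cnj_sesq[OF h] s by metis
  then have "cnj k = k" using N by simp
  then obtain lam where k: "k = of_real lam" by (metis Reals_cases Reals_cnj_iff)
  show thesis
  proof (rule that[of "\<lambda>i. v $ i * of_real (1 / sqrt N)" lam])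
    have "ip {..<n} (\<lambda>i. v $ i * of_real (1 / sqrt N)) (\<lambda>i. v $ i * of_real (1 / sqrt N))
        = of_real (1 / sqrt N) * of_real (1 / sqrt N) * ip {..<n} (\<lambda>i. v $ i) (\<lambda>i. v $ i)"
      unfolding ip_def by (simp add: sum_distrib_left sum_divide_distrib mult_ac)
    also have "\<dots> = of_real (1 / sqrt N * (1 / sqrt N) * N)" unfolding vv of_real_mult ..
    also have "1 / sqrt N * (1 / sqrt N) * N = 1" using N by (simp add: field_simps)
    finally show "ip {..<n} (\<lambda>i. v $ i * of_real (1 / sqrt N)) (\<lambda>i. v $ i * of_real (1 / sqrt N)) = 1" by simp
    fix i assume "i < n"
    then show "(\<Sum>j<n. M i j * (v $ j * of_real (1 / sqrt N))) = of_real lam * (v $ i * of_real (1 / sqrt N))"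
      using ev[of i] k by (simp add: mult.assoc[symmetric] sum_distrib_right[symmetric] sum_divide_distrib[symmetric])
  qed
qed

lemma sesq_sum_right: "sesq I f M (\<lambda>i. \<Sum>l\<in>J. g l * x l i) = (\<Sum>l\<in>J. g l * sesq I f M (x l))"
proof -
  have "sesq I f M (\<lambda>i. \<Sum>l\<in>J. g l * x l i) = (\<Sum>i\<in>I. \<Sum>j\<in>I. \<Sum>l\<in>J. g l * (cnj (f i) * M i j * x l j))"
    unfolding sesq_def sum_distrib_left by (simp only: mult_ac)
  also have "\<dots> = (\<Sum>l\<in>J. \<Sum>i\<in>I. \<Sum>j\<in>I. g l * (cnj (f i) * M i j * x l j))"
    by (subst (2) sum.swap, subst sum.swap) (rule refl)
  finally show ?thesis unfolding sesq_def by (simp only: sum_distrib_left)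
qed

text \<open>Deflation: the eigenvectors found so far are completed to a basis, \<open>M\<close> is
  compressed to the span of the remaining basis vectors, and an eigenvector of the compression is an
  eigenvector of \<open>M\<close>, because \<open>M\<close> leaves the complement of its
  eigenvectors invariant.\<close>

lemma hermitian_eigenvectors:
  assumes fin: "finite I" and h: "hermitian_on I M" and "r \<le> card I"
  shows "\<exists>w (e :: nat \<Rightarrow> real). orthonormal I {..<r} w \<and> (\<forall>k<r. \<forall>f. sesq I f M (w k) = of_real (e k) * ip I f (w k))"
  using assms(3)
proof (induction r)
  case 0
  then show ?case by (simp add: orthonormal_def)
next
  case (Suc r)
  then obtain w and e :: "nat \<Rightarrow> real" where w: "orthonormal I {..<r} w"
    and e: "\<And>k f. k < r \<Longrightarrow> sesq I f M (w k) = of_real (e k) * ip I f (w k)" by auto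
  obtain w' where w': "orthonormal I {..<card I} w'" "complete_family I {..<card I} w'" "\<And>k. k < r \<Longrightarrow> w' k = w k"
    using orthonormal_completion[OF fin w] by blast
  define n where "n = card I - r"
  have n: "n > 0" "card I = r + n" using Suc.prems by (auto simp: n_def)
  define M' where "M' j l = sesq I (w' (r + j)) M (w' (r + l))" for j l
  have "hermitian_on {..<n} M'" unfolding M'_def by (intro hermitian_onI) (simp add: cnj_sesq[OF h])
  from hermitian_eigenvector[OF n(1) this] obtain y and lam :: real where y: "ip {..<n} y y = 1"
    "\<And>i. i < n \<Longrightarrow> (\<Sum>j<n. M' i j * y j) = of_real lam * y i" by blast
  define v where "v i = (\<Sum>j<n. y j * w' (r + j) i)" for i
  have w'v: "ip I (w' k) v = (if k < r then 0 else y (k - r))" if k: "k < card I" for k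
  proof -
    have "ip I (w' k) v = (\<Sum>j<n. y j * ip I (w' k) (w' (r + j)))"
      unfolding v_def by (rule ip_sum_right)
    also have "\<dots> = (\<Sum>j<n. if j = k - r then (if k < r then 0 else y j) else 0)"
      using w'(1) k n(2) by (intro sum.cong refl) (auto simp: orthonormal_def)
    also have "\<dots> = (if k < r then 0 else y (k - r))" using k n by auto
    finally show ?thesis .
  qed
  have "ip I v v = (\<Sum>j<n. cnj (y j) * ip I (w' (r + j)) v)" unfolding v_def[abs_def] by (rule ip_sum_left)
  also have "\<dots> = ip {..<n} y y" unfolding ip_def[of "{..<n}"] using n by (intro sum.cong refl) (simp add: w'v)
  finally have vv: "ip I v v = 1" using y(1) by simp
  have expand: "g i = (\<Sum>k<card I. ip I (w' k) g * w' k i)" if "i \<in> I" for g i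
    using w'(2) that by (intro biorthogonal_expand[OF fin]) (auto simp: complete_family_def)
  \<comment> \<open>The eigenvalue equation is tested on the basis: on old eigenvectors both sides
    vanish, on the others it is the equation for the compression \<open>M'\<close>.\<close>
  have M'v: "sesq I (w' k) M v = of_real lam * ip I (w' k) v" if k: "k < card I" for k
  proof (cases "k < r")
    case True
    have "ip I v (w' k) = 0" using w'v[OF k] True cnj_ip[of I "w' k" v] by simp
    then have "sesq I v M (w' k) = 0" using e[OF True, of v] w'(3)[OF True] by simp
    then have "sesq I (w' k) M v = 0" using cnj_sesq[OF h, of v "w' k"] by simp
    then show ?thesis using True w'v[OF k] by simp
  next
    case False
    have "sesq I (w' k) M v = (\<Sum>l<n. M' (k - r) l * y l)"
      unfolding v_def[abs_def] sesq_sum_right M'_def using False by (simp add: mult.commute)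
    then show ?thesis using False w'v[OF k] y(2)[of "k - r"] k n by simp
  qed
  have Mv: "sesq I f M v = of_real lam * ip I f v" for f
  proof -
    have "(\<Sum>j\<in>I. M i j * v j) = of_real lam * v i" if "i \<in> I" for i
    proof -
      have "(\<Sum>j\<in>I. M i j * v j) = (\<Sum>k<card I. sesq I (w' k) M v * w' k i)"
        unfolding sesq_eq_ip by (rule expand[OF that])
      also have "\<dots> = of_real lam * (\<Sum>k<card I. ip I (w' k) v * w' k i)"
        by (simp add: M'v sum_distrib_left mult.assoc)
      finally show ?thesis using expand[OF that, of v] by simp
    qed
    then have "sesq I f M v = ip I f (\<lambda>i. of_real lam * v i)" unfolding sesq_eq_ip by (intro ip_cong) auto
    then show ?thesis by (simp add: ip_def sum_distrib_left mult_ac)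
  qed
  have wv: "ip I (w k) v = 0" "ip I v (w k) = 0" if "k < r" for k
  proof -
    show "ip I (w k) v = 0" using w'v[of k] that w'(3) n by simp
    then show "ip I v (w k) = 0" using cnj_ip[of I "w k" v] by simp
  qed
  have "orthonormal I {..<Suc r} (w(r := v))"
    using w wv vv unfolding orthonormal_def by (auto simp: less_Suc_eq)
  moreover have "\<forall>k<Suc r. \<forall>f. sesq I f M ((w(r := v)) k) = of_real ((e(r := lam)) k) * ip I f ((w(r := v)) k)"
    using e Mv by (auto simp: less_Suc_eq)
  ultimately show ?case by blast
qed

text \<open>The eigenvectors are relabelled by \<open>I\<close> itself, which keeps eigenbases on
  product index sets indexed by tuples.\<close>

lemma spectral_theorem:
  assumes fin: "finite I" and h: "hermitian_on I M"
  obtains u e where "spectral_on I I u e M" "complete_family I I u"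
proof -
  obtain w and e :: "nat \<Rightarrow> real" where w: "orthonormal I {..<card I} w"
    and e: "\<And>k f. k < card I \<Longrightarrow> sesq I f M (w k) = of_real (e k) * ip I f (w k)"
    using hermitian_eigenvectors[OF fin h order_refl] by auto
  obtain w' where "complete_family I {..<card I} w'" "\<forall>k<card I. w' k = w k"
    using orthonormal_completion[OF fin w] by blast
  then have c: "(\<Sum>k<card I. w k i * cnj (w k j)) = (if i = j then 1 else 0)" if "i \<in> I" "j \<in> I" for i j
    using that by (simp add: complete_family_def)
  obtain g where g: "bij_betw g I {..<card I}"
    using ex_bij_betw_finite_nat[OF fin] by (auto simp: atLeast0LessThan)
  note re = sum.reindex_bij_betw[OF g]
  have gI: "g k < card I" if "k \<in> I" for k using g that by (auto simp: bij_betw_def)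
  have ge: "g k = g l \<longleftrightarrow> k = l" if "k \<in> I" "l \<in> I" for k l
    using g that by (auto simp: bij_betw_def inj_on_def)
  have "M i j = (\<Sum>k\<in>I. of_real (e (g k)) * w (g k) i * cnj (w (g k) j))" if ij: "i \<in> I" "j \<in> I" for i j
  proof -
    have "M i j = (\<Sum>k<card I. \<Sum>l<card I. sesq I (w k) M (w l) * w k i * cnj (w l j))"
      by (rule biorthogonal_kernel_expand[OF fin c ij])
    also have "\<dots> = (\<Sum>k<card I. \<Sum>l<card I. if k = l then of_real (e k) * w k i * cnj (w l j) else 0)"
      using w by (intro sum.cong refl) (auto simp: e orthonormal_def)
    also have "\<dots> = (\<Sum>k<card I. of_real (e k) * w k i * cnj (w k j))" by simp
    finally show ?thesis unfolding re[of "\<lambda>k. of_real (e k) * w k i * cnj (w k j)"] .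
  qed
  moreover have "orthonormal I I (\<lambda>k. w (g k))" using w gI ge by (simp add: orthonormal_def)
  moreover have "complete_family I I (\<lambda>k. w (g k))"
    unfolding complete_family_def using c by (simp add: re[of "\<lambda>k. w k i * cnj (w k j)" for i j])
  ultimately show thesis using fin by (intro that[of "\<lambda>k. w (g k)" "\<lambda>k. e (g k)"]) (auto simp: spectral_on_def)
qed


section \<open>Entropy and positive operators\<close>

definition psd_on :: "'i set \<Rightarrow> ('i \<Rightarrow> 'i \<Rightarrow> complex) \<Rightarrow> bool" where
  "psd_on I M \<longleftrightarrow> hermitian_on I M \<and> (\<forall>f. 0 \<le> Re (sesq I f M f))"

definition eta :: "real \<Rightarrow> real" where
  "eta x = - x * log 2 x"

text \<open>The operator is not assumed to have trace 1. The choice ranges over complete eigenbases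
  indexed by \<open>I\<close>; \<open>ent_eq\<close> then permits reading the entropy off any
  decomposition, whatever its index set and even if eigenvectors for 0 are missing.\<close>

definition ent :: "'i set \<Rightarrow> ('i \<Rightarrow> 'i \<Rightarrow> complex) \<Rightarrow> real" where
  "ent I M = (SOME r. \<exists>u e. spectral_on I I u e M \<and> complete_family I I u \<and> r = (\<Sum>k\<in>I. eta (e k)))"

lemma eta_0 [simp]: "eta 0 = 0"
  by (simp add: eta_def)

lemma cnj_mult_self: "cnj z * z = of_real ((cmod z)\<^sup>2)"
  by (metis complex_norm_square mult.commute)

lemma mult_cnj_self: "z * cnj z = of_real ((cmod z)\<^sup>2)"
  by (metis complex_norm_square)

lemma cmod_ip_commute: "cmod (ip I f g) = cmod (ip I g f)"
  by (metis cnj_ip complex_mod_cnj)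

section \<open>Independence of the entropy from the decomposition\<close>

lemma spectral_sesq:
  assumes "spectral_on I K u e M"
  shows "sesq I f M g = (\<Sum>k\<in>K. of_real (e k) * ip I f (u k) * ip I (u k) g)"
proof -
  have "sesq I f M g = (\<Sum>i\<in>I. \<Sum>j\<in>I. \<Sum>k\<in>K. of_real (e k) * ((cnj (f i) * u k i) * (cnj (u k j) * g j)))"
    using assms unfolding sesq_def spectral_on_def
    by (intro sum.cong refl) (simp add: sum_distrib_left sum_distrib_right mult_ac)
  also have "\<dots> = (\<Sum>k\<in>K. \<Sum>i\<in>I. \<Sum>j\<in>I. of_real (e k) * ((cnj (f i) * u k i) * (cnj (u k j) * g j)))"
    by (subst (2) sum.swap, subst sum.swap) (rule refl)
  also have "\<dots> = (\<Sum>k\<in>K. of_real (e k) * (ip I f (u k) * ip I (u k) g))"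
    unfolding ip_def sum_product by (simp only: sum_distrib_left)
  finally show ?thesis by (simp only: mult.assoc)
qed

lemma spectral_sesq_self:
  assumes "spectral_on I K u e M"
  shows "sesq I f M f = of_real (\<Sum>k\<in>K. e k * (cmod (ip I (u k) f))\<^sup>2)"
  unfolding spectral_sesq[OF assms] of_real_sum
proof (intro sum.cong refl)
  fix k
  have "ip I f (u k) * ip I (u k) f = of_real ((cmod (ip I (u k) f))\<^sup>2)"
    using cnj_mult_self[of "ip I (u k) f"] by (simp only: cnj_ip)
  then show "of_real (e k) * ip I f (u k) * ip I (u k) f = of_real (e k * (cmod (ip I (u k) f))\<^sup>2)"
    by (simp add: mult.assoc)
qed

lemma orthonormal_ip: "orthonormal I K u \<Longrightarrow> k \<in> K \<Longrightarrow> l \<in> K \<Longrightarrow> ip I (u k) (u l) = (if k = l then 1 else 0)"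
  by (simp add: orthonormal_def)

lemma spectral_onD:
  assumes "spectral_on I K u e M"
  shows "finite K" "orthonormal I K u"
    "\<And>i j. i \<in> I \<Longrightarrow> j \<in> I \<Longrightarrow> M i j = (\<Sum>k\<in>K. of_real (e k) * u k i * cnj (u k j))"
  using assms by (auto simp: spectral_on_def)

lemma spectral_eigen:
  assumes "spectral_on I K u e M" "k \<in> K"
  shows "sesq I (u k) M g = of_real (e k) * ip I (u k) g" "sesq I g M (u k) = of_real (e k) * ip I g (u k)"
proof -
  note K = spectral_onD(1)[OF assms(1)]
  have *: "ip I (u k) (u l) = (if k = l then 1 else 0)" "ip I (u l) (u k) = (if k = l then 1 else 0)" if "l \<in> K" for l
    using spectral_onD(2)[OF assms(1)] that assms(2) by (auto simp: orthonormal_ip)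
  have "sesq I (u k) M g = (\<Sum>l\<in>K. if k = l then of_real (e l) * ip I (u l) g else 0)"
    unfolding spectral_sesq[OF assms(1)] by (intro sum.cong refl) (simp add: *)
  then show "sesq I (u k) M g = of_real (e k) * ip I (u k) g" using K assms(2) by simp
  have "sesq I g M (u k) = (\<Sum>l\<in>K. if k = l then of_real (e l) * ip I g (u l) else 0)"
    unfolding spectral_sesq[OF assms(1)] by (intro sum.cong refl) (simp add: *)
  then show "sesq I g M (u k) = of_real (e k) * ip I g (u k)" using K assms(2) by simp
qed

lemma spectral_hermitian:
  assumes "spectral_on I K u e M"
  shows "hermitian_on I M"
  by (intro hermitian_onI) (simp add: spectral_onD(3)[OF assms] mult_ac)

lemma orthonormal_norm:
  assumes "orthonormal I K u" "k \<in> K"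
  shows "(\<Sum>i\<in>I. (cmod (u k i))\<^sup>2) = 1"
proof -
  have "complex_of_real (\<Sum>i\<in>I. (cmod (u k i))\<^sup>2) = of_real 1"
    using orthonormal_ip[OF assms(1) assms(2) assms(2)] by (simp add: ip_self del: of_real_sum)
  then show ?thesis using of_real_eq_iff by blast
qed

text \<open>The two spectral decompositions are compared through the doubly (sub)stochastic matrix of
  squared overlaps, which is supported on pairs of equal eigenvalues.\<close>

lemma spectral_sum_unique:
  fixes f :: "real \<Rightarrow> real"
  assumes fin: "finite I" and u: "spectral_on I K u e M" and v: "spectral_on I L v d M"
    and comp: "complete_family I L v" and f0: "f 0 = 0"
  shows "(\<Sum>k\<in>K. f (e k)) = (\<Sum>l\<in>L. f (d l))"
proof -
  define w where "w k l = (cmod (ip I (v l) (u k)))\<^sup>2" for k l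
  have eq: "w k l * f (e k) = w k l * f (d l)" if "k \<in> K" "l \<in> L" for k l
  proof -
    have "of_real (e k) * ip I (v l) (u k) = of_real (d l) * ip I (v l) (u k)"
      using spectral_eigen(2)[OF u that(1), of "v l"] spectral_eigen(1)[OF v that(2), of "u k"] by metis
    then have "e k = d l \<or> w k l = 0" by (auto simp: w_def)
    then show ?thesis by auto
  qed
  have row: "(\<Sum>l\<in>L. w k l) = 1" if "k \<in> K" for k
    using parseval_norm[OF fin comp, of "u k"] orthonormal_norm[OF spectral_onD(2)[OF u] that]
    by (simp add: w_def)
  \<comment> \<open>As \<open>u\<close> may be incomplete, a column is only known to sum to 1 where
    \<open>d l\<close> is nonzero; elsewhere \<open>f 0 = 0\<close> makes up for it.\<close>
  have col: "(\<Sum>k\<in>K. w k l) * f (d l) = f (d l)" if l: "l \<in> L" for l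
  proof (cases "d l = 0")
    case False
    have "complex_of_real (\<Sum>k\<in>K. e k * w k l) = sesq I (v l) M (v l)"
      unfolding spectral_sesq_self[OF u] w_def by (simp add: cmod_ip_commute)
    also have "\<dots> = of_real (d l)"
      using spectral_eigen(1)[OF v l, of "v l"] orthonormal_ip[OF spectral_onD(2)[OF v] l l] by simp
    finally have 1: "(\<Sum>k\<in>K. e k * w k l) = d l" using of_real_eq_iff by blast
    have "(\<Sum>k\<in>K. e k * w k l) = (\<Sum>k\<in>K. d l * w k l)"
    proof (intro sum.cong refl)
      fix k assume "k \<in> K"
      have "of_real (e k) * ip I (v l) (u k) = of_real (d l) * ip I (v l) (u k)"
        using spectral_eigen(2)[OF u \<open>k \<in> K\<close>, of "v l"] spectral_eigen(1)[OF v l, of "u k"] by metis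
      then show "e k * w k l = d l * w k l" by (auto simp: w_def)
    qed
    then have "d l * (\<Sum>k\<in>K. w k l) = d l" using 1 by (simp add: sum_distrib_left)
    then show ?thesis using False by simp
  qed (simp add: f0)
  have "(\<Sum>k\<in>K. f (e k)) = (\<Sum>k\<in>K. (\<Sum>l\<in>L. w k l) * f (e k))" using row by simp
  also have "\<dots> = (\<Sum>k\<in>K. \<Sum>l\<in>L. w k l * f (d l))"
    by (simp add: sum_distrib_right eq)
  also have "\<dots> = (\<Sum>l\<in>L. \<Sum>k\<in>K. w k l * f (d l))" by (rule sum.swap)
  also have "\<dots> = (\<Sum>l\<in>L. f (d l))" by (simp add: sum_distrib_right[symmetric] col)
  finally show ?thesis .
qed

lemma ent_eq:
  assumes fin: "finite I" and u: "spectral_on I K u e M"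
  shows "ent I M = (\<Sum>k\<in>K. eta (e k))"
proof -
  obtain v d where v: "spectral_on I I v d M" "complete_family I I v"
    using spectral_theorem[OF fin spectral_hermitian[OF u]] .
  have "\<exists>r. \<exists>u e. spectral_on I I u e M \<and> complete_family I I u \<and> r = (\<Sum>k\<in>I. eta (e k))"
    using v by blast
  then have "\<exists>u e. spectral_on I I u e M \<and> complete_family I I u \<and> ent I M = (\<Sum>k\<in>I. eta (e k))"
    unfolding ent_def by (rule someI_ex)
  then obtain v d where v: "spectral_on I I v d M" "complete_family I I v" "ent I M = (\<Sum>k\<in>I. eta (d k))"
    by blast
  show ?thesis unfolding v(3) using spectral_sum_unique[OF fin u v(1,2), of eta] by simp
qed

lemma spectral_cong:
  assumes "spectral_on I K u e M" "\<And>i j. i \<in> I \<Longrightarrow> j \<in> I \<Longrightarrow> M' i j = M i j"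
  shows "spectral_on I K u e M'"
  using assms by (auto simp: spectral_on_def)

lemma ent_cong:
  assumes "\<And>i j. i \<in> I \<Longrightarrow> j \<in> I \<Longrightarrow> M i j = M' i j"
  shows "ent I M = ent I M'"
proof -
  have "spectral_on I I u e M = spectral_on I I u e M'" for u e
    using assms by (auto simp: spectral_on_def)
  then show ?thesis by (simp add: ent_def)
qed

lemma ip_reindex:
  assumes "bij_betw h J I"
  shows "ip J (\<lambda>j. f (h j)) (\<lambda>j. g (h j)) = ip I f g"
  unfolding ip_def by (rule sum.reindex_bij_betw[OF assms, of "\<lambda>i. cnj (f i) * g i"])

lemma spectral_reindex:
  assumes h: "bij_betw h J I" and u: "spectral_on I K u e M"
  shows "spectral_on J K (\<lambda>k j. u k (h j)) e (\<lambda>i j. M (h i) (h j))"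
proof -
  have "h j \<in> I" if "j \<in> J" for j using h that by (auto simp: bij_betw_def)
  then show ?thesis using u unfolding spectral_on_def orthonormal_def ip_reindex[OF h] by simp
qed

lemma ent_reindex:
  assumes h: "bij_betw h J I" and fin: "finite I" and M: "hermitian_on I M"
    and N: "\<And>x y. x \<in> J \<Longrightarrow> y \<in> J \<Longrightarrow> N x y = M (h x) (h y)"
  shows "ent J N = ent I M"
proof -
  obtain v d where v: "spectral_on I I v d M" using spectral_theorem[OF fin M] .
  have "finite J" using bij_betw_finite[OF h] fin by simp
  have "spectral_on J I (\<lambda>k j. v k (h j)) d N" by (rule spectral_cong[OF spectral_reindex[OF h v] N])
  then show ?thesis using ent_eq[OF \<open>finite J\<close>] ent_eq[OF fin v] by metis
qed

section \<open>Positive kernels and Gram representations\<close>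

lemma psd_onD:
  assumes "psd_on I M"
  shows "hermitian_on I M" "0 \<le> Re (sesq I f M f)"
  using assms by (auto simp: psd_on_def)

lemma psd_spectral_nonneg:
  assumes "psd_on I M" "spectral_on I K u e M" "k \<in> K"
  shows "0 \<le> e k"
proof -
  have "sesq I (u k) M (u k) = of_real (e k)"
    using spectral_eigen(1)[OF assms(2,3), of "u k"]
      orthonormal_ip[OF spectral_onD(2)[OF assms(2)] assms(3) assms(3)] by simp
  then show ?thesis using psd_onD(2)[OF assms(1), of "u k"] by simp
qed

lemma sesq_gram:
  assumes "\<And>i j. i \<in> I \<Longrightarrow> j \<in> I \<Longrightarrow> M i j = (\<Sum>k\<in>K. w k i * cnj (w k j))"
  shows "sesq I f M g = (\<Sum>k\<in>K. ip I f (w k) * ip I (w k) g)"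
proof -
  have "sesq I f M g = (\<Sum>i\<in>I. \<Sum>j\<in>I. \<Sum>k\<in>K. (cnj (f i) * w k i) * (cnj (w k j) * g j))"
    unfolding sesq_def
    by (intro sum.cong refl) (simp add: assms sum_distrib_left sum_distrib_right mult_ac)
  also have "\<dots> = (\<Sum>k\<in>K. \<Sum>i\<in>I. \<Sum>j\<in>I. (cnj (f i) * w k i) * (cnj (w k j) * g j))"
    by (subst (2) sum.swap, subst sum.swap) (rule refl)
  finally show ?thesis unfolding ip_def sum_product .
qed

lemma psd_gram:
  assumes M: "\<And>i j. i \<in> I \<Longrightarrow> j \<in> I \<Longrightarrow> M i j = (\<Sum>k\<in>K. w k i * cnj (w k j))"
  shows "psd_on I M"
  unfolding psd_on_def
proof (intro conjI allI)
  show "hermitian_on I M" by (intro hermitian_onI) (simp add: M mult.commute)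
  fix f
  have "Re (ip I f (w k) * ip I (w k) f) \<ge> 0" for k
    using cnj_mult_self[of "ip I (w k) f"] unfolding cnj_ip by simp
  moreover have "sesq I f M f = (\<Sum>k\<in>K. ip I f (w k) * ip I (w k) f)" by (rule sesq_gram[OF M])
  ultimately show "0 \<le> Re (sesq I f M f)" by (simp add: sum_nonneg)
qed

text \<open>Eigenvectors are scaled by the roots of their eigenvalues. Unlike orthonormal
  decompositions, Gram representations pass directly to restrictions and tensor products.\<close>

lemma psd_gramE:
  assumes "finite I" "psd_on I M"
  obtains w where "\<And>i j. i \<in> I \<Longrightarrow> j \<in> I \<Longrightarrow> M i j = (\<Sum>k\<in>I. w k i * cnj (w k j))"
proof -
  obtain v d where v: "spectral_on I I v d M" using spectral_theorem[OF assms(1) psd_onD(1)[OF assms(2)]] .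
  have "M i j = (\<Sum>k\<in>I. (of_real (sqrt (d k)) * v k i) * cnj (of_real (sqrt (d k)) * v k j))"
    if ij: "i \<in> I" "j \<in> I" for i j
  proof -
    have "(of_real (sqrt (d k)) * v k i) * cnj (of_real (sqrt (d k)) * v k j) = of_real (d k) * v k i * cnj (v k j)"
      if "k \<in> I" for k
    proof -
      have "complex_of_real (sqrt (d k)) * of_real (sqrt (d k)) = of_real (d k)"
        unfolding of_real_mult[symmetric] using psd_spectral_nonneg[OF assms(2) v that] by simp
      then show ?thesis by (simp add: mult_ac)
    qed
    then show ?thesis unfolding spectral_onD(3)[OF v ij] by (intro sum.cong refl) metis
  qed
  then show thesis by (rule that)
qed

lemma psd_spectral:
  assumes "spectral_on I K u e M" "\<And>k. k \<in> K \<Longrightarrow> 0 \<le> e k"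
  shows "psd_on I M"
  unfolding psd_on_def spectral_sesq_self[OF assms(1)] using spectral_hermitian[OF assms(1)] assms(2)
  by (auto intro!: sum_nonneg)

text \<open>A Gram representation pulls back along any map. This covers diagonal blocks, reordered
  tensor factors and the passage between numbers and their digits.\<close>

lemma psd_comap:
  assumes "finite I" "psd_on I M" "h ` J \<subseteq> I" "\<And>x y. x \<in> J \<Longrightarrow> y \<in> J \<Longrightarrow> N x y = M (h x) (h y)"
  shows "psd_on J N"
proof -
  obtain w where w: "\<And>i j. i \<in> I \<Longrightarrow> j \<in> I \<Longrightarrow> M i j = (\<Sum>k\<in>I. w k i * cnj (w k j))"
    by (rule psd_gramE[OF assms(1,2)]) blast
  show ?thesis by (rule psd_gram[where K = I and w = "\<lambda>k j. w k (h j)"]) (use w assms(3,4) in auto)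
qed

lemma psd_cong:
  assumes "psd_on I M" "\<And>i j. i \<in> I \<Longrightarrow> j \<in> I \<Longrightarrow> M' i j = M i j"
  shows "psd_on I M'"
proof -
  have "sesq I f M' f = sesq I f M f" for f unfolding sesq_def by (intro sum.cong refl) (simp add: assms(2))
  moreover have "hermitian_on I M'"
    by (intro hermitian_onI) (metis assms(2) hermitian_onD[OF psd_onD(1)[OF assms(1)]])
  ultimately show ?thesis using assms(1) by (simp add: psd_on_def)
qed

lemma psd_sum:
  assumes "finite I" "\<And>y. y \<in> Y \<Longrightarrow> psd_on I (M y)"
  shows "psd_on I (\<lambda>i j. \<Sum>y\<in>Y. M y i j)"
  unfolding psd_on_def
proof (intro conjI allI)
  show "hermitian_on I (\<lambda>i j. \<Sum>y\<in>Y. M y i j)"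
    unfolding hermitian_on_def cnj_sum
    by (intro ballI sum.cong refl hermitian_onD[OF psd_onD(1)[OF assms(2)]])
  fix f
  have "sesq I f (\<lambda>i j. \<Sum>y\<in>Y. M y i j) f = (\<Sum>i\<in>I. \<Sum>j\<in>I. \<Sum>y\<in>Y. cnj (f i) * M y i j * f j)"
    unfolding sesq_def by (simp add: sum_distrib_left sum_distrib_right)
  also have "\<dots> = (\<Sum>y\<in>Y. sesq I f (M y) f)"
    unfolding sesq_def by (subst (2) sum.swap, subst sum.swap) (rule refl)
  finally show "0 \<le> Re (sesq I f (\<lambda>i j. \<Sum>y\<in>Y. M y i j) f)"
    using psd_onD(2)[OF assms(2)] by (simp add: sum_nonneg)
qed

lemma spectral_trace:
  assumes "spectral_on I K u e M"
  shows "(\<Sum>i\<in>I. M i i) = of_real (\<Sum>k\<in>K. e k)"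
proof -
  have "(\<Sum>i\<in>I. M i i) = (\<Sum>i\<in>I. \<Sum>k\<in>K. of_real (e k) * (cnj (u k i) * u k i))"
    by (simp add: spectral_onD(3)[OF assms] mult_ac)
  also have "\<dots> = (\<Sum>k\<in>K. of_real (e k) * ip I (u k) (u k))"
    by (subst sum.swap) (simp add: ip_def sum_distrib_left)
  also have "\<dots> = of_real (\<Sum>k\<in>K. e k)"
    using spectral_onD(2)[OF assms] by (simp add: orthonormal_def)
  finally show ?thesis .
qed

section \<open>Direct sums and shifts by the identity\<close>

text \<open>This serves twice: with equal blocks it diagonalises id \<otimes> N, with varying blocks
  an operator with a classical register.\<close>

lemma spectral_block:
  assumes A: "finite A" and y: "\<And>a. a \<in> A \<Longrightarrow> spectral_on I K (y a) (r a) (N a)"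
  shows "spectral_on (A \<times> I) (A \<times> K) (\<lambda>(a, k) (a', i). if a = a' then y a k i else 0)
    (\<lambda>(a, k). r a k) (\<lambda>(a, i) (a', i'). if a = a' then N a i i' else 0)"
    (is "spectral_on _ _ ?v ?q ?N")
proof (cases "A = {}")
  case True
  then show ?thesis by (simp add: spectral_on_def orthonormal_def)
next
  case False
  then have K: "finite K" using spectral_onD(1)[OF y] by blast
  have on: "orthonormal (A \<times> I) (A \<times> K) ?v"
    unfolding orthonormal_def
  proof (intro ballI, clarsimp simp only: mem_Sigma_iff prod.case)
    fix a k a' k' assume a: "a \<in> A" "k \<in> K" "a' \<in> A" "k' \<in> K"
    have "ip (A \<times> I) (\<lambda>(a'', i). if a = a'' then y a k i else 0) (\<lambda>(a'', i). if a' = a'' then y a' k' i else 0)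
        = (\<Sum>b\<in>A. if a = b then (if a' = b then ip I (y a k) (y a' k') else 0) else 0)"
      unfolding ip_def sum.cartesian_product' by (intro sum.cong refl) auto
    also have "\<dots> = (if a' = a then ip I (y a k) (y a' k') else 0)" using A a by simp
    also have "\<dots> = (if (a, k) = (a', k') then 1 else 0)"
      using spectral_onD(2)[OF y[OF a(1)]] a by (auto simp: orthonormal_def)
    finally show "ip (A \<times> I) (\<lambda>(a'', i). if a = a'' then y a k i else 0) (\<lambda>(a'', i). if a' = a'' then y a' k' i else 0)
        = (if (a, k) = (a', k') then 1 else 0)" .
  qed
  have "?N (a, i) (a', i') = (\<Sum>k\<in>A \<times> K. of_real (?q k) * ?v k (a, i) * cnj (?v k (a', i')))"
    if a: "a \<in> A" "i \<in> I" "a' \<in> A" "i' \<in> I" for a i a' i'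
  proof -
    have "(\<Sum>k\<in>A \<times> K. of_real (?q k) * ?v k (a, i) * cnj (?v k (a', i')))
        = (\<Sum>b\<in>A. if b = a then (if b = a' then (\<Sum>k\<in>K. of_real (r a k) * y a k i * cnj (y a k i')) else 0) else 0)"
      unfolding sum.cartesian_product' by (intro sum.cong refl) auto
    also have "\<dots> = ?N (a, i) (a', i')"
      using A a spectral_onD(3)[OF y[OF a(1)] a(2,4)] by (cases "a = a'") auto
    finally show ?thesis by simp
  qed
  then have "\<forall>i\<in>A \<times> I. \<forall>j\<in>A \<times> I. ?N i j = (\<Sum>k\<in>A \<times> K. of_real (?q k) * ?v k i * cnj (?v k j))"
    by blast
  moreover have "finite (A \<times> K)" using A K by simp
  ultimately show ?thesis using on unfolding spectral_on_def by blast
qed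

lemma complete_block:
  assumes A: "finite A" and y: "\<And>a. a \<in> A \<Longrightarrow> complete_family I K (y a)"
  shows "complete_family (A \<times> I) (A \<times> K) (\<lambda>(a, k) (a', i). if a = a' then y a k i else 0)"
    (is "complete_family _ _ ?v")
proof -
  have "(\<Sum>k\<in>A \<times> K. ?v k (a, i) * cnj (?v k (a', i'))) = (if (a, i) = (a', i') then 1 else 0)"
    if a: "a \<in> A" "i \<in> I" "a' \<in> A" "i' \<in> I" for a i a' i'
  proof -
    have "(\<Sum>k\<in>A \<times> K. ?v k (a, i) * cnj (?v k (a', i')))
        = (\<Sum>b\<in>A. if b = a then (if b = a' then (\<Sum>k\<in>K. y a k i * cnj (y a k i')) else 0) else 0)"
      unfolding sum.cartesian_product' by (intro sum.cong refl) auto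
    also have "\<dots> = (if (a, i) = (a', i') then 1 else 0)"
      using A a y[OF a(1)] by (cases "a = a'") (auto simp: complete_family_def)
    finally show ?thesis .
  qed
  then show ?thesis unfolding complete_family_def by auto
qed

text \<open>Completeness writes the identity in the same eigenvectors; this is why it is carried
  along with decompositions that are to be regularised.\<close>

lemma spectral_shift:
  assumes y: "spectral_on I K y r N" and c: "complete_family I K y"
  shows "spectral_on I K y (\<lambda>k. r k + h) (\<lambda>i j. N i j + (if i = j then of_real h else 0))"
proof -
  have "N i j + (if i = j then of_real h else 0) = (\<Sum>k\<in>K. of_real (r k + h) * y k i * cnj (y k j))"
    if ij: "i \<in> I" "j \<in> I" for i j
  proof -
    have "(\<Sum>k\<in>K. of_real (r k + h) * y k i * cnj (y k j))
        = (\<Sum>k\<in>K. of_real (r k) * y k i * cnj (y k j)) + of_real h * (\<Sum>k\<in>K. y k i * cnj (y k j))"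
      by (simp add: algebra_simps sum.distrib sum_distrib_left)
    also have "(\<Sum>k\<in>K. y k i * cnj (y k j)) = (if i = j then 1 else 0)" using c ij by (simp add: complete_family_def)
    finally show ?thesis using spectral_onD(3)[OF y ij] by simp
  qed
  then show ?thesis using y by (simp add: spectral_on_def)
qed


section \<open>Monotonicity of relative entropy\<close>

text \<open>For positive R and G and S the inverse of R, let \<Delta> X = G X S be the relative modular
  operator. The supremum over Z is the quadratic form of the inverse of \<Delta> + T at the square root
  of R. Restricting Z to the form Z' (x) id shows that it decreases under partial traces.\<close>

definition lform :: "'i set \<Rightarrow> ('i \<Rightarrow> 'i \<Rightarrow> complex) \<Rightarrow> ('i \<Rightarrow> 'i \<Rightarrow> complex) \<Rightarrow> real
    \<Rightarrow> ('i \<Rightarrow> 'i \<Rightarrow> complex) \<Rightarrow> real" where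
  "lform S R G T Z = 2 * Re (\<Sum>s\<in>S. \<Sum>t\<in>S. Z s t * R t s)
     - Re (\<Sum>t\<in>S. sesq S (\<lambda>s. Z s t) G (\<lambda>s. Z s t))
     - T * Re (\<Sum>s\<in>S. sesq S (\<lambda>t. cnj (Z s t)) R (\<lambda>t. cnj (Z s t)))"

text \<open>The quadratic part belongs to the map taking Z to G Z + T Z R. Between the eigenbases of
  \<open>G\<close> on the left and \<open>R\<close> on the right this map is diagonal with
  eigenvalues \<open>q j + T * p i\<close>, so the form splits into one scalar quadratic in each
  entry of \<open>Z\<close>.\<close>

lemma lform_eq:
  assumes fin: "finite S"
    and u: "spectral_on S I u p R" "complete_family S I u"
    and v: "spectral_on S J v q G" "complete_family S J v"
  defines "c \<equiv> \<lambda>j i. ip S (v j) (u i)"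
    and "z \<equiv> \<lambda>Z j i. ip S (v j) (\<lambda>s. \<Sum>t\<in>S. Z s t * u i t)"
  shows "lform S R G T Z =
    (\<Sum>i\<in>I. \<Sum>j\<in>J. 2 * p i * Re (cnj (c j i) * z Z j i) - (q j + T * p i) * (cmod (z Z j i))\<^sup>2)"
proof -
  define x where "x i s = (\<Sum>t\<in>S. Z s t * u i t)" for i s
  define y where "y j t = ip S (v j) (\<lambda>s. Z s t)" for j t
  have zx: "z Z j i = ip S (v j) (x i)" for j i unfolding z_def x_def ..
  have zy: "z Z j i = cnj (ip S (u i) (\<lambda>t. cnj (y j t)))" for j i
  proof -
    have "z Z j i = (\<Sum>s\<in>S. \<Sum>t\<in>S. cnj (v j s) * Z s t * u i t)"
      unfolding z_def ip_def by (simp add: sum_distrib_left mult.assoc)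
    also have "\<dots> = (\<Sum>t\<in>S. \<Sum>s\<in>S. cnj (v j s) * Z s t * u i t)" by (rule sum.swap)
    also have "\<dots> = cnj (ip S (u i) (\<lambda>t. cnj (y j t)))"
      unfolding y_def ip_def by (simp add: sum_distrib_left mult_ac)
    finally show ?thesis .
  qed
  have t1: "(\<Sum>s\<in>S. \<Sum>t\<in>S. Z s t * R t s) = (\<Sum>i\<in>I. \<Sum>j\<in>J. of_real (p i) * (cnj (c j i) * z Z j i))"
  proof -
    have "(\<Sum>s\<in>S. \<Sum>t\<in>S. Z s t * R t s) = (\<Sum>s\<in>S. \<Sum>t\<in>S. \<Sum>i\<in>I. of_real (p i) * (cnj (u i s) * (Z s t * u i t)))"
      by (intro sum.cong refl) (simp add: spectral_onD(3)[OF u(1)] sum_distrib_left mult_ac)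
    also have "\<dots> = (\<Sum>i\<in>I. \<Sum>s\<in>S. \<Sum>t\<in>S. of_real (p i) * (cnj (u i s) * (Z s t * u i t)))"
      by (subst (2) sum.swap, subst sum.swap) (rule refl)
    also have "\<dots> = (\<Sum>i\<in>I. of_real (p i) * ip S (u i) (x i))"
      unfolding ip_def x_def by (simp only: sum_distrib_left)
    also have "\<dots> = (\<Sum>i\<in>I. of_real (p i) * (\<Sum>j\<in>J. cnj (c j i) * z Z j i))"
      unfolding zx c_def
      by (intro sum.cong refl arg_cong2[where f = "(*)"] parseval[OF fin v(2)])
    finally show ?thesis by (simp only: sum_distrib_left)
  qed
  have t2: "(\<Sum>t\<in>S. sesq S (\<lambda>s. Z s t) G (\<lambda>s. Z s t)) = of_real (\<Sum>i\<in>I. \<Sum>j\<in>J. q j * (cmod (z Z j i))\<^sup>2)"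
  proof -
    have "(\<Sum>t\<in>S. sesq S (\<lambda>s. Z s t) G (\<lambda>s. Z s t)) = of_real (\<Sum>t\<in>S. \<Sum>j\<in>J. q j * (cmod (y j t))\<^sup>2)"
      unfolding spectral_sesq_self[OF v(1)] y_def by simp
    also have "(\<Sum>t\<in>S. \<Sum>j\<in>J. q j * (cmod (y j t))\<^sup>2) = (\<Sum>j\<in>J. q j * (\<Sum>t\<in>S. (cmod (cnj (y j t)))\<^sup>2))"
      by (subst sum.swap) (simp add: sum_distrib_left)
    also have "\<dots> = (\<Sum>j\<in>J. q j * (\<Sum>i\<in>I. (cmod (z Z j i))\<^sup>2))"
      unfolding parseval_norm[OF fin u(2)] zy by simp
    also have "\<dots> = (\<Sum>i\<in>I. \<Sum>j\<in>J. q j * (cmod (z Z j i))\<^sup>2)"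
      by (subst sum.swap) (simp add: sum_distrib_left)
    finally show ?thesis .
  qed
  have t3: "(\<Sum>s\<in>S. sesq S (\<lambda>t. cnj (Z s t)) R (\<lambda>t. cnj (Z s t))) = of_real (\<Sum>i\<in>I. \<Sum>j\<in>J. p i * (cmod (z Z j i))\<^sup>2)"
  proof -
    have x: "ip S (u i) (\<lambda>t. cnj (Z s t)) = cnj (x i s)" for i s
      unfolding ip_def x_def by (simp add: mult.commute)
    have "(\<Sum>s\<in>S. sesq S (\<lambda>t. cnj (Z s t)) R (\<lambda>t. cnj (Z s t))) = of_real (\<Sum>s\<in>S. \<Sum>i\<in>I. p i * (cmod (x i s))\<^sup>2)"
      unfolding spectral_sesq_self[OF u(1)] x by simp
    also have "(\<Sum>s\<in>S. \<Sum>i\<in>I. p i * (cmod (x i s))\<^sup>2) = (\<Sum>i\<in>I. p i * (\<Sum>s\<in>S. (cmod (x i s))\<^sup>2))"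
      by (subst sum.swap) (simp add: sum_distrib_left)
    also have "\<dots> = (\<Sum>i\<in>I. p i * (\<Sum>j\<in>J. (cmod (z Z j i))\<^sup>2))"
      unfolding parseval_norm[OF fin v(2)] zx ..
    finally show ?thesis by (simp only: sum_distrib_left)
  qed
  have "lform S R G T Z = 2 * (\<Sum>i\<in>I. \<Sum>j\<in>J. p i * Re (cnj (c j i) * z Z j i))
      - (\<Sum>i\<in>I. \<Sum>j\<in>J. q j * (cmod (z Z j i))\<^sup>2) - T * (\<Sum>i\<in>I. \<Sum>j\<in>J. p i * (cmod (z Z j i))\<^sup>2)"
    unfolding lform_def t1 t2 t3 Re_sum Re_complex_of_real
    by (simp only: Re_complex_of_real Re_sum times_complex.simps(1) Im_complex_of_real) simp
  also have "\<dots> = (\<Sum>i\<in>I. \<Sum>j\<in>J. 2 * p i * Re (cnj (c j i) * z Z j i) - (q j + T * p i) * (cmod (z Z j i))\<^sup>2)"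
    unfolding sum_distrib_left sum_subtractf[symmetric]
    by (intro sum.cong refl) (simp only: algebra_simps)
  finally show ?thesis .
qed

text \<open>Expand the square of |D z - p c| and divide by \<open>D\<close>. Equality holds at z = p
  c / D, the entry used in \<open>lform_attained\<close>.\<close>

lemma complete_square_bound:
  fixes c z :: complex
  assumes "D > 0"
  shows "2 * p * Re (cnj c * z) - D * (cmod z)\<^sup>2 \<le> p\<^sup>2 * (cmod c)\<^sup>2 / D"
proof -
  have "0 \<le> (cmod (of_real D * z - of_real p * c))\<^sup>2" by simp
  also have "\<dots> = D\<^sup>2 * (cmod z)\<^sup>2 - 2 * D * p * Re (cnj c * z) + p\<^sup>2 * (cmod c)\<^sup>2"
    unfolding cmod_power2 by (simp add: power2_eq_square algebra_simps)
  finally have "D * (2 * p * Re (cnj c * z) - D * (cmod z)\<^sup>2) \<le> p\<^sup>2 * (cmod c)\<^sup>2"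
    by (simp add: power2_eq_square algebra_simps)
  then show ?thesis using assms by (simp add: pos_le_divide_eq mult.commute)
qed

lemma lform_le:
  assumes fin: "finite S"
    and u: "spectral_on S I u p R" "complete_family S I u" "\<And>i. i \<in> I \<Longrightarrow> 0 \<le> p i"
    and v: "spectral_on S J v q G" "complete_family S J v" "\<And>j. j \<in> J \<Longrightarrow> 0 < q j"
    and T: "0 \<le> T"
  shows "lform S R G T Z \<le> (\<Sum>i\<in>I. \<Sum>j\<in>J. (p i)\<^sup>2 * (cmod (ip S (v j) (u i)))\<^sup>2 / (q j + T * p i))"
  unfolding lform_eq[OF fin u(1,2) v(1,2)]
  by (intro sum_mono complete_square_bound add_pos_nonneg mult_nonneg_nonneg T u(3) v(3))

lemma lform_attained:
  assumes fin: "finite S"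
    and u: "spectral_on S I u p R" "complete_family S I u" "\<And>i. i \<in> I \<Longrightarrow> 0 \<le> p i"
    and v: "spectral_on S J v q G" "complete_family S J v" "\<And>j. j \<in> J \<Longrightarrow> 0 < q j"
    and T: "0 \<le> T"
  shows "\<exists>Z. lform S R G T Z = (\<Sum>i\<in>I. \<Sum>j\<in>J. (p i)\<^sup>2 * (cmod (ip S (v j) (u i)))\<^sup>2 / (q j + T * p i))"
proof -
  \<comment> \<open>The maximisers of the scalar quadratics; \<open>Z\<close> is the operator having
    them as entries between the two eigenbases.\<close>
  define a where "a j i = of_real (p i / (q j + T * p i)) * ip S (v j) (u i)" for j i
  define Z where "Z s t = (\<Sum>i\<in>I. (\<Sum>j\<in>J. a j i * v j s) * cnj (u i t))" for s t
  note I = spectral_onD(1)[OF u(1)] and J = spectral_onD(1)[OF v(1)]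
  have z: "ip S (v j) (\<lambda>s. \<Sum>t\<in>S. Z s t * u i t) = a j i" if i: "i \<in> I" and j: "j \<in> J" for i j
  proof -
    have "(\<Sum>t\<in>S. Z s t * u i t) = (\<Sum>j\<in>J. a j i * v j s)" for s
    proof -
      have "(\<Sum>t\<in>S. Z s t * u i t) = (\<Sum>t\<in>S. \<Sum>k\<in>I. (\<Sum>j\<in>J. a j k * v j s) * (cnj (u k t) * u i t))"
        unfolding Z_def sum_distrib_right[of _ I] mult.assoc ..
      also have "\<dots> = (\<Sum>k\<in>I. (\<Sum>j\<in>J. a j k * v j s) * ip S (u k) (u i))"
        by (subst sum.swap) (simp only: ip_def sum_distrib_left)
      also have "\<dots> = (\<Sum>k\<in>I. if k = i then (\<Sum>j\<in>J. a j k * v j s) else 0)"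
        using spectral_onD(2)[OF u(1)] i by (intro sum.cong refl) (simp add: orthonormal_ip)
      finally show ?thesis using I i by simp
    qed
    then have "ip S (v j) (\<lambda>s. \<Sum>t\<in>S. Z s t * u i t) = (\<Sum>k\<in>J. a k i * ip S (v j) (v k))"
      by (simp only: ip_sum_right)
    also have "\<dots> = (\<Sum>k\<in>J. if j = k then a k i else 0)"
      using spectral_onD(2)[OF v(1)] j by (intro sum.cong refl) (simp add: orthonormal_ip)
    finally show ?thesis using J j by simp
  qed
  have "lform S R G T Z = (\<Sum>i\<in>I. \<Sum>j\<in>J. (p i)\<^sup>2 * (cmod (ip S (v j) (u i)))\<^sup>2 / (q j + T * p i))"
    unfolding lform_eq[OF fin u(1,2) v(1,2)]
  proof (intro sum.cong refl)
    fix i j assume ij: "i \<in> I" "j \<in> J"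
    define D where "D = q j + T * p i"
    have D: "D > 0" unfolding D_def using v(3)[OF ij(2)] u(3)[OF ij(1)] T by (simp add: add_pos_nonneg)
    define C where "C = (cmod (ip S (v j) (u i)))\<^sup>2"
    have 1: "Re (cnj (ip S (v j) (u i)) * a j i) = p i / D * C"
    proof -
      have "cnj (ip S (v j) (u i)) * a j i = of_real (p i / D) * (cnj (ip S (v j) (u i)) * ip S (v j) (u i))"
        unfolding a_def D_def by (simp only: mult_ac)
      also have "\<dots> = of_real (p i / D * C)" unfolding cnj_mult_self C_def by simp
      finally show ?thesis by (simp only: Re_complex_of_real)
    qed
    have 2: "(cmod (a j i))\<^sup>2 = (p i / D)\<^sup>2 * C"
      unfolding a_def D_def C_def norm_mult power_mult_distrib norm_of_real power2_abs ..
    have "2 * p i * (p i / D * C) - D * ((p i / D)\<^sup>2 * C) = (p i)\<^sup>2 * C / D"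
      using D by (simp add: field_simps power2_eq_square)
    then show "2 * p i * Re (cnj (ip S (v j) (u i)) * ip S (v j) (\<lambda>s. \<Sum>t\<in>S. Z s t * u i t))
        - (q j + T * p i) * (cmod (ip S (v j) (\<lambda>s. \<Sum>t\<in>S. Z s t * u i t)))\<^sup>2
        = (p i)\<^sup>2 * (cmod (ip S (v j) (u i)))\<^sup>2 / (q j + T * p i)"
      unfolding z[OF ij] 1 2 D_def[symmetric] C_def[symmetric] .
  qed
  then show ?thesis by blast
qed

text \<open>The hypothesis is integrated over T from 0 to infinity, ln (q + T p) being a primitive of
  p / (q + T p).\<close>

lemma log_integral_comparison:
  fixes w p q :: "'a \<Rightarrow> real" and w' p' q' :: "'b \<Rightarrow> real"
  assumes A: "\<And>a. a \<in> A \<Longrightarrow> 0 \<le> w a" "\<And>a. a \<in> A \<Longrightarrow> 0 \<le> p a" "\<And>a. a \<in> A \<Longrightarrow> 0 < q a"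
      "\<And>a. a \<in> A \<Longrightarrow> p a = 0 \<Longrightarrow> w a = 0"
    and B: "\<And>b. b \<in> B \<Longrightarrow> 0 \<le> w' b" "\<And>b. b \<in> B \<Longrightarrow> 0 \<le> p' b" "\<And>b. b \<in> B \<Longrightarrow> 0 < q' b"
      "\<And>b. b \<in> B \<Longrightarrow> p' b = 0 \<Longrightarrow> w' b = 0"
    and w: "sum w A = sum w' B"
    and le: "\<And>T. 0 \<le> T \<Longrightarrow> (\<Sum>b\<in>B. w' b * p' b / (q' b + T * p' b)) \<le> (\<Sum>a\<in>A. w a * p a / (q a + T * p a))"
  shows "(\<Sum>b\<in>B. w' b * (ln (p' b) - ln (q' b))) \<le> (\<Sum>a\<in>A. w a * (ln (p a) - ln (q a)))"
proof -
  \<comment> \<open>The derivative of \<open>F\<close> is the nonnegative difference of the two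
    sides of \<open>le\<close>.\<close>
  define F where "F T = (\<Sum>a\<in>A. w a * ln (q a + T * p a)) - (\<Sum>b\<in>B. w' b * ln (q' b + T * p' b))" for T
  have der: "((\<lambda>T. \<Sum>a\<in>A. w a * ln (q a + T * p a)) has_real_derivative (\<Sum>a\<in>A. w a * p a / (q a + x * p a))) (at x)"
    if "0 \<le> x" "\<And>a. a \<in> A \<Longrightarrow> 0 \<le> p a" "\<And>a. a \<in> A \<Longrightarrow> 0 < q a"
    for x and A :: "'c set" and w p q :: "'c \<Rightarrow> real"
  proof (rule DERIV_sum)
    fix a assume a: "a \<in> A"
    have pos: "0 < q a + x * p a" using that a by (simp add: add_pos_nonneg)
    have "((\<lambda>T. w a * ln (q a + T * p a)) has_real_derivative w a * (1 / (q a + x * p a) * p a)) (at x)"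
      using pos by (auto intro!: derivative_eq_intros)
    then show "((\<lambda>T. w a * ln (q a + T * p a)) has_real_derivative w a * p a / (q a + x * p a)) (at x)" by simp
  qed
  have mono: "F 0 \<le> F T" if T: "0 \<le> T" for T
  proof (rule DERIV_nonneg_imp_nondecreasing[OF T])
    fix x assume x: "0 \<le> x" "x \<le> T"
    have "(F has_real_derivative (\<Sum>a\<in>A. w a * p a / (q a + x * p a)) - (\<Sum>b\<in>B. w' b * p' b / (q' b + x * p' b))) (at x)"
      unfolding F_def using x(1) A B by (intro DERIV_diff der) auto
    then show "\<exists>y. (F has_real_derivative y) (at x) \<and> 0 \<le> y" using le[OF x(1)] by (metis diff_ge_0_iff_ge)
  qed
  \<comment> \<open>Each sum of logarithms grows like its total weight times \<open>ln T\<close>.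
    The totals agree, so the divergent terms cancel in \<open>F\<close>.\<close>
  have lim: "((\<lambda>T. (\<Sum>a\<in>A. w a * ln (q a + T * p a)) - sum w A * ln T) \<longlongrightarrow> (\<Sum>a\<in>A. w a * ln (p a))) at_top"
    if A: "\<And>a. a \<in> A \<Longrightarrow> 0 \<le> p a" "\<And>a. a \<in> A \<Longrightarrow> 0 < q a" "\<And>a. a \<in> A \<Longrightarrow> p a = 0 \<Longrightarrow> w a = 0"
    for A :: "'c set" and w p q :: "'c \<Rightarrow> real"
  proof -
    have "((\<lambda>T. \<Sum>a\<in>A. w a * ln (q a * inverse T + p a)) \<longlongrightarrow> (\<Sum>a\<in>A. w a * ln (p a))) at_top"
    proof (rule tendsto_sum)
      fix a assume a: "a \<in> A"
      show "((\<lambda>T. w a * ln (q a * inverse T + p a)) \<longlongrightarrow> w a * ln (p a)) at_top"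
      \<comment> \<open>Where \<open>p a = 0\<close>, the logarithm itself diverges, but its weight
        \<open>w a\<close> is 0.\<close>
      proof (cases "p a = 0")
        case False
        have "((\<lambda>T. q a * inverse T + p a) \<longlongrightarrow> q a * 0 + p a) at_top"
          by (intro tendsto_intros tendsto_inverse_0_at_top filterlim_ident)
        then show ?thesis using False by (auto intro!: tendsto_intros)
      qed (use A a in simp)
    qed
    moreover have "eventually (\<lambda>T. (\<Sum>a\<in>A. w a * ln (q a * inverse T + p a))
        = (\<Sum>a\<in>A. w a * ln (q a + T * p a)) - sum w A * ln T) at_top"
      using eventually_gt_at_top[of 0]
    proof eventually_elim
      case (elim T)
      have "w a * ln (q a * inverse T + p a) = w a * ln (q a + T * p a) - w a * ln T" if a: "a \<in> A" for a
      proof -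
        have "q a + T * p a > 0" using A a elim by (simp add: add_pos_nonneg)
        moreover have "q a * inverse T + p a = (q a + T * p a) / T" using elim by (simp add: field_simps)
        ultimately show ?thesis using elim by (simp add: ln_div algebra_simps)
      qed
      then show ?case by (simp add: sum_subtractf sum_distrib_right)
    qed
    ultimately show ?thesis by (rule Lim_transform_eventually)
  qed
  have "((\<lambda>T. ((\<Sum>a\<in>A. w a * ln (q a + T * p a)) - sum w A * ln T)
      - ((\<Sum>b\<in>B. w' b * ln (q' b + T * p' b)) - sum w' B * ln T))
      \<longlongrightarrow> (\<Sum>a\<in>A. w a * ln (p a)) - (\<Sum>b\<in>B. w' b * ln (p' b))) at_top"
    using A B by (intro tendsto_diff lim) auto
  then have "(F \<longlongrightarrow> (\<Sum>a\<in>A. w a * ln (p a)) - (\<Sum>b\<in>B. w' b * ln (p' b))) at_top"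
    unfolding F_def w by simp
  \<comment> \<open>A nondecreasing function starts below its limit: \<open>F 0\<close> contains the
    logarithms of \<open>q\<close>, the limit those of \<open>p\<close>.\<close>
  then have "F 0 \<le> (\<Sum>a\<in>A. w a * ln (p a)) - (\<Sum>b\<in>B. w' b * ln (p' b))"
    by (rule tendsto_lowerbound) (auto intro: mono eventually_mono[OF eventually_ge_at_top[of 0]])
  then show ?thesis unfolding F_def by (simp add: right_diff_distrib sum_subtractf)
qed

section \<open>Partial traces of kernels\<close>

lemma sum_prod_triple:
  "(\<Sum>x\<in>A \<times> B \<times> E. f x) = (\<Sum>a\<in>A. \<Sum>b\<in>B. \<Sum>e\<in>E. f (a, b, e))"
  by (simp only: sum.cartesian_product')

lemma sum_prod_pair:
  "(\<Sum>x\<in>A \<times> E. f x) = (\<Sum>a\<in>A. \<Sum>e\<in>E. f (a, e))"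
  by (simp only: sum.cartesian_product')

definition trace_mid :: "'b set \<Rightarrow> ('a \<times> 'b \<times> 'e \<Rightarrow> 'a \<times> 'b \<times> 'e \<Rightarrow> complex)
    \<Rightarrow> 'a \<times> 'e \<Rightarrow> 'a \<times> 'e \<Rightarrow> complex" where
  "trace_mid B M = (\<lambda>(a, e) (a', e'). \<Sum>b\<in>B. M (a, b, e) (a', b, e'))"

definition trace_fst :: "'a set \<Rightarrow> ('a \<times> 'b \<Rightarrow> 'a \<times> 'b \<Rightarrow> complex) \<Rightarrow> 'b \<Rightarrow> 'b \<Rightarrow> complex" where
  "trace_fst A M = (\<lambda>i j. \<Sum>a\<in>A. M (a, i) (a, j))"

text \<open>Each term of \<open>lform\<close> pairs \<open>R\<close> or \<open>G\<close> linearly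
  with an operator built from the test operator. For a test operator acting as the identity on
  \<open>B\<close>, these pairings depend on \<open>R\<close> and \<open>G\<close> only through
  their partial traces.\<close>

lemma lform_trace_mid:
  fixes A :: "'a set" and B :: "'b set" and E :: "'c set"
  assumes B: "finite B"
  shows "lform (A \<times> B \<times> E) R G T (\<lambda>(a, b, e) (a', b', e'). if b = b' then Z (a, e) (a', e') else 0)
    = lform (A \<times> E) (trace_mid B R) (trace_mid B G) T Z"
proof -
  let ?Z = "\<lambda>(a, b, e) (a', b', e'). if b = b' then Z (a, e) (a', e') else 0"
  let ?S = "A \<times> B \<times> E" and ?X = "A \<times> E"
  define m where "m = (\<lambda>b x. (fst x, b, snd x) :: 'a \<times> 'b \<times> 'c)"
  have S: "(\<Sum>s\<in>?S. f s) = (\<Sum>b\<in>B. \<Sum>x\<in>?X. f (m b x))" for f :: "_ \<Rightarrow> complex"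
    unfolding sum.cartesian_product' m_def fst_conv snd_conv by (rule sum.swap)
  have Zm: "?Z (m b x) (m b' x') = (if b = b' then Z x x' else 0)" for b x b' x'
    by (simp add: m_def split_beta)
  have Tm: "trace_mid B M x x' = (\<Sum>b\<in>B. M (m b x) (m b x'))" for M x x'
    by (simp add: trace_mid_def m_def split_beta)
  have d: "(\<Sum>b\<in>B. \<Sum>x\<in>?X. if b = b0 then F x else 0) = (\<Sum>x\<in>?X. F x)"
    if "b0 \<in> B" for b0 and F :: "_ \<Rightarrow> complex"
  proof -
    have "(\<Sum>b\<in>B. \<Sum>x\<in>?X. if b = b0 then F x else 0) = (\<Sum>b\<in>B. if b = b0 then sum F ?X else 0)"
      by (intro sum.cong refl) auto
    then show ?thesis using B that by simp
  qed
  have s: "sesq ?S g N g = (\<Sum>x\<in>?X. \<Sum>x'\<in>?X. cnj (f x) * N (m b0 x) (m b0 x') * f x')"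
    if "b0 \<in> B" and g: "\<And>b x. g (m b x) = (if b = b0 then f x else 0)" for b0 N and f g :: "_ \<Rightarrow> complex"
  proof -
    have "sesq ?S g N g = (\<Sum>b\<in>B. \<Sum>x\<in>?X. if b = b0 then (\<Sum>b'\<in>B. \<Sum>x'\<in>?X.
        if b' = b0 then cnj (f x) * N (m b0 x) (m b0 x') * f x' else 0) else 0)"
      unfolding sesq_def S g by (intro sum.cong refl) (auto intro!: sum.cong)
    then show ?thesis by (simp only: d[OF that(1)])
  qed
  have sm: "(\<Sum>b\<in>B. \<Sum>x0\<in>?X. \<Sum>x\<in>?X. \<Sum>x'\<in>?X. cnj (f x0 x) * N (m b x) (m b x') * f x0 x')
      = (\<Sum>x0\<in>?X. sesq ?X (f x0) (trace_mid B N) (f x0))" for f :: "_ \<Rightarrow> _ \<Rightarrow> complex" and N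
    unfolding sesq_def Tm sum_distrib_left sum_distrib_right
    by (subst sum.swap, rule sum.cong[OF refl], subst sum.swap) (intro sum.cong[OF refl] sum.swap)
  have "(\<Sum>s\<in>?S. \<Sum>t\<in>?S. ?Z s t * R t s)
    = (\<Sum>b\<in>B. \<Sum>x\<in>?X. \<Sum>b'\<in>B. \<Sum>x'\<in>?X. if b' = b then Z x x' * R (m b x') (m b x) else 0)"
    unfolding S Zm by (intro sum.cong refl) auto
  also have "\<dots> = (\<Sum>b\<in>B. \<Sum>x\<in>?X. \<Sum>x'\<in>?X. Z x x' * R (m b x') (m b x))"
    by (intro sum.cong refl d)
  also have "\<dots> = (\<Sum>x\<in>?X. \<Sum>x'\<in>?X. Z x x' * trace_mid B R x' x)"
    unfolding Tm sum_distrib_left by (subst sum.swap) (intro sum.cong[OF refl] sum.swap)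
  finally have t1: "(\<Sum>s\<in>?S. \<Sum>t\<in>?S. ?Z s t * R t s) = (\<Sum>x\<in>?X. \<Sum>x'\<in>?X. Z x x' * trace_mid B R x' x)" .
  have t2: "(\<Sum>t\<in>?S. sesq ?S (\<lambda>s. ?Z s t) G (\<lambda>s. ?Z s t)) = (\<Sum>t\<in>?X. sesq ?X (\<lambda>s. Z s t) (trace_mid B G) (\<lambda>s. Z s t))"
    unfolding S sm[symmetric] by (intro sum.cong refl s) (simp_all add: Zm)
  have t3: "(\<Sum>t\<in>?S. sesq ?S (\<lambda>s. cnj (?Z t s)) R (\<lambda>s. cnj (?Z t s)))
      = (\<Sum>t\<in>?X. sesq ?X (\<lambda>s. cnj (Z t s)) (trace_mid B R) (\<lambda>s. cnj (Z t s)))"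
    unfolding S sm[symmetric] by (intro sum.cong refl s) (simp_all add: Zm)
  show ?thesis unfolding lform_def t1 t2 t3 ..
qed


lemma psd_trace_mid:
  assumes "finite A" "finite B" "finite E" "psd_on (A \<times> B \<times> E) M"
  shows "psd_on (A \<times> E) (trace_mid B M)"
proof -
  have "psd_on (A \<times> E) (\<lambda>i j. \<Sum>b\<in>B. (\<lambda>i j. M (fst i, b, snd i) (fst j, b, snd j)) i j)"
  proof (rule psd_sum)
    fix b assume "b \<in> B"
    then show "psd_on (A \<times> E) (\<lambda>i j. M (fst i, b, snd i) (fst j, b, snd j))"
      using assms by (intro psd_comap[OF _ assms(4), where h = "\<lambda>i. (fst i, b, snd i)"]) auto
  qed (use assms in simp)
  moreover have "(\<lambda>i j. \<Sum>b\<in>B. M (fst i, b, snd i) (fst j, b, snd j)) = trace_mid B M"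
    by (simp add: trace_mid_def fun_eq_iff split_beta)
  ultimately show ?thesis by simp
qed

lemma psd_trace_fst:
  assumes "finite A" "finite I" "psd_on (A \<times> I) M"
  shows "psd_on I (trace_fst A M)"
  unfolding trace_fst_def
proof (rule psd_sum)
  fix a assume "a \<in> A"
  then show "psd_on I (\<lambda>i j. M (a, i) (a, j))"
    using assms by (intro psd_comap[OF _ assms(3), where h = "\<lambda>i. (a, i)"]) auto
qed (rule assms(2))

text \<open>These are the Nussbaum-Szkola weights: their first marginal is the spectrum of
  \<open>R\<close>, their second the diagonal of \<open>R\<close> in the basis \<open>v\<close>.
  They turn quantum relative entropy into a classical sum of differences of logarithms.\<close>

lemma weighted_log_sum:
  assumes fin: "finite S"
    and u: "spectral_on S I u p R"
    and v: "complete_family S J v"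
  shows "(\<Sum>(i, j)\<in>I \<times> J. p i * (cmod (ip S (v j) (u i)))\<^sup>2 * (f i - g j))
    = (\<Sum>i\<in>I. p i * f i) - (\<Sum>j\<in>J. g j * Re (sesq S (v j) R (v j)))"
    and "(\<Sum>(i, j)\<in>I \<times> J. p i * (cmod (ip S (v j) (u i)))\<^sup>2) = (\<Sum>i\<in>I. p i)"
proof -
  have row: "(\<Sum>j\<in>J. (cmod (ip S (v j) (u i)))\<^sup>2) = 1" if "i \<in> I" for i
    using parseval_norm[OF fin v, of "u i"] orthonormal_norm[OF spectral_onD(2)[OF u] that] by simp
  have 1: "(\<Sum>i\<in>I. \<Sum>j\<in>J. p i * (cmod (ip S (v j) (u i)))\<^sup>2 * f i) = (\<Sum>i\<in>I. p i * f i)" for f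
  proof (intro sum.cong refl)
    fix i assume "i \<in> I"
    have "(\<Sum>j\<in>J. p i * (cmod (ip S (v j) (u i)))\<^sup>2 * f i) = (\<Sum>j\<in>J. (cmod (ip S (v j) (u i)))\<^sup>2) * (p i * f i)"
      unfolding sum_distrib_right by (simp only: mult_ac)
    then show "(\<Sum>j\<in>J. p i * (cmod (ip S (v j) (u i)))\<^sup>2 * f i) = p i * f i" using row[OF \<open>i \<in> I\<close>] by simp
  qed
  have 2: "(\<Sum>i\<in>I. \<Sum>j\<in>J. p i * (cmod (ip S (v j) (u i)))\<^sup>2 * g j) = (\<Sum>j\<in>J. g j * Re (sesq S (v j) R (v j)))"
    unfolding spectral_sesq_self[OF u] Re_complex_of_real cmod_ip_commute[of S "u i" "v j" for i j]
    unfolding sum_distrib_left by (subst sum.swap) (simp only: mult_ac)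
  show "(\<Sum>(i, j)\<in>I \<times> J. p i * (cmod (ip S (v j) (u i)))\<^sup>2 * (f i - g j))
    = (\<Sum>i\<in>I. p i * f i) - (\<Sum>j\<in>J. g j * Re (sesq S (v j) R (v j)))"
    unfolding sum.cartesian_product' prod.case right_diff_distrib sum_subtractf 1 2 ..
  show "(\<Sum>(i, j)\<in>I \<times> J. p i * (cmod (ip S (v j) (u i)))\<^sup>2) = (\<Sum>i\<in>I. p i)"
    unfolding sum.cartesian_product' prod.case using 1[of "\<lambda>_. 1"] by simp
qed

lemma ent_zero: "finite I \<Longrightarrow> ent I (\<lambda>i j. 0) = 0"
  by (subst ent_eq[where K = "{}"]) (auto simp: spectral_on_def orthonormal_def)

lemma ent_empty: "ent {} M = 0"
  by (subst ent_eq[where K = "{}"]) (auto simp: spectral_on_def orthonormal_def)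

lemma trace_trace_mid:
  "(\<Sum>i\<in>A \<times> E. trace_mid B M i i) = (\<Sum>i\<in>A \<times> B \<times> E. M i i)"
  unfolding sum_prod_pair sum_prod_triple trace_mid_def prod.case
  by (intro sum.cong refl sum.swap)

text \<open>Both sides are tr R ln R - tr R ln G, after and before the trace over \<open>B\<close>,
  written in eigenbases. \<open>R\<close> may be singular, while \<open>G\<close> is positive
  definite to keep its logarithms finite.\<close>

lemma relative_entropy_monotone:
  assumes fin: "finite A" "finite B" "finite E"
    and R: "psd_on (A \<times> B \<times> E) R"
    and u: "spectral_on (A \<times> B \<times> E) I u p R" "complete_family (A \<times> B \<times> E) I u"
    and v: "spectral_on (A \<times> B \<times> E) J v q G" "complete_family (A \<times> B \<times> E) J v" "\<And>j. j \<in> J \<Longrightarrow> 0 < q j"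
    and u': "spectral_on (A \<times> E) I' u' p' (trace_mid B R)" "complete_family (A \<times> E) I' u'"
    and v': "spectral_on (A \<times> E) J' v' q' (trace_mid B G)" "complete_family (A \<times> E) J' v'" "\<And>j. j \<in> J' \<Longrightarrow> 0 < q' j"
  shows "(\<Sum>i\<in>I'. p' i * ln (p' i)) - (\<Sum>j\<in>J'. ln (q' j) * Re (sesq (A \<times> E) (v' j) (trace_mid B R) (v' j)))
    \<le> (\<Sum>i\<in>I. p i * ln (p i)) - (\<Sum>j\<in>J. ln (q j) * Re (sesq (A \<times> B \<times> E) (v j) R (v j)))"
proof -
  have fin2: "finite (A \<times> B \<times> E)" "finite (A \<times> E)" using fin by auto
  note R' = psd_trace_mid[OF fin R]
  note p0 = psd_spectral_nonneg[OF R u(1)] and p0' = psd_spectral_nonneg[OF R' u'(1)]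
  note finI = spectral_onD(1)[OF u(1)] spectral_onD(1)[OF v(1)] spectral_onD(1)[OF u'(1)] spectral_onD(1)[OF v'(1)]
  let ?c = "\<lambda>i j. (cmod (ip (A \<times> B \<times> E) (v j) (u i)))\<^sup>2"
  let ?c' = "\<lambda>i j. (cmod (ip (A \<times> E) (v' j) (u' i)))\<^sup>2"
  have "complex_of_real (sum p I) = of_real (sum p' I')"
    using spectral_trace[OF u(1)] spectral_trace[OF u'(1)] trace_trace_mid[of B R A E] by simp
  then have tr: "sum p I = sum p' I'" using of_real_eq_iff by blast
  have le: "(\<Sum>(i, j)\<in>I' \<times> J'. p' i * ?c' i j * p' i / (q' j + T * p' i))
    \<le> (\<Sum>(i, j)\<in>I \<times> J. p i * ?c i j * p i / (q j + T * p i))" if T: "0 \<le> T" for T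
  proof -
    \<comment> \<open>An optimal test operator for the reduced pair, tensored with the identity on
      \<open>B\<close>, competes in the supremum for the full pair.\<close>
    obtain Z where Z: "lform (A \<times> E) (trace_mid B R) (trace_mid B G) T Z
      = (\<Sum>i\<in>I'. \<Sum>j\<in>J'. (p' i)\<^sup>2 * ?c' i j / (q' j + T * p' i))"
      using lform_attained[OF fin2(2) u' p0' v' T] by blast
    have "(\<Sum>i\<in>I'. \<Sum>j\<in>J'. (p' i)\<^sup>2 * ?c' i j / (q' j + T * p' i))
      \<le> (\<Sum>i\<in>I. \<Sum>j\<in>J. (p i)\<^sup>2 * ?c i j / (q j + T * p i))"
      unfolding Z[symmetric] lform_trace_mid[OF fin(2), symmetric]
      by (rule lform_le[OF fin2(1) u p0 v T])
    then show ?thesis unfolding sum.cartesian_product' prod.case by (simp add: power2_eq_square mult_ac)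
  qed
  have "(\<Sum>x\<in>I' \<times> J'. (\<lambda>(i, j). p' i * ?c' i j) x * (ln ((\<lambda>(i, j). p' i) x) - ln ((\<lambda>(i, j). q' j) x)))
    \<le> (\<Sum>x\<in>I \<times> J. (\<lambda>(i, j). p i * ?c i j) x * (ln ((\<lambda>(i, j). p i) x) - ln ((\<lambda>(i, j). q j) x)))"
  proof (rule log_integral_comparison)
    show "(\<Sum>x\<in>I \<times> J. (\<lambda>(i, j). p i * ?c i j) x) = (\<Sum>x\<in>I' \<times> J'. (\<lambda>(i, j). p' i * ?c' i j) x)"
      using weighted_log_sum(2)[OF fin2(1) u(1) v(2)] weighted_log_sum(2)[OF fin2(2) u'(1) v'(2)] tr by simp
    fix T :: real assume "0 \<le> T"
    from le[OF this] show "(\<Sum>x\<in>I' \<times> J'. (\<lambda>(i, j). p' i * ?c' i j) x * (\<lambda>(i, j). p' i) x / ((\<lambda>(i, j). q' j) x + T * (\<lambda>(i, j). p' i) x))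
      \<le> (\<Sum>x\<in>I \<times> J. (\<lambda>(i, j). p i * ?c i j) x * (\<lambda>(i, j). p i) x / ((\<lambda>(i, j). q j) x + T * (\<lambda>(i, j). p i) x))"
      by (simp add: split_beta)
  qed (use finI p0 p0' v(3) v'(3) in auto)
  then show ?thesis
    using weighted_log_sum(1)[OF fin2(1) u(1) v(2), of "\<lambda>i. ln (p i)" "\<lambda>j. ln (q j)"]
      weighted_log_sum(1)[OF fin2(2) u'(1) v'(2), of "\<lambda>i. ln (p' i)" "\<lambda>j. ln (q' j)"]
    by (simp add: split_beta)
qed

section \<open>From relative entropy to strong subadditivity\<close>

lemma sesq_block:
  assumes A: "finite A"
  shows "(\<Sum>a0\<in>A. sesq (A \<times> I) (\<lambda>(a, i). if a0 = a then f i else 0) M (\<lambda>(a, i). if a0 = a then f i else 0))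
    = sesq I f (trace_fst A M) f"
proof -
  have d: "(\<Sum>a\<in>A. if a0 = a then g a else 0) = g a0" if "a0 \<in> A" for a0 and g :: "'a \<Rightarrow> complex"
    using A that by simp
  have "(\<Sum>a0\<in>A. sesq (A \<times> I) (\<lambda>(a, i). if a0 = a then f i else 0) M (\<lambda>(a, i). if a0 = a then f i else 0))
    = (\<Sum>a0\<in>A. \<Sum>a\<in>A. if a0 = a then (\<Sum>i\<in>I. \<Sum>a'\<in>A. if a0 = a' then (\<Sum>i'\<in>I. cnj (f i) * M (a, i) (a', i') * f i') else 0) else 0)"
    unfolding sesq_def sum.cartesian_product' prod.case
    by (intro sum.cong refl) (auto intro!: sum.cong)
  also have "\<dots> = (\<Sum>a0\<in>A. \<Sum>i\<in>I. \<Sum>i'\<in>I. cnj (f i) * M (a0, i) (a0, i') * f i')"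
    by (intro sum.cong refl) (simp add: d)
  also have "\<dots> = (\<Sum>i\<in>I. \<Sum>a0\<in>A. \<Sum>i'\<in>I. cnj (f i) * M (a0, i) (a0, i') * f i')" by (rule sum.swap)
  also have "\<dots> = (\<Sum>i\<in>I. \<Sum>i'\<in>I. \<Sum>a0\<in>A. cnj (f i) * M (a0, i) (a0, i') * f i')"
    by (intro sum.cong[OF refl] sum.swap)
  finally show ?thesis unfolding sesq_def trace_fst_def by (simp only: sum_distrib_left sum_distrib_right)
qed

text \<open>For \<open>r = 0\<close> the logarithm diverges, but the factor \<open>r\<close> makes
  the whole expression constantly 0; this realises 0 log 0 = 0 when the regularisation is
  removed.\<close>

lemma tendsto_mult_ln_shift:
  fixes r h :: real
  assumes "0 \<le> r"
  shows "((\<lambda>x. ln (r + x * h) * r) \<longlongrightarrow> ln r * r) (at_right 0)"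
proof (cases "r = 0")
  case False
  have "((\<lambda>x. ln (r + x * h) * r) \<longlongrightarrow> ln (r + 0 * h) * r) (at_right 0)"
    by (intro tendsto_intros) (use False in auto)
  then show ?thesis by simp
qed simp

text \<open>Relative entropy is monotone under the trace over B; this is applied to M and
  id (x) N, where N is the trace of M over A, the latter regularised by a small multiple h of the
  identity.\<close>

theorem strong_subadditivity:
  assumes fin: "finite A" "finite B" "finite E" and M: "psd_on (A \<times> B \<times> E) M"
  shows "ent (A \<times> B \<times> E) M + ent E (trace_fst B (trace_fst A M))
    \<le> ent (A \<times> E) (trace_mid B M) + ent (B \<times> E) (trace_fst A M)"
proof (cases "B = {}")
  \<comment> \<open>An empty \<open>B\<close> is treated apart since the regularisation of the
    reduced operator is \<open>h\<close> times its cardinality.\<close>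
  case True
  then have "ent E (trace_fst B (trace_fst A M)) = ent E (\<lambda>i j. 0)" "ent (A \<times> E) (trace_mid B M) = ent (A \<times> E) (\<lambda>i j. 0)"
    by (auto simp: trace_fst_def trace_mid_def intro: ent_cong)
  then show ?thesis using True fin by (simp add: ent_zero ent_empty)
next
  case False
  have fin2: "finite (A \<times> B \<times> E)" "finite (A \<times> E)" "finite (B \<times> E)" using fin by auto
  define N where "N = trace_fst A M"
  define NE where "NE = trace_fst B N"
  have N: "psd_on (B \<times> E) N" unfolding N_def using psd_trace_fst[OF fin(1) fin2(3) M] .
  have NE: "psd_on E NE" unfolding NE_def using psd_trace_fst[OF fin(2,3) N] .
  note M' = psd_trace_mid[OF fin M]
  obtain u p where u: "spectral_on (A \<times> B \<times> E) (A \<times> B \<times> E) u p M" "complete_family (A \<times> B \<times> E) (A \<times> B \<times> E) u"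
    using spectral_theorem[OF fin2(1) psd_onD(1)[OF M]] .
  obtain u' p' where u': "spectral_on (A \<times> E) (A \<times> E) u' p' (trace_mid B M)" "complete_family (A \<times> E) (A \<times> E) u'"
    using spectral_theorem[OF fin2(2) psd_onD(1)[OF M']] .
  obtain y r where y: "spectral_on (B \<times> E) (B \<times> E) y r N" "complete_family (B \<times> E) (B \<times> E) y"
    using spectral_theorem[OF fin2(3) psd_onD(1)[OF N]] .
  obtain x t where x: "spectral_on E E x t NE" "complete_family E E x"
    using spectral_theorem[OF fin(3) psd_onD(1)[OF NE]] .
  note r0 = psd_spectral_nonneg[OF N y(1)] and t0 = psd_spectral_nonneg[OF NE x(1)]
  let ?m = "real (card B)"
  have m: "?m > 0" using False fin by (simp add: card_gt_0_iff)
  have main: "(\<Sum>i\<in>A \<times> E. p' i * ln (p' i)) - (\<Sum>l\<in>E. ln (t l + h * ?m) * t l)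
    \<le> (\<Sum>i\<in>A \<times> B \<times> E. p i * ln (p i)) - (\<Sum>k\<in>B \<times> E. ln (r k + h * 1) * r k)" if h: "h > 0" for h
  proof -
    let ?G = "\<lambda>(a :: 'a, i) (a', i'). if a = a' then N i i' + (if i = i' then complex_of_real h else 0) else 0 :: complex"
    let ?G' = "\<lambda>(a :: 'a, e) (a', e'). if a = a' then NE e e' + (if e = e' then complex_of_real (h * ?m) else 0) else 0 :: complex"
    let ?v = "\<lambda>(a :: 'a, k) (a', i). if a = a' then y k i else 0"
    let ?v' = "\<lambda>(a :: 'a, k) (a', i). if a = a' then x k i else 0"
    have v: "spectral_on (A \<times> B \<times> E) (A \<times> B \<times> E) ?v (\<lambda>(a, k). r k + h) ?G"
      by (rule spectral_block[OF fin(1) spectral_shift[OF y]])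
    have vc: "complete_family (A \<times> B \<times> E) (A \<times> B \<times> E) ?v" by (rule complete_block[OF fin(1) y(2)])
    have v': "spectral_on (A \<times> E) (A \<times> E) ?v' (\<lambda>(a, k). t k + h * ?m) ?G'"
      by (rule spectral_block[OF fin(1) spectral_shift[OF x]])
    have vc': "complete_family (A \<times> E) (A \<times> E) ?v'" by (rule complete_block[OF fin(1) x(2)])
    \<comment> \<open>Tracing over \<open>B\<close> the operator id \<otimes> (N + h) multiplies the
      shift by \<open>card B\<close>.\<close>
    have GG: "trace_mid B ?G i j = ?G' i j" for i j
    proof -
      obtain a e a' e' where ij: "i = (a, e)" "j = (a', e')" by (cases i, cases j) auto
      have "trace_mid B ?G (a, e) (a', e') = ?G' (a, e) (a', e')"
      proof (cases "a = a'")
        case True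
        have "trace_mid B ?G (a, e) (a', e') = (\<Sum>b\<in>B. N (b, e) (b, e') + (if e = e' then complex_of_real h else 0))"
          unfolding trace_mid_def using True by simp
        also have "\<dots> = NE e e' + (if e = e' then complex_of_real (h * ?m) else 0)"
          unfolding NE_def trace_fst_def by (simp add: sum.distrib mult.commute)
        finally show ?thesis using True by simp
      qed (simp add: trace_mid_def)
      then show ?thesis unfolding ij .
    qed
    have v'': "spectral_on (A \<times> E) (A \<times> E) ?v' (\<lambda>(a, k). t k + h * ?m) (trace_mid B ?G)"
      by (rule spectral_cong[OF v']) (rule GG)
    have pos: "0 < (case j of (a, k) \<Rightarrow> r k + h)" if "j \<in> A \<times> B \<times> E" for j
      using that r0 h by (auto intro: add_nonneg_pos)
    have pos': "0 < (case j of (a, k) \<Rightarrow> t k + h * ?m)" if "j \<in> A \<times> E" for j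
      using that t0 h m by (auto intro: add_nonneg_pos)
    have s: "(\<Sum>j\<in>A \<times> B \<times> E. ln (case j of (a, k) \<Rightarrow> r k + h) * Re (sesq (A \<times> B \<times> E) (?v j) M (?v j)))
      = (\<Sum>k\<in>B \<times> E. ln (r k + h * 1) * r k)"
    proof -
      have "(\<Sum>j\<in>A \<times> B \<times> E. ln (case j of (a, k) \<Rightarrow> r k + h) * Re (sesq (A \<times> B \<times> E) (?v j) M (?v j)))
        = (\<Sum>k\<in>B \<times> E. \<Sum>a\<in>A. ln (r k + h) * Re (sesq (A \<times> B \<times> E) (?v (a, k)) M (?v (a, k))))"
        unfolding sum.cartesian_product'[of _ A] prod.case by (rule sum.swap)
      also have "\<dots> = (\<Sum>k\<in>B \<times> E. ln (r k + h) * Re (sesq (B \<times> E) (y k) N (y k)))"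
        unfolding sum_distrib_left[symmetric] Re_sum[symmetric] prod.case N_def sesq_block[OF fin(1)] ..
      also have "\<dots> = (\<Sum>k\<in>B \<times> E. ln (r k + h * 1) * r k)"
        using spectral_eigen(1)[OF y(1)] orthonormal_ip[OF spectral_onD(2)[OF y(1)]]
        by (intro sum.cong refl) simp
      finally show ?thesis .
    qed
    have s': "(\<Sum>j\<in>A \<times> E. ln (case j of (a, k) \<Rightarrow> t k + h * ?m) * Re (sesq (A \<times> E) (?v' j) (trace_mid B M) (?v' j)))
      = (\<Sum>l\<in>E. ln (t l + h * ?m) * t l)"
    proof -
      have ne: "trace_fst A (trace_mid B M) = NE"
        unfolding NE_def N_def trace_fst_def trace_mid_def prod.case by (intro ext sum.swap)
      have "(\<Sum>j\<in>A \<times> E. ln (case j of (a, k) \<Rightarrow> t k + h * ?m) * Re (sesq (A \<times> E) (?v' j) (trace_mid B M) (?v' j)))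
        = (\<Sum>k\<in>E. \<Sum>a\<in>A. ln (t k + h * ?m) * Re (sesq (A \<times> E) (?v' (a, k)) (trace_mid B M) (?v' (a, k))))"
        unfolding sum.cartesian_product'[of _ A] prod.case by (rule sum.swap)
      also have "\<dots> = (\<Sum>k\<in>E. ln (t k + h * ?m) * Re (sesq E (x k) NE (x k)))"
        unfolding sum_distrib_left[symmetric] Re_sum[symmetric] prod.case sesq_block[OF fin(1)] ne ..
      also have "\<dots> = (\<Sum>l\<in>E. ln (t l + h * ?m) * t l)"
        using spectral_eigen(1)[OF x(1)] orthonormal_ip[OF spectral_onD(2)[OF x(1)]]
        by (intro sum.cong refl) simp
      finally show ?thesis .
    qed
    show ?thesis using relative_entropy_monotone[OF fin M u v vc pos u' v'' vc' pos'] unfolding s s' .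
  qed
  have "(\<Sum>i\<in>A \<times> E. p' i * ln (p' i)) - (\<Sum>l\<in>E. ln (t l) * t l)
    \<le> (\<Sum>i\<in>A \<times> B \<times> E. p i * ln (p i)) - (\<Sum>k\<in>B \<times> E. ln (r k) * r k)"
  proof (rule tendsto_le)
    show "((\<lambda>h. (\<Sum>i\<in>A \<times> E. p' i * ln (p' i)) - (\<Sum>l\<in>E. ln (t l + h * ?m) * t l))
      \<longlongrightarrow> (\<Sum>i\<in>A \<times> E. p' i * ln (p' i)) - (\<Sum>l\<in>E. ln (t l) * t l)) (at_right 0)"
      by (intro tendsto_diff tendsto_const tendsto_sum tendsto_mult_ln_shift t0)
    show "((\<lambda>h. (\<Sum>i\<in>A \<times> B \<times> E. p i * ln (p i)) - (\<Sum>k\<in>B \<times> E. ln (r k + h * 1) * r k))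
      \<longlongrightarrow> (\<Sum>i\<in>A \<times> B \<times> E. p i * ln (p i)) - (\<Sum>k\<in>B \<times> E. ln (r k) * r k)) (at_right 0)"
      by (intro tendsto_diff tendsto_const tendsto_sum tendsto_mult_ln_shift r0)
    show "\<forall>\<^sub>F h in at_right 0. (\<Sum>i\<in>A \<times> E. p' i * ln (p' i)) - (\<Sum>l\<in>E. ln (t l + h * ?m) * t l)
      \<le> (\<Sum>i\<in>A \<times> B \<times> E. p i * ln (p i)) - (\<Sum>k\<in>B \<times> E. ln (r k + h * 1) * r k)"
      using eventually_at_right_less[of "0::real"] by (rule eventually_mono) (rule main)
  qed simp
  moreover have e: "ent I K * ln 2 = - (\<Sum>k\<in>I. ln (e k) * e k)"
    if "finite I" "spectral_on I I w e K" for I :: "'i set" and w e K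
    unfolding ent_eq[OF that] eta_def log_def
    by (simp add: sum_negf sum_divide_distrib[symmetric] mult.commute)
  ultimately have "ent (A \<times> B \<times> E) M * ln 2 + ent E NE * ln 2
    \<le> ent (A \<times> E) (trace_mid B M) * ln 2 + ent (B \<times> E) N * ln 2"
    unfolding e[OF fin2(1) u(1)] e[OF fin2(2) u'(1)] e[OF fin2(3) y(1)] e[OF fin(3) x(1)]
    by (simp add: mult.commute)
  then have "(ent (A \<times> B \<times> E) M + ent E NE) * ln 2 \<le> (ent (A \<times> E) (trace_mid B M) + ent (B \<times> E) N) * ln 2"
    by (simp only: distrib_right)
  then have "ent (A \<times> B \<times> E) M + ent E NE \<le> ent (A \<times> E) (trace_mid B M) + ent (B \<times> E) N"
    by (rule mult_right_le_imp_le) simp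
  then show ?thesis unfolding N_def NE_def .
qed

section \<open>Conditional mutual information and its chain rule\<close>

definition cmi :: "'a set \<Rightarrow> 'b set \<Rightarrow> 'e set \<Rightarrow> ('a \<times> 'b \<times> 'e \<Rightarrow> 'a \<times> 'b \<times> 'e \<Rightarrow> complex) \<Rightarrow> real" where
  "cmi A B E M = ent (A \<times> E) (trace_mid B M) + ent (B \<times> E) (trace_fst A M)
     - ent (A \<times> B \<times> E) M - ent E (trace_fst B (trace_fst A M))"

lemma bij_betw_assoc: "bij_betw (\<lambda>((x, y), z). (x, y, z)) ((X \<times> Y) \<times> Z) (X \<times> Y \<times> Z)"
  by (rule bij_betwI[where g = "\<lambda>(x, y, z). ((x, y), z)"]) auto

lemma bij_betw_swap12: "bij_betw (\<lambda>(x, y, z). (y, x, z)) (X \<times> Y \<times> Z) (Y \<times> X \<times> Z)"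
  by (rule bij_betwI[where g = "\<lambda>(y, x, z). (x, y, z)"]) auto

lemma bij_betw_swap23: "bij_betw (\<lambda>(w, x, y, z). (w, y, x, z)) (W \<times> X \<times> Y \<times> Z) (W \<times> Y \<times> X \<times> Z)"
  by (rule bij_betwI[where g = "\<lambda>(w, y, x, z). (w, x, y, z)"]) auto

text \<open>The difference of the two sides is I(A2;B1|A1E) + I(B2;A1|B1E), and each summand is
  nonnegative by strong subadditivity.\<close>

lemma cmi_superadditive:
  fixes A1 :: "'a1 set" and A2 :: "'a2 set" and B1 :: "'b1 set" and B2 :: "'b2 set" and E :: "'e set"
  assumes fin: "finite A1" "finite A2" "finite B1" "finite B2" "finite E"
    and M: "psd_on ((A2 \<times> A1) \<times> (B2 \<times> B1) \<times> E) M"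
  defines "M2 \<equiv> (\<lambda>(a2, b2, a1, b1, e) (a2', b2', a1', b1', e'). M ((a2, a1), (b2, b1), e) ((a2', a1'), (b2', b1'), e'))"
  shows "cmi A1 B1 E (trace_fst B2 (trace_fst A2 M2)) + cmi A2 B2 (A1 \<times> B1 \<times> E) M2
    \<le> cmi (A2 \<times> A1) (B2 \<times> B1) E M"
proof -
  define h :: "'a2 \<times> 'b2 \<times> 'a1 \<times> 'b1 \<times> 'e \<Rightarrow> ('a2 \<times> 'a1) \<times> ('b2 \<times> 'b1) \<times> 'e"
    where "h = (\<lambda>(a2, b2, a1, b1, e). ((a2, a1), (b2, b1), e))"
  have hb: "bij_betw h (A2 \<times> B2 \<times> A1 \<times> B1 \<times> E) ((A2 \<times> A1) \<times> (B2 \<times> B1) \<times> E)"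
    by (rule bij_betwI[where g = "\<lambda>((a2, a1), (b2, b1), e). (a2, b2, a1, b1, e)"]) (auto simp: h_def)
  have M2: "psd_on (A2 \<times> B2 \<times> A1 \<times> B1 \<times> E) M2"
    using fin by (intro psd_comap[OF _ M, where h = h]) (auto simp: h_def M2_def)
  define M1 where "M1 = trace_fst B2 (trace_fst A2 M2)"
  define Q where "Q = trace_fst A2 M2"
  \<comment> \<open>The factors of the marginal without \<open>B2\<close> are permuted so that
    \<open>B1\<close> stands in the position traced out by \<open>trace_mid\<close>, as needed for
    I(A2;B1|A1E).\<close>
  define P where "P = (\<lambda>(a2, b1, a1, e) (a2', b1', a1', e'). trace_mid B2 M2 (a2, a1, b1, e) (a2', a1', b1', e'))"
  have mid: "psd_on (A2 \<times> A1 \<times> B1 \<times> E) (trace_mid B2 M2)" using fin by (intro psd_trace_mid[OF _ _ _ M2]) auto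
  have Q: "psd_on (B2 \<times> A1 \<times> B1 \<times> E) Q" unfolding Q_def using fin by (intro psd_trace_fst[OF _ _ M2]) auto
  have M1: "psd_on (A1 \<times> B1 \<times> E) M1" unfolding M1_def Q_def[symmetric] using fin by (intro psd_trace_fst[OF _ _ Q]) auto
  have P: "psd_on (A2 \<times> B1 \<times> A1 \<times> E) P"
    using fin by (intro psd_comap[OF _ mid, where h = "\<lambda>(w, x, y, z). (w, y, x, z)"]) (auto simp: P_def)
  have ssa1: "ent (A2 \<times> B1 \<times> A1 \<times> E) P + ent (A1 \<times> E) (trace_fst B1 (trace_fst A2 P))
    \<le> ent (A2 \<times> A1 \<times> E) (trace_mid B1 P) + ent (B1 \<times> A1 \<times> E) (trace_fst A2 P)"
    using fin P by (intro strong_subadditivity) auto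
  have ssa2: "ent (B2 \<times> A1 \<times> B1 \<times> E) Q + ent (B1 \<times> E) (trace_fst A1 (trace_fst B2 Q))
    \<le> ent (B2 \<times> B1 \<times> E) (trace_mid A1 Q) + ent (A1 \<times> B1 \<times> E) (trace_fst B2 Q)"
    using fin Q by (intro strong_subadditivity) auto
  have e1: "ent (A2 \<times> B1 \<times> A1 \<times> E) P = ent (A2 \<times> A1 \<times> B1 \<times> E) (trace_mid B2 M2)"
    using fin by (intro ent_reindex[OF bij_betw_swap23] psd_onD(1)[OF mid]) (auto simp: P_def)
  have tP: "trace_fst A2 P (b1, a1, e) (b1', a1', e') = M1 (a1, b1, e) (a1', b1', e')" for a1 b1 e a1' b1' e'
    unfolding P_def M1_def trace_fst_def trace_mid_def prod.case by (rule sum.swap)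
  have e2: "ent (A1 \<times> E) (trace_fst B1 (trace_fst A2 P)) = ent (A1 \<times> E) (trace_mid B1 M1)"
    by (intro ent_cong) (auto simp: trace_fst_def[of B1] trace_mid_def tP)
  have e3: "ent ((A2 \<times> A1) \<times> E) (trace_mid (B2 \<times> B1) M) = ent (A2 \<times> A1 \<times> E) (trace_mid B1 P)"
    using fin by (intro ent_reindex[OF bij_betw_assoc] psd_onD(1)[OF psd_trace_mid[OF _ _ _ P]])
      (auto simp: trace_mid_def P_def M2_def sum.cartesian_product' intro: sum.swap)
  have e4: "ent (B1 \<times> A1 \<times> E) (trace_fst A2 P) = ent (A1 \<times> B1 \<times> E) M1"
    using fin by (intro ent_reindex[OF bij_betw_swap12] psd_onD(1)[OF M1]) (auto simp: tP)
  have e5: "ent ((B2 \<times> B1) \<times> E) (trace_fst (A2 \<times> A1) M) = ent (B2 \<times> B1 \<times> E) (trace_mid A1 Q)"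
    using fin by (intro ent_reindex[OF bij_betw_assoc] psd_onD(1)[OF psd_trace_mid[OF _ _ _ Q]])
      (auto simp: trace_mid_def Q_def M2_def trace_fst_def sum.cartesian_product' intro: sum.swap)
  have e6: "ent (A2 \<times> B2 \<times> A1 \<times> B1 \<times> E) M2 = ent ((A2 \<times> A1) \<times> (B2 \<times> B1) \<times> E) M"
    using fin by (intro ent_reindex[OF hb] psd_onD(1)[OF M]) (auto simp: h_def M2_def)
  have e7: "ent E (trace_fst (B2 \<times> B1) (trace_fst (A2 \<times> A1) M)) = ent E (trace_fst B1 (trace_fst A1 M1))"
  proof (intro ent_cong)
    fix e e'
    show "trace_fst (B2 \<times> B1) (trace_fst (A2 \<times> A1) M) e e' = trace_fst B1 (trace_fst A1 M1) e e'"
      unfolding M1_def trace_fst_def M2_def prod.case sum.cartesian_product'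
      by (subst sum.swap, rule sum.cong[OF refl], subst (2) sum.swap) (intro sum.cong[OF refl] sum.swap)
  qed
  show ?thesis
    using ssa1 ssa2 unfolding cmi_def M1_def[symmetric] e1 e2 e3 e4 e5 e6 e7 Q_def[symmetric]
    unfolding M1_def Q_def by linarith
qed


section \<open>Matrices as kernels\<close>

lemma sesq_two_point:
  fixes c :: complex
  assumes "finite I" "i \<in> I" "j \<in> I"
  defines "f \<equiv> \<lambda>x. (if x = i then 1 else 0) + (if x = j then c else 0)"
  shows "sesq I f M f = M i i + c * M i j + cnj c * M j i + cnj c * c * M j j"
proof -
  have r: "(\<Sum>y\<in>I. M x y * f y) = M x i + c * M x j" for x
  proof -
    have "(\<Sum>y\<in>I. M x y * f y) = (\<Sum>y\<in>I. (if y = i then M x y else 0) + (if y = j then c * M x y else 0))"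
      unfolding f_def by (intro sum.cong refl) (simp add: algebra_simps)
    then show ?thesis using assms(1-3) by (simp add: sum.distrib)
  qed
  have "sesq I f M f = (\<Sum>x\<in>I. cnj (f x) * (M x i + c * M x j))"
    unfolding sesq_eq_ip ip_def r ..
  also have "\<dots> = (\<Sum>x\<in>I. (if x = i then M x i + c * M x j else 0) + (if x = j then cnj c * (M x i + c * M x j) else 0))"
    unfolding f_def by (intro sum.cong refl) (simp add: algebra_simps)
  finally show ?thesis using assms(1-3) by (simp add: sum.distrib algebra_simps)
qed

text \<open>Polarisation with coefficients 1 and \<i>. In \<open>positive_op\<close> Hermiticity is
  only implicit in the reality of the form, whereas \<open>psd_on\<close> states it.\<close>

lemma hermitian_of_real_form:
  assumes fin: "finite I" and re: "\<And>f. Im (sesq I f M f) = 0"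
  shows "hermitian_on I M"
proof (rule hermitian_onI)
  fix i j assume ij: "i \<in> I" "j \<in> I"
  \<comment> \<open>The two-point vector with coefficient 0 is a single coordinate vector, which
    isolates a diagonal entry.\<close>
  have d: "Im (M k k) = 0" if "k \<in> I" for k
    using re[of "\<lambda>x. (if x = k then 1 else 0) + (if x = k then 0 else 0)"] sesq_two_point[OF fin that that, of 0 M] by simp
  have 1: "Im (M i j + M j i) = 0"
    using re[of "\<lambda>x. (if x = i then 1 else 0) + (if x = j then 1 else 0)"] sesq_two_point[OF fin ij, of 1 M]
      d[OF ij(1)] d[OF ij(2)] by simp
  have 2: "Re (M i j) - Re (M j i) = 0"
    using re[of "\<lambda>x. (if x = i then 1 else 0) + (if x = j then \<i> else 0)"] sesq_two_point[OF fin ij, of \<i> M]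
      d[OF ij(1)] d[OF ij(2)] by simp
  show "M j i = cnj (M i j)" using 1 2 by (simp add: complex_eq_iff)
qed

lemma cscalar_prod_mult_mat_vec:
  assumes "M \<in> carrier_mat d d"
  shows "(M *\<^sub>v vec d f) \<bullet>c vec d f = sesq {..<d} f (\<lambda>i j. M $$ (i, j)) f"
proof -
  have "(M *\<^sub>v vec d f) \<bullet>c vec d f = (\<Sum>i<d. (\<Sum>j<d. M $$ (i, j) * f j) * cnj (f i))"
    using assms by (auto simp: scalar_prod_def atLeast0LessThan intro!: sum.cong)
  also have "\<dots> = sesq {..<d} f (\<lambda>i j. M $$ (i, j)) f"
    unfolding sesq_eq_ip ip_def by (intro sum.cong refl mult.commute)
  finally show ?thesis .
qed

lemma positive_op_iff_psd_on:
  "positive_op d M \<longleftrightarrow> M \<in> carrier_mat d d \<and> psd_on {..<d} (\<lambda>i j. M $$ (i, j))"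
proof (cases "M \<in> carrier_mat d d")
  case True
  let ?s = "\<lambda>f. sesq {..<d} f (\<lambda>i j. M $$ (i, j)) f"
  have v: "vec d (\<lambda>i. v $ i) = v" if "v \<in> carrier_vec d" for v :: "complex vec" using that by auto
  have "(\<forall>v \<in> carrier_vec d. 0 \<le> (M *\<^sub>v v) \<bullet>c v) \<longleftrightarrow> (\<forall>f. 0 \<le> ?s f)"
  proof
    assume "\<forall>v \<in> carrier_vec d. 0 \<le> (M *\<^sub>v v) \<bullet>c v"
    then show "\<forall>f. 0 \<le> ?s f" using cscalar_prod_mult_mat_vec[OF True] by (metis vec_carrier)
  next
    assume "\<forall>f. 0 \<le> ?s f"
    then show "\<forall>v \<in> carrier_vec d. 0 \<le> (M *\<^sub>v v) \<bullet>c v" using cscalar_prod_mult_mat_vec[OF True] v by metis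
  qed
  also have "\<dots> \<longleftrightarrow> psd_on {..<d} (\<lambda>i j. M $$ (i, j))"
  proof
    assume *: "\<forall>f. 0 \<le> ?s f"
    then show "psd_on {..<d} (\<lambda>i j. M $$ (i, j))"
      unfolding psd_on_def by (auto simp: less_eq_complex_def intro!: hermitian_of_real_form)
  next
    assume *: "psd_on {..<d} (\<lambda>i j. M $$ (i, j))"
    show "\<forall>f. 0 \<le> ?s f"
    proof
      fix f
      have "cnj (?s f) = ?s f" by (rule cnj_sesq[OF psd_onD(1)[OF *]])
      then have "Im (?s f) = 0" by (simp add: complex_eq_iff)
      then show "0 \<le> ?s f" using psd_onD(2)[OF *, of f] by (simp add: less_eq_complex_def)
    qed
  qed
  finally show ?thesis using True by (simp add: positive_op_def)
qed (simp add: positive_op_def)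

section \<open>Unitary diagonalisation, entropy and trace norm of matrices\<close>

lemma mat_adjoint_index:
  assumes "M \<in> carrier_mat n m"
  shows "mat_adjoint M \<in> carrier_mat m n" "i < m \<Longrightarrow> j < n \<Longrightarrow> mat_adjoint M $$ (i, j) = cnj (M $$ (j, i))"
  using assms by (auto simp: mat_adjoint_def mat_of_rows_def)

lemma diag_conj_index:
  assumes U: "U \<in> carrier_mat d d" and ij: "i < d" "j < d"
  shows "(U * mat_diag d g * mat_adjoint U) $$ (i, j) = (\<Sum>k<d. g k * U $$ (i, k) * cnj (U $$ (j, k)))"
proof -
  have "U * mat_diag d g = mat d d (\<lambda>(i, j). U $$ (i, j) * g j)"
    by (rule mat_diag_mult_right[OF U])
  then show ?thesis using U ij mat_adjoint_index[OF U]
    by (auto simp: scalar_prod_def atLeast0LessThan mult_ac intro!: sum.cong)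
qed

lemma unitary_op_spectral:
  assumes "unitary_op d U" and M: "M = U * mat_diag d (\<lambda>i. of_real (e i)) * mat_adjoint U"
  shows "spectral_on {..<d} {..<d} (\<lambda>k i. U $$ (i, k)) e (\<lambda>i j. M $$ (i, j))"
    "complete_family {..<d} {..<d} (\<lambda>k i. U $$ (i, k))"
proof -
  have U: "U \<in> carrier_mat d d" "U * mat_adjoint U = 1\<^sub>m d" "mat_adjoint U * U = 1\<^sub>m d"
    using assms(1) by (auto simp: unitary_op_def)
  note A = mat_adjoint_index[OF U(1)]
  have "ip {..<d} (\<lambda>i. U $$ (i, k)) (\<lambda>i. U $$ (i, l)) = (if k = l then 1 else 0)" if "k < d" "l < d" for k l
  proof -
    have "(mat_adjoint U * U) $$ (k, l) = (\<Sum>i<d. cnj (U $$ (i, k)) * U $$ (i, l))"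
      using that U(1) A by (auto simp: scalar_prod_def atLeast0LessThan intro!: sum.cong)
    then show ?thesis using U(3) that by (simp add: ip_def)
  qed
  then show "spectral_on {..<d} {..<d} (\<lambda>k i. U $$ (i, k)) e (\<lambda>i j. M $$ (i, j))"
    using diag_conj_index[OF U(1)] unfolding M by (auto simp: spectral_on_def orthonormal_def)
  have "(\<Sum>k<d. U $$ (i, k) * cnj (U $$ (j, k))) = (if i = j then 1 else 0)" if "i < d" "j < d" for i j
  proof -
    have "(U * mat_adjoint U) $$ (i, j) = (\<Sum>k<d. U $$ (i, k) * cnj (U $$ (j, k)))"
      using that U(1) A by (auto simp: scalar_prod_def atLeast0LessThan intro!: sum.cong)
    then show ?thesis using U(2) that by simp
  qed
  then show "complete_family {..<d} {..<d} (\<lambda>k i. U $$ (i, k))" by (auto simp: complete_family_def)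
qed

lemma unitary_diagonalisation:
  assumes M: "M \<in> carrier_mat d d" and h: "hermitian_on {..<d} (\<lambda>i j. M $$ (i, j))"
  obtains U e where "unitary_op d U" "M = U * mat_diag d (\<lambda>i. complex_of_real (e i)) * mat_adjoint U"
proof -
  obtain u e where u: "spectral_on {..<d} {..<d} u e (\<lambda>i j. M $$ (i, j))" "complete_family {..<d} {..<d} u"
    using spectral_theorem[OF _ h] by auto
  define U where "U = mat d d (\<lambda>(i, k). u k i)"
  have U: "U \<in> carrier_mat d d" by (simp add: U_def)
  note A = mat_adjoint_index[OF U]
  have "U * mat_adjoint U = 1\<^sub>m d"
  proof (rule eq_matI)
    fix i j assume "i < dim_row (1\<^sub>m d)" "j < dim_col (1\<^sub>m d)"
    then have ij: "i < d" "j < d" by auto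
    have "(U * mat_adjoint U) $$ (i, j) = (\<Sum>k<d. u k i * cnj (u k j))"
      using ij U A by (auto simp: scalar_prod_def atLeast0LessThan U_def intro!: sum.cong)
    then show "(U * mat_adjoint U) $$ (i, j) = 1\<^sub>m d $$ (i, j)" using u(2) ij by (simp add: complete_family_def)
  qed (use U A in auto)
  moreover have "mat_adjoint U * U = 1\<^sub>m d"
  proof (rule eq_matI)
    fix i j assume "i < dim_row (1\<^sub>m d)" "j < dim_col (1\<^sub>m d)"
    then have ij: "i < d" "j < d" by auto
    have "(mat_adjoint U * U) $$ (i, j) = ip {..<d} (u i) (u j)"
      using ij U A by (auto simp: scalar_prod_def atLeast0LessThan U_def ip_def intro!: sum.cong)
    then show "(mat_adjoint U * U) $$ (i, j) = 1\<^sub>m d $$ (i, j)"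
      using spectral_onD(2)[OF u(1)] ij by (simp add: orthonormal_def)
  qed (use U A in auto)
  moreover have "M = U * mat_diag d (\<lambda>i. complex_of_real (e i)) * mat_adjoint U"
  proof (rule eq_matI)
    fix i j assume "i < dim_row (U * mat_diag d (\<lambda>i. complex_of_real (e i)) * mat_adjoint U)"
      "j < dim_col (U * mat_diag d (\<lambda>i. complex_of_real (e i)) * mat_adjoint U)"
    then have ij: "i < d" "j < d" using U A by auto
    show "M $$ (i, j) = (U * mat_diag d (\<lambda>i. complex_of_real (e i)) * mat_adjoint U) $$ (i, j)"
      unfolding diag_conj_index[OF U ij] using spectral_onD(3)[OF u(1)] ij by (simp add: U_def)
  qed (use U A M in auto)
  ultimately show thesis using U by (intro that[of U e]) (simp_all add: unitary_op_def)
qed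

text \<open>The choice in \<open>spectral_fun\<close> comes with one eigenbasis shared by the
  operator and its image, and traces are computed in it. Independence of the choice then enters
  through \<open>ent_eq\<close> and \<open>spectral_sum_unique\<close>.\<close>

lemma spectral_fun_spectral:
  assumes M: "M \<in> carrier_mat d d" and h: "hermitian_on {..<d} (\<lambda>i j. M $$ (i, j))"
  obtains u e where "spectral_on {..<d} {..<d} u e (\<lambda>i j. M $$ (i, j))" "complete_family {..<d} {..<d} u"
    "spectral_fun f M \<in> carrier_mat d d"
    "spectral_on {..<d} {..<d} u (\<lambda>k. f (e k)) (\<lambda>i j. spectral_fun f M $$ (i, j))"
proof -
  have dim: "dim_row M = d" using M by auto
  obtain U e where "unitary_op d U" "M = U * mat_diag d (\<lambda>i. complex_of_real (e i)) * mat_adjoint U"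
    using unitary_diagonalisation[OF M h] .
  then have "\<exists>N U (e :: nat \<Rightarrow> real). unitary_op (dim_row M) U \<and>
     M = U * mat_diag (dim_row M) (\<lambda>i. of_real (e i)) * mat_adjoint U \<and>
     N = U * mat_diag (dim_row M) (\<lambda>i. of_real (f (e i))) * mat_adjoint U" unfolding dim by blast
  from someI_ex[OF this] obtain U and e :: "nat \<Rightarrow> real" where U: "unitary_op d U"
     "M = U * mat_diag d (\<lambda>i. of_real (e i)) * mat_adjoint U"
     "spectral_fun f M = U * mat_diag d (\<lambda>i. of_real (f (e i))) * mat_adjoint U"
    unfolding spectral_fun_def[symmetric] using M by auto
  have c: "spectral_fun f M \<in> carrier_mat d d"
    unfolding U(3) using U(1) mat_adjoint_index(1)[of U d d] by (auto simp: unitary_op_def)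
  show thesis
    by (rule that[OF unitary_op_spectral[OF U(1,2)] c unitary_op_spectral(1)[OF U(1,3)]])
qed

lemma entropy_eq_ent:
  assumes M: "M \<in> carrier_mat d d" and h: "hermitian_on {..<d} (\<lambda>i j. M $$ (i, j))"
  shows "entropy M = ent {..<d} (\<lambda>i j. M $$ (i, j))"
proof -
  obtain u e where u: "spectral_on {..<d} {..<d} u e (\<lambda>i j. M $$ (i, j))" "complete_family {..<d} {..<d} u"
    "spectral_fun (log 2) M \<in> carrier_mat d d"
    "spectral_on {..<d} {..<d} u (\<lambda>k. log 2 (e k)) (\<lambda>i j. spectral_fun (log 2) M $$ (i, j))"
    using spectral_fun_spectral[OF M h] .
  define N where "N = spectral_fun (log 2) M"
  have N: "N \<in> carrier_mat d d" using u(3) by (simp add: N_def)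
  have "mat_trace (M * N) = (\<Sum>i<d. \<Sum>j<d. M $$ (i, j) * N $$ (j, i))"
    unfolding mat_trace_def using M N by (auto simp: scalar_prod_def atLeast0LessThan intro!: sum.cong)
  also have "\<dots> = (\<Sum>i<d. \<Sum>j<d. \<Sum>k<d. of_real (log 2 (e k)) * (cnj (u k i) * M $$ (i, j) * u k j))"
    unfolding N_def by (intro sum.cong refl) (simp add: spectral_onD(3)[OF u(4)] sum_distrib_left mult_ac)
  also have "\<dots> = (\<Sum>k<d. \<Sum>i<d. \<Sum>j<d. of_real (log 2 (e k)) * (cnj (u k i) * M $$ (i, j) * u k j))"
    by (subst (2) sum.swap, subst sum.swap) (rule refl)
  also have "\<dots> = (\<Sum>k<d. of_real (log 2 (e k)) * sesq {..<d} (u k) (\<lambda>i j. M $$ (i, j)) (u k))"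
    unfolding sesq_def by (simp only: sum_distrib_left)
  also have "\<dots> = (\<Sum>k<d. of_real (log 2 (e k)) * of_real (e k))"
    using spectral_eigen(1)[OF u(1)] orthonormal_ip[OF spectral_onD(2)[OF u(1)]] by (intro sum.cong refl) simp
  also have "\<dots> = of_real (\<Sum>k<d. log 2 (e k) * e k)" by simp
  finally have "entropy M = - (\<Sum>k<d. log 2 (e k) * e k)"
    unfolding entropy_def N_def by (simp del: of_real_sum)
  also have "\<dots> = ent {..<d} (\<lambda>i j. M $$ (i, j))"
    unfolding ent_eq[OF _ u(1), simplified] eta_def by (simp add: sum_negf mult.commute)
  finally show ?thesis .
qed

text \<open>The product of the adjoint of \<open>D\<close> with \<open>D\<close> has the same
  eigenvectors with squared eigenvalues, and by \<open>spectral_sum_unique\<close> the sum of their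
  roots does not depend on the decomposition. As \<open>sqrt 0 = 0\<close>, the family
  \<open>u\<close> may be incomplete.\<close>

lemma trace_norm_spectral:
  assumes D: "D \<in> carrier_mat d d" and u: "spectral_on {..<d} K u e (\<lambda>i j. D $$ (i, j))"
  shows "trace_norm D = (\<Sum>k\<in>K. \<bar>e k\<bar>)"
proof -
  define M where "M = mat_adjoint D * D"
  note A = mat_adjoint_index[OF D]
  have M: "M \<in> carrier_mat d d" using A D by (simp add: M_def)
  have Mij: "M $$ (i, j) = (\<Sum>k\<in>K. of_real ((e k)\<^sup>2) * u k i * cnj (u k j))" if ij: "i < d" "j < d" for i j
  proof -
    have "M $$ (i, j) = (\<Sum>l<d. cnj (D $$ (l, i)) * D $$ (l, j))"
      unfolding M_def using ij A D by (auto simp: scalar_prod_def atLeast0LessThan intro!: sum.cong)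
    also have "\<dots> = ip {..<d} (\<lambda>l. \<Sum>k\<in>K. (of_real (e k) * cnj (u k i)) * u k l) (\<lambda>l. \<Sum>k\<in>K. (of_real (e k) * cnj (u k j)) * u k l)"
      unfolding ip_def using ij by (intro sum.cong refl) (simp add: spectral_onD(3)[OF u] mult_ac)
    also have "\<dots> = (\<Sum>k\<in>K. cnj (of_real (e k) * cnj (u k i)) * (\<Sum>l\<in>K. (of_real (e l) * cnj (u l j)) * ip {..<d} (u k) (u l)))"
      by (simp only: ip_sum_left ip_sum_right)
    also have "\<dots> = (\<Sum>k\<in>K. cnj (of_real (e k) * cnj (u k i)) * (\<Sum>l\<in>K. if k = l then of_real (e l) * cnj (u l j) else 0))"
      using spectral_onD(2)[OF u] by (intro sum.cong refl arg_cong2[where f = "(*)"]) (simp add: orthonormal_ip)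
    also have "\<dots> = (\<Sum>k\<in>K. of_real ((e k)\<^sup>2) * u k i * cnj (u k j))"
      using spectral_onD(1)[OF u] by (intro sum.cong refl) (simp add: power2_eq_square mult_ac)
    finally show ?thesis .
  qed
  have M2: "spectral_on {..<d} K u (\<lambda>k. (e k)\<^sup>2) (\<lambda>i j. M $$ (i, j))"
    using u Mij by (auto simp: spectral_on_def)
  obtain v c where v: "spectral_on {..<d} {..<d} v c (\<lambda>i j. M $$ (i, j))" "complete_family {..<d} {..<d} v"
    "spectral_fun sqrt M \<in> carrier_mat d d"
    "spectral_on {..<d} {..<d} v (\<lambda>k. sqrt (c k)) (\<lambda>i j. spectral_fun sqrt M $$ (i, j))"
    using spectral_fun_spectral[OF M spectral_hermitian[OF M2]] .
  have "mat_trace (spectral_fun sqrt M) = of_real (\<Sum>k<d. sqrt (c k))"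
    unfolding mat_trace_def using v(3) spectral_trace[OF v(4)] by simp
  then have "trace_norm D = (\<Sum>k<d. sqrt (c k))" unfolding trace_norm_def M_def[symmetric] by (simp del: of_real_sum)
  also have "\<dots> = (\<Sum>k\<in>K. sqrt ((e k)\<^sup>2))"
    using spectral_sum_unique[OF _ M2 v(1,2), of sqrt] by simp
  finally show ?thesis by simp
qed

section \<open>Numbers as pairs and triples of digits\<close>

lemma index_less: "i < a \<Longrightarrow> k < e \<Longrightarrow> i * e + k < a * e" for i a k e :: nat
proof -
  assume "i < a" "k < e"
  then have "i * e + k < Suc i * e" by simp
  also have "Suc i * e \<le> a * e" using \<open>i < a\<close> by (intro mult_le_mono1) simp
  finally show "i * e + k < a * e" .
qed

lemma bij_betw_div_mod:
  "bij_betw (\<lambda>x::nat. (x div e, x mod e)) {..<a * e} ({..<a} \<times> {..<e})"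
proof (cases "e = 0")
  case False
  show ?thesis
    by (rule bij_betwI[where g = "\<lambda>(i, k). i * e + k"])
       (use False in \<open>auto simp: less_mult_imp_div_less index_less\<close>)
qed (simp add: bij_betw_def)

lemma bij_betw_div_mod_triple:
  "bij_betw (\<lambda>x::nat. (x div (b * e), x div e mod b, x mod e)) {..<a * b * e} ({..<a} \<times> {..<b} \<times> {..<e})"
proof -
  have "bij_betw (\<lambda>(i, y). (i, (y div e, y mod e))) ({..<a} \<times> {..<b * e}) ({..<a} \<times> ({..<b} \<times> {..<e}))"
    using bij_betw_div_mod[of e b] unfolding bij_betw_def inj_on_def by (auto simp: image_iff set_eq_iff)
  from bij_betw_trans[OF bij_betw_div_mod[of "b * e" a] this]
  have "bij_betw (\<lambda>x. (x div (b * e), (x mod (b * e) div e, x mod (b * e) mod e))) {..<a * (b * e)} ({..<a} \<times> {..<b} \<times> {..<e})"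
    by (simp add: o_def)
  moreover have "x mod (b * e) div e = x div e mod b" "x mod (b * e) mod e = x mod e" for x :: nat
    by (cases "e = 0"; simp add: mult.commute[of b e] mod_mult2_eq)+
  ultimately show ?thesis by (simp add: mult.assoc)
qed


section \<open>Superadditivity of squashed entanglement\<close>

lemma index_digits:
  fixes i j k b e :: nat
  assumes "j < b" "k < e"
  shows "((i * b + j) * e + k) div (b * e) = i" "((i * b + j) * e + k) div e mod b = j" "((i * b + j) * e + k) mod e = k"
    "((i * b + j) * e + k) div e = i * b + j"
proof -
  show 1: "((i * b + j) * e + k) div e = i * b + j" "((i * b + j) * e + k) mod e = k" using assms by auto
  then show "((i * b + j) * e + k) div e mod b = j" using assms by simp
  have "((i * b + j) * e + k) div (e * b) = i" unfolding div_mult2_eq 1 using assms by simp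
  then show "((i * b + j) * e + k) div (b * e) = i" by (simp add: mult.commute)
qed

lemma sum_div_mod:
  fixes f :: "nat \<Rightarrow> 'a::comm_monoid_add"
  shows "(\<Sum>x<a * b. f x) = (\<Sum>i<a. \<Sum>j<b. f (i * b + j))"
proof -
  have "(\<Sum>i<a. \<Sum>j<b. f (i * b + j)) = (\<Sum>x<a * b. (\<lambda>(i, j). f (i * b + j)) (x div b, x mod b))"
    unfolding sum.reindex_bij_betw[OF bij_betw_div_mod] by (simp only: sum.cartesian_product' prod.case)
  then show ?thesis by simp
qed

text \<open>This is the passage from kernels on tuples to the matrix definition. The extending
  system may be indexed by any finite set, such as a product or a disjoint sum; enumerating it
  permutes basis vectors and changes no entropy.\<close>

lemma squashed_entanglement_le:
  fixes E :: "'e set" and \<rho> :: "complex mat"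
  assumes fin: "finite E" and M: "psd_on ({..<a} \<times> {..<b} \<times> E) M" and \<rho>: "state (a * b) \<rho>"
    and ext: "\<And>i j i' j'. i < a \<Longrightarrow> j < b \<Longrightarrow> i' < a \<Longrightarrow> j' < b \<Longrightarrow>
      (\<Sum>k\<in>E. M (i, j, k) (i', j', k)) = \<rho> $$ (i * b + j, i' * b + j')"
  shows "squashed_entanglement a b \<rho> \<le> ereal (cmi {..<a} {..<b} E M / 2)"
proof -
  define e where "e = card E"
  obtain h where h: "bij_betw h {..<e} E"
    using ex_bij_betw_nat_finite[OF fin] by (auto simp: atLeast0LessThan e_def)
  have re: "(\<Sum>k<e. F (h k)) = (\<Sum>k\<in>E. F k)" for F :: "'e \<Rightarrow> complex"
    by (rule sum.reindex_bij_betw[OF h])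
  have \<rho>c: "\<rho> \<in> carrier_mat (a * b) (a * b)" using \<rho> by (simp add: state_def positive_op_def)
  let ?A = "{..<a}" and ?B = "{..<b}"
  define g where "g x = (x div (b * e), x div e mod b, h (x mod e))" for x
  define \<sigma> where "\<sigma> = mat (a * b * e) (a * b * e) (\<lambda>(x, y). M (g x) (g y))"
  have \<sigma>c: "\<sigma> \<in> carrier_mat (a * b * e) (a * b * e)" by (simp add: \<sigma>_def)
  have hb: "bij_betw (\<lambda>(i, k). (i, h k)) (X \<times> {..<e}) (X \<times> E)" for X :: "'x set"
    using h unfolding bij_betw_def inj_on_def by (auto simp: image_iff set_eq_iff)
  have hb3: "bij_betw (\<lambda>(i, j, k). (i, j, h k)) (X \<times> Y \<times> {..<e}) (X \<times> Y \<times> E)" for X :: "'x set" and Y :: "'y set"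
    using h unfolding bij_betw_def inj_on_def by (auto simp: image_iff set_eq_iff)
  have g: "bij_betw g {..<a * b * e} (?A \<times> ?B \<times> E)"
    using bij_betw_trans[OF bij_betw_div_mod_triple hb3] by (simp add: g_def[abs_def] o_def)
  have g2: "bij_betw (\<lambda>x. (x div e, h (x mod e))) {..<n * e} ({..<n} \<times> E)" for n
    using bij_betw_trans[OF bij_betw_div_mod hb] by (simp add: o_def)
  have gi: "g ((i * b + j) * e + k) = (i, j, h k)" if "j < b" "k < e" for i j k
    using index_digits[OF that] by (simp add: g_def)
  have \<sigma>i: "\<sigma> $$ ((i * b + j) * e + k, (i' * b + j') * e + k') = M (i, j, h k) (i', j', h k')"
    if "i < a" "j < b" "k < e" "i' < a" "j' < b" "k' < e" for i j k i' j' k'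
  proof -
    have "(i * b + j) * e + k < a * b * e" "(i' * b + j') * e + k' < a * b * e"
      using that by (auto intro!: index_less)
    then show ?thesis using that by (simp add: \<sigma>_def gi)
  qed
  have gI: "g ` {..<a * b * e} = ?A \<times> ?B \<times> E" using g by (simp add: bij_betw_def)
  have psd: "psd_on {..<a * b * e} (\<lambda>x y. \<sigma> $$ (x, y))"
    by (rule psd_comap[OF _ M, where h = g]) (use fin gI in \<open>auto simp: \<sigma>_def\<close>)
  have pt3: "partial_trace (a * b) e 1 \<sigma> = \<rho>"
  proof (rule eq_matI)
    fix x y assume "x < dim_row \<rho>" "y < dim_col \<rho>"
    then have xy: "x < a * b" "y < a * b" using \<rho>c by auto
    then have b: "b > 0" by (cases b) auto
    have d: "x div b < a" "y div b < a" using xy by (auto simp: less_mult_imp_div_less)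
    have "partial_trace (a * b) e 1 \<sigma> $$ (x, y) = (\<Sum>k<e. \<sigma> $$ ((x div b * b + x mod b) * e + k, (y div b * b + y mod b) * e + k))"
      using xy by (simp add: partial_trace_def)
    also have "\<dots> = (\<Sum>k<e. M (x div b, x mod b, h k) (y div b, y mod b, h k))"
      using d b by (intro sum.cong refl \<sigma>i) auto
    also have "\<dots> = \<rho> $$ (x div b * b + x mod b, y div b * b + y mod b)"
      unfolding re[of "\<lambda>k. M (x div b, x mod b, k) (y div b, y mod b, k)"] using d b by (intro ext) auto
    finally show "partial_trace (a * b) e 1 \<sigma> $$ (x, y) = \<rho> $$ (x, y)" by simp
  qed (use \<rho>c in \<open>auto simp: partial_trace_def\<close>)
  \<comment> \<open>Normalisation is inherited from the reduced state, the trace over the last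
    factor preserving the total trace.\<close>
  have "mat_trace \<sigma> = (\<Sum>x<a * b. \<Sum>k<e. \<sigma> $$ (x * e + k, x * e + k))"
    unfolding mat_trace_def using \<sigma>c by (simp add: sum_div_mod)
  also have "\<dots> = mat_trace (partial_trace (a * b) e 1 \<sigma>)"
    unfolding mat_trace_def by (simp add: partial_trace_def)
  finally have st: "state (a * b * e) \<sigma>"
    using psd \<sigma>c \<rho> unfolding pt3 by (simp add: state_def positive_op_iff_psd_on)
  have M13: "psd_on (?A \<times> E) (trace_mid ?B M)" using fin by (intro psd_trace_mid[OF _ _ _ M]) auto
  have M23: "psd_on (?B \<times> E) (trace_fst ?A M)" using fin by (intro psd_trace_fst[OF _ _ M]) auto
  have M3: "psd_on E (trace_fst ?B (trace_fst ?A M))" using fin by (intro psd_trace_fst[OF _ _ M23]) auto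
  \<comment> \<open>All four entropies are compared in the same way: each marginal matrix is a
    positive kernel read along a bijection of its index set.\<close>
  have entr: "entropy N = ent I K"
    if N: "N \<in> carrier_mat n n" and f: "bij_betw f {..<n} I" and I: "finite I" and K: "psd_on I K"
      and eq: "\<And>x y. x < n \<Longrightarrow> y < n \<Longrightarrow> N $$ (x, y) = K (f x) (f y)"
    for N n and f :: "nat \<Rightarrow> 'x" and I K
  proof -
    have "psd_on {..<n} (\<lambda>x y. N $$ (x, y))"
      using f by (intro psd_comap[OF I K, where h = f]) (auto simp: eq bij_betw_def)
    then have "entropy N = ent {..<n} (\<lambda>x y. N $$ (x, y))" by (intro entropy_eq_ent N psd_onD(1))
    also have "\<dots> = ent I K" by (rule ent_reindex[OF f I psd_onD(1)[OF K]]) (simp add: eq)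
    finally show ?thesis .
  qed
  have "entropy \<sigma> = ent (?A \<times> ?B \<times> E) M"
    by (rule entr[OF \<sigma>c g _ M]) (use fin in \<open>auto simp: \<sigma>_def\<close>)
  moreover have "entropy (partial_trace a b e \<sigma>) = ent (?A \<times> E) (trace_mid ?B M)"
  proof (rule entr[OF _ g2 _ M13])
    fix x y assume xy: "x < a * e" "y < a * e"
    then have e: "e > 0" by (cases e) auto
    have d: "x div e < a" "y div e < a" using xy by (auto simp: less_mult_imp_div_less)
    have "partial_trace a b e \<sigma> $$ (x, y) = (\<Sum>k<b. \<sigma> $$ ((x div e * b + k) * e + x mod e, (y div e * b + k) * e + y mod e))"
      using xy by (simp add: partial_trace_def)
    also have "\<dots> = (\<Sum>k<b. M (x div e, k, h (x mod e)) (y div e, k, h (y mod e)))"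
      using d e by (intro sum.cong refl \<sigma>i) auto
    finally show "partial_trace a b e \<sigma> $$ (x, y) = trace_mid ?B M (x div e, h (x mod e)) (y div e, h (y mod e))"
      by (simp add: trace_mid_def)
  qed (use fin in \<open>auto simp: partial_trace_def\<close>)
  moreover have "entropy (partial_trace 1 a (b * e) \<sigma>) = ent (?B \<times> E) (trace_fst ?A M)"
  proof (rule entr[OF _ g2 _ M23])
    fix x y assume xy: "x < b * e" "y < b * e"
    then have e: "e > 0" by (cases e) auto
    have d: "x div e < b" "y div e < b" using xy by (auto simp: less_mult_imp_div_less)
    have s: "k * (b * e) + z = (k * b + z div e) * e + z mod e" for k z :: nat
      by (simp add: algebra_simps)
    have "partial_trace 1 a (b * e) \<sigma> $$ (x, y) = (\<Sum>k<a. \<sigma> $$ (k * (b * e) + x, k * (b * e) + y))"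
      using xy by (simp add: partial_trace_def)
    also have "\<dots> = (\<Sum>k<a. M (k, x div e, h (x mod e)) (k, y div e, h (y mod e)))"
      unfolding s using d e by (intro sum.cong refl \<sigma>i) auto
    finally show "partial_trace 1 a (b * e) \<sigma> $$ (x, y) = trace_fst ?A M (x div e, h (x mod e)) (y div e, h (y mod e))"
      by (simp add: trace_fst_def)
  qed (use fin in \<open>auto simp: partial_trace_def\<close>)
  moreover have "entropy (partial_trace 1 (a * b) e \<sigma>) = ent E (trace_fst ?B (trace_fst ?A M))"
  proof (rule entr[OF _ h _ M3])
    fix x y assume xy: "x < e" "y < e"
    have "partial_trace 1 (a * b) e \<sigma> $$ (x, y) = (\<Sum>k<a * b. \<sigma> $$ (k * e + x, k * e + y))"
      using xy by (simp add: partial_trace_def)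
    also have "\<dots> = (\<Sum>i<a. \<Sum>j<b. \<sigma> $$ ((i * b + j) * e + x, (i * b + j) * e + y))"
      by (rule sum_div_mod)
    also have "\<dots> = (\<Sum>i<a. \<Sum>j<b. M (i, j, h x) (i, j, h y))"
      using xy by (intro sum.cong refl \<sigma>i) auto
    also have "\<dots> = (\<Sum>j<b. \<Sum>i<a. M (i, j, h x) (i, j, h y))" by (rule sum.swap)
    finally show "partial_trace 1 (a * b) e \<sigma> $$ (x, y) = trace_fst ?B (trace_fst ?A M) (h x) (h y)"
      by (simp add: trace_fst_def)
  qed (use fin in \<open>auto simp: partial_trace_def\<close>)
  ultimately have "cond_mutual_info a b e \<sigma> = cmi ?A ?B E M"
    unfolding cond_mutual_info_def cmi_def by simp
  then show ?thesis unfolding squashed_entanglement_def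
    by (intro Inf_lower) (use st pt3 in force)
qed

text \<open>Entries of the bipartite power, the A parts x, x' and the B parts y, y' of the row and
  column index being given separately.\<close>

definition power_kernel :: "nat \<Rightarrow> nat \<Rightarrow> nat \<Rightarrow> complex mat \<Rightarrow> nat \<Rightarrow> nat \<Rightarrow> nat \<Rightarrow> nat \<Rightarrow> complex" where
  "power_kernel a b n \<rho> x y x' y' = (\<Prod>k<n. \<rho> $$ (x div a ^ k mod a * b + y div b ^ k mod b,
      x' div a ^ k mod a * b + y' div b ^ k mod b))"

lemma div_power_mod:
  fixes a i x :: nat
  assumes "k < n"
  shows "(i * a ^ n + x) div a ^ k mod a = x div a ^ k mod a"
proof (cases "a = 0")
  case False
  obtain m where n: "n = k + Suc m" using assms less_imp_Suc_add by auto
  have "(i * a ^ n + x) div a ^ k = i * a ^ Suc m + x div a ^ k"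
    using div_mult_self3[of "a ^ k" "i * a ^ Suc m" x] False unfolding n power_add by (simp add: mult_ac)
  then show ?thesis using mod_mult_self3[of "i * a ^ m" a "x div a ^ k"] by (simp add: mult_ac)
qed (use assms in \<open>cases n; simp\<close>)

text \<open>The new copy is the leading digit of both parts, so it is split off by division with
  remainder by \<open>a ^ n\<close> and \<open>b ^ n\<close>, and the lower digits are
  unaffected.\<close>

lemma power_kernel_Suc:
  assumes "i < a" "j < b" "i' < a" "j' < b" "x < a ^ n" "y < b ^ n" "x' < a ^ n" "y' < b ^ n"
  shows "power_kernel a b (Suc n) \<rho> (i * a ^ n + x) (j * b ^ n + y) (i' * a ^ n + x') (j' * b ^ n + y')
    = power_kernel a b n \<rho> x y x' y' * \<rho> $$ (i * b + j, i' * b + j')"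
  unfolding power_kernel_def prod.lessThan_Suc
  using assms by (intro arg_cong2[where f = "(*)"] prod.cong refl) (simp_all add: div_power_mod)

lemma power_kernel_trace:
  assumes tr: "mat_trace \<rho> = 1" "\<rho> \<in> carrier_mat (a * b) (a * b)"
  shows "(\<Sum>x<a ^ n. \<Sum>y<b ^ n. power_kernel a b n \<rho> x y x y) = 1"
proof (induction n)
  case 0
  then show ?case by (simp add: power_kernel_def)
next
  case (Suc n)
  have t: "(\<Sum>i<a. \<Sum>j<b. \<rho> $$ (i * b + j, i * b + j)) = 1"
    using tr unfolding mat_trace_def by (simp add: sum_div_mod)
  have "(\<Sum>x<a ^ Suc n. \<Sum>y<b ^ Suc n. power_kernel a b (Suc n) \<rho> x y x y)
    = (\<Sum>i<a. \<Sum>x<a ^ n. \<Sum>j<b. \<Sum>y<b ^ n. power_kernel a b n \<rho> x y x y * \<rho> $$ (i * b + j, i * b + j))"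
    unfolding power_Suc sum_div_mod by (intro sum.cong refl power_kernel_Suc) auto
  also have "\<dots> = (\<Sum>i<a. \<Sum>j<b. \<Sum>x<a ^ n. \<Sum>y<b ^ n. power_kernel a b n \<rho> x y x y * \<rho> $$ (i * b + j, i * b + j))"
    by (intro sum.cong[OF refl] sum.swap)
  also have "\<dots> = (\<Sum>i<a. \<Sum>j<b. 1 * \<rho> $$ (i * b + j, i * b + j))"
    unfolding sum_distrib_right[symmetric] Suc.IH ..
  finally show ?case using t by simp
qed

lemma cmi_nonneg:
  assumes "finite A" "finite B" "finite E" "psd_on (A \<times> B \<times> E) M"
  shows "0 \<le> cmi A B E M"
  using strong_subadditivity[OF assms] by (simp add: cmi_def)

lemma cmi_reindex:
  assumes fin: "finite A" "finite B" "finite E" and M: "psd_on (A \<times> B \<times> E) M"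
    and f: "bij_betw f A' A" and g: "bij_betw g B' B"
  defines "N \<equiv> (\<lambda>(x, y, k) (x', y', k'). M (f x, g y, k) (f x', g y', k'))"
  shows "cmi A' B' E N = cmi A B E M"
proof -
  have b: "bij_betw (\<lambda>(x, k). (h x, k)) (X' \<times> E) (X \<times> E)" if "bij_betw h X' X"
    for h and X :: "'x set" and X' :: "'y set"
    using that unfolding bij_betw_def inj_on_def by (auto simp: image_iff set_eq_iff)
  have b3: "bij_betw (\<lambda>(x, y, k). (f x, g y, k)) (A' \<times> B' \<times> E) (A \<times> B \<times> E)"
    using f g unfolding bij_betw_def inj_on_def by (auto simp: image_iff set_eq_iff)
  have M13: "psd_on (A \<times> E) (trace_mid B M)" using fin by (intro psd_trace_mid[OF _ _ _ M]) auto
  have M23: "psd_on (B \<times> E) (trace_fst A M)" using fin by (intro psd_trace_fst[OF _ _ M]) auto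
  have e1: "ent (A' \<times> B' \<times> E) N = ent (A \<times> B \<times> E) M"
    using fin by (intro ent_reindex[OF b3] psd_onD(1)[OF M]) (auto simp: N_def)
  have tm: "trace_mid B' N (x, k) (x', k') = trace_mid B M (f x, k) (f x', k')" for x k x' k'
    unfolding trace_mid_def N_def prod.case by (rule sum.reindex_bij_betw[OF g, of "\<lambda>y. M (f x, y, k) (f x', y, k')"])
  have e2: "ent (A' \<times> E) (trace_mid B' N) = ent (A \<times> E) (trace_mid B M)"
    using fin by (intro ent_reindex[OF b[OF f]] psd_onD(1)[OF M13]) (auto simp: tm)
  have tf: "trace_fst A' N (y, k) (y', k') = trace_fst A M (g y, k) (g y', k')" for y k y' k'
    unfolding trace_fst_def N_def prod.case by (rule sum.reindex_bij_betw[OF f, of "\<lambda>x. M (x, g y, k) (x, g y', k')"])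
  have e3: "ent (B' \<times> E) (trace_fst A' N) = ent (B \<times> E) (trace_fst A M)"
    using fin by (intro ent_reindex[OF b[OF g]] psd_onD(1)[OF M23]) (auto simp: tf)
  have "trace_fst B' (trace_fst A' N) k k' = trace_fst B (trace_fst A M) k k'" for k k'
    unfolding trace_fst_def[of B'] tf trace_fst_def[of B]
    by (rule sum.reindex_bij_betw[OF g, of "\<lambda>y. trace_fst A M (y, k) (y, k')"])
  then show ?thesis unfolding cmi_def e1 e2 e3 by (simp cong: ent_cong)
qed

lemma bij_betw_mult_add: "bij_betw (\<lambda>(i, x). i * m + x) ({..<a} \<times> {..<m}) {..<a * m}" for a m :: nat
proof (cases "m = 0")
  case False
  then show ?thesis
    by (intro bij_betwI[where g = "\<lambda>x. (x div m, x mod m)"]) (auto simp: less_mult_imp_div_less index_less)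
qed (simp add: bij_betw_def)

text \<open>Squashed entanglement is superadditive: the chain rule extracts from an extension of the
  power one extension of each copy, the earlier copies joining the extending system.\<close>

lemma cmi_power_ge:
  fixes E :: "'e set" and \<rho> :: "complex mat"
  assumes \<rho>: "state (a * b) \<rho>"
    and c: "ereal (c / 2) \<le> squashed_entanglement a b \<rho>"
    and "finite E" and "psd_on ({..<a ^ n} \<times> {..<b ^ n} \<times> E) M"
    and "\<And>x y x' y'. x < a ^ n \<Longrightarrow> y < b ^ n \<Longrightarrow> x' < a ^ n \<Longrightarrow> y' < b ^ n \<Longrightarrow>
      (\<Sum>k\<in>E. M (x, y, k) (x', y', k)) = power_kernel a b n \<rho> x y x' y'"
  shows "real n * c \<le> cmi {..<a ^ n} {..<b ^ n} E M"
  using assms(3-5)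
proof (induction n arbitrary: E M)
  case 0
  then show ?case using cmi_nonneg[of "{..<a ^ 0}" "{..<b ^ 0}" E M] by simp
next
  case (Suc n)
  note M = Suc.prems(2)
  let ?A = "{..<a}" and ?B = "{..<b}" and ?An = "{..<a ^ n}" and ?Bn = "{..<b ^ n}"
  let ?f = "\<lambda>(i, x). i * a ^ n + x" and ?g = "\<lambda>(j, y). j * b ^ n + y"
  define N where "N = (\<lambda>(p, q, k) (p', q', k'). M (?f p, ?g q, k) (?f p', ?g q', k' :: 'e))"
  have f: "bij_betw ?f (?A \<times> ?An) {..<a ^ Suc n}" and g: "bij_betw ?g (?B \<times> ?Bn) {..<b ^ Suc n}"
    unfolding power_Suc by (rule bij_betw_mult_add)+
  have N: "psd_on ((?A \<times> ?An) \<times> (?B \<times> ?Bn) \<times> E) N"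
    using Suc.prems(1) by (intro psd_comap[OF _ M, where h = "\<lambda>(p, q, k). (?f p, ?g q, k)"])
      (auto simp: N_def intro!: index_less)
  have cN: "cmi (?A \<times> ?An) (?B \<times> ?Bn) E N = cmi {..<a ^ Suc n} {..<b ^ Suc n} E M"
    unfolding N_def by (rule cmi_reindex[OF _ _ Suc.prems(1) M f g]) auto
  define M2 where "M2 = (\<lambda>(a2, b2, a1, b1, e) (a2', b2', a1', b1', e'). N ((a2, a1), (b2, b1), e) ((a2', a1'), (b2', b1'), e'))"
  define M1 where "M1 = trace_fst ?B (trace_fst ?A M2)"
  \<comment> \<open>The leading copy plays the role of A2 B2. It is extended by all the rest,
    whereas the remaining n copies keep \<open>E\<close> itself as extending system; hence the index
    type of \<open>E\<close> stays fixed throughout the induction.\<close>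
  have le: "cmi ?An ?Bn E M1 + cmi ?A ?B (?An \<times> ?Bn \<times> E) M2 \<le> cmi (?A \<times> ?An) (?B \<times> ?Bn) E N"
    unfolding M1_def M2_def using Suc.prems(1) by (intro cmi_superadditive N) auto
  have M2: "psd_on (?A \<times> ?B \<times> ?An \<times> ?Bn \<times> E) M2"
    using Suc.prems(1) by (intro psd_comap[OF _ N, where h = "\<lambda>(a2, b2, a1, b1, e). ((a2, a1), (b2, b1), e)"])
      (auto simp: M2_def)
  have M2': "psd_on (?B \<times> ?An \<times> ?Bn \<times> E) (trace_fst ?A M2)"
    using Suc.prems(1) by (intro psd_trace_fst[OF _ _ M2]) auto
  have M1: "psd_on (?An \<times> ?Bn \<times> E) M1"
    unfolding M1_def using Suc.prems(1) by (intro psd_trace_fst[OF _ _ M2']) auto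
  have ext: "(\<Sum>k\<in>E. M2 (i, j, x, y, k) (i', j', x', y', k)) = power_kernel a b n \<rho> x y x' y' * \<rho> $$ (i * b + j, i' * b + j')"
    if "i < a" "j < b" "i' < a" "j' < b" "x < a ^ n" "y < b ^ n" "x' < a ^ n" "y' < b ^ n" for i j x y i' j' x' y'
    unfolding M2_def N_def prod.case power_kernel_Suc[OF that, symmetric] using that
    by (intro Suc.prems(3)) (auto simp: power_Suc intro!: index_less)
  have \<rho>c: "\<rho> \<in> carrier_mat (a * b) (a * b)" "mat_trace \<rho> = 1" using \<rho> by (auto simp: state_def positive_op_def)
  have t: "(\<Sum>j<b. \<Sum>i<a. \<rho> $$ (i * b + j, i * b + j)) = 1"
    using \<rho>c unfolding mat_trace_def by (subst sum.swap) (simp add: sum_div_mod)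
  have "real n * c \<le> cmi ?An ?Bn E M1"
  proof (rule Suc.IH[OF Suc.prems(1) M1])
    fix x y x' y' assume xy: "x < a ^ n" "y < b ^ n" "x' < a ^ n" "y' < b ^ n"
    have "(\<Sum>k\<in>E. M1 (x, y, k) (x', y', k)) = (\<Sum>j<b. \<Sum>k\<in>E. \<Sum>i<a. M2 (i, j, x, y, k) (i, j, x', y', k))"
      unfolding M1_def trace_fst_def by (rule sum.swap)
    also have "\<dots> = (\<Sum>j<b. \<Sum>i<a. \<Sum>k\<in>E. M2 (i, j, x, y, k) (i, j, x', y', k))"
      by (intro sum.cong[OF refl] sum.swap)
    also have "\<dots> = (\<Sum>j<b. \<Sum>i<a. power_kernel a b n \<rho> x y x' y' * \<rho> $$ (i * b + j, i * b + j))"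
      using xy by (intro sum.cong refl ext) auto
    also have "\<dots> = power_kernel a b n \<rho> x y x' y'"
      unfolding sum_distrib_left[symmetric] t by simp
    finally show "(\<Sum>k\<in>E. M1 (x, y, k) (x', y', k)) = power_kernel a b n \<rho> x y x' y'" .
  qed
  moreover have "c \<le> cmi ?A ?B (?An \<times> ?Bn \<times> E) M2"
  proof -
    have "squashed_entanglement a b \<rho> \<le> ereal (cmi ?A ?B (?An \<times> ?Bn \<times> E) M2 / 2)"
    proof (rule squashed_entanglement_le[OF _ M2 \<rho>])
      fix i j i' j' assume ij: "i < a" "j < b" "i' < a" "j' < b"
      have "(\<Sum>k\<in>?An \<times> ?Bn \<times> E. M2 (i, j, k) (i', j', k)) = (\<Sum>x<a ^ n. \<Sum>y<b ^ n. \<Sum>k\<in>E. M2 (i, j, x, y, k) (i', j', x, y, k))"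
        by (rule sum_prod_triple)
      also have "\<dots> = (\<Sum>x<a ^ n. \<Sum>y<b ^ n. power_kernel a b n \<rho> x y x y * \<rho> $$ (i * b + j, i' * b + j'))"
        using ij by (intro sum.cong refl ext) auto
      also have "\<dots> = \<rho> $$ (i * b + j, i' * b + j')"
        unfolding sum_distrib_right[symmetric] power_kernel_trace[OF \<rho>c(2,1)] by simp
      finally show "(\<Sum>k\<in>?An \<times> ?Bn \<times> E. M2 (i, j, k) (i', j', k)) = \<rho> $$ (i * b + j, i' * b + j')" .
    qed (use Suc.prems(1) in auto)
    then have "ereal (c / 2) \<le> ereal (cmi ?A ?B (?An \<times> ?Bn \<times> E) M2 / 2)" using c by (rule order_trans[rotated])
    then show ?thesis by simp
  qed
  ultimately show ?case using le unfolding cN by (simp add: algebra_simps)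
qed


section \<open>LOCC operations preserve the Schmidt rank\<close>

text \<open>The coefficient matrix factors through dimension s. A local operator changes one of the
  two factors and leaves the other alone.\<close>

definition schmidt_rank_le :: "nat \<Rightarrow> nat \<Rightarrow> nat \<Rightarrow> (nat \<Rightarrow> nat \<Rightarrow> complex) \<Rightarrow> bool" where
  "schmidt_rank_le s a b \<psi> \<longleftrightarrow> (\<exists>L R. \<forall>i<a. \<forall>j<b. \<psi> i j = (\<Sum>l<s. L i l * R l j))"

definition pure_mat :: "nat \<Rightarrow> nat \<Rightarrow> (nat \<Rightarrow> nat \<Rightarrow> complex) \<Rightarrow> complex mat" where
  "pure_mat a b \<psi> = mat (a * b) (a * b) (\<lambda>(x, y). \<psi> (x div b) (x mod b) * cnj (\<psi> (y div b) (y mod b)))"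

text \<open>Unnormalised ensembles of any finite length. Being inductive, the predicate lets
  additive maps be followed one vector at a time.\<close>

inductive low_rank_mixture :: "nat \<Rightarrow> nat \<Rightarrow> nat \<Rightarrow> complex mat \<Rightarrow> bool" for s a b where
  zero: "low_rank_mixture s a b (0\<^sub>m (a * b) (a * b))"
| add_pure: "low_rank_mixture s a b M \<Longrightarrow> schmidt_rank_le s a b \<psi> \<Longrightarrow> low_rank_mixture s a b (M + pure_mat a b \<psi>)"

lemma pure_mat_carrier [simp]: "pure_mat a b \<psi> \<in> carrier_mat (a * b) (a * b)"
  by (simp add: pure_mat_def)

lemma pure_mat_index:
  assumes "i < a" "j < b" "i' < a" "j' < b"
  shows "pure_mat a b \<psi> $$ (i * b + j, i' * b + j') = \<psi> i j * cnj (\<psi> i' j')"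
  using assms index_less[OF assms(1,2)] index_less[OF assms(3,4)] by (simp add: pure_mat_def)

lemma low_rank_mixture_carrier: "low_rank_mixture s a b M \<Longrightarrow> M \<in> carrier_mat (a * b) (a * b)"
  by (induction rule: low_rank_mixture.induct) auto

lemma low_rank_mixture_add:
  assumes "low_rank_mixture s a b N" "low_rank_mixture s a b M"
  shows "low_rank_mixture s a b (M + N)"
  using assms(1)
proof (induction rule: low_rank_mixture.induct)
  case zero
  then show ?case using assms(2) right_add_zero_mat[OF low_rank_mixture_carrier[OF assms(2)]] by simp
next
  case (add_pure N \<psi>)
  have "M + (N + pure_mat a b \<psi>) = (M + N) + pure_mat a b \<psi>"
    using low_rank_mixture_carrier[OF assms(2)] low_rank_mixture_carrier[OF add_pure.hyps(1)]
    by (metis assoc_add_mat pure_mat_carrier)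
  then show ?case using add_pure by (simp add: low_rank_mixture.add_pure)
qed

lemma eq_matI_pair:
  assumes "M \<in> carrier_mat (a * b) (a * b)" "N \<in> carrier_mat (a * b) (a * b)"
    and "\<And>i j i' j'. i < a \<Longrightarrow> j < b \<Longrightarrow> i' < a \<Longrightarrow> j' < b \<Longrightarrow>
      M $$ (i * b + j, i' * b + j') = N $$ (i * b + j, i' * b + j')"
  shows "M = N"
proof (rule eq_matI)
  fix x y assume "x < dim_row N" "y < dim_col N"
  then have xy: "x < a * b" "y < a * b" using assms(2) by auto
  then have "b > 0" by (cases b) auto
  then show "M $$ (x, y) = N $$ (x, y)"
    using assms(3)[of "x div b" "x mod b" "y div b" "y mod b"] xy by (simp add: less_mult_imp_div_less)
qed (use assms in auto)

lemma low_rank_mixture_gram: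
  assumes "finite T" "M \<in> carrier_mat (a * b) (a * b)" "\<And>t. t \<in> T \<Longrightarrow> schmidt_rank_le s a b (\<psi> t)"
    and "\<And>i j i' j'. i < a \<Longrightarrow> j < b \<Longrightarrow> i' < a \<Longrightarrow> j' < b \<Longrightarrow>
      M $$ (i * b + j, i' * b + j') = (\<Sum>t\<in>T. \<psi> t i j * cnj (\<psi> t i' j'))"
  shows "low_rank_mixture s a b M"
  using assms
proof (induction T arbitrary: M rule: finite_induct)
  case empty
  have "M = 0\<^sub>m (a * b) (a * b)"
    by (rule eq_matI_pair[OF empty(1)]) (use empty(3) in \<open>auto simp: index_less\<close>)
  then show ?case by (simp add: low_rank_mixture.zero)
next
  case (insert t T)
  define N where "N = mat (a * b) (a * b) (\<lambda>(x, y). \<Sum>t\<in>T. \<psi> t (x div b) (x mod b) * cnj (\<psi> t (y div b) (y mod b)))"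
  have N: "N \<in> carrier_mat (a * b) (a * b)" by (simp add: N_def)
  have Ni: "N $$ (i * b + j, i' * b + j') = (\<Sum>t\<in>T. \<psi> t i j * cnj (\<psi> t i' j'))"
    if "i < a" "j < b" "i' < a" "j' < b" for i j i' j'
    using that index_less[OF that(1,2)] index_less[OF that(3,4)] by (simp add: N_def)
  have "M = N + pure_mat a b (\<psi> t)"
  proof (rule eq_matI_pair[OF insert.prems(1)])
    fix i j i' j' assume ij: "i < a" "j < b" "i' < a" "j' < b"
    have "(N + pure_mat a b (\<psi> t)) $$ (i * b + j, i' * b + j')
      = N $$ (i * b + j, i' * b + j') + pure_mat a b (\<psi> t) $$ (i * b + j, i' * b + j')"
      using N index_less[OF ij(1,2)] index_less[OF ij(3,4)] by (intro index_add_mat) (auto simp: pure_mat_def)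
    then show "M $$ (i * b + j, i' * b + j') = (N + pure_mat a b (\<psi> t)) $$ (i * b + j, i' * b + j')"
      unfolding Ni[OF ij] pure_mat_index[OF ij] insert.prems(3)[OF ij] using insert.hyps by simp
  qed (use N in auto)
  moreover have "low_rank_mixture s a b N" by (rule insert.IH[OF N]) (use insert.prems(2) Ni in auto)
  ultimately show ?case using insert.prems(2) by (auto intro: low_rank_mixture.add_pure)
qed

lemma linear_op_map_sum:
  assumes E: "linear_op_map d d' E" and T: "finite T" and ij: "i < d'" "j < d'"
  shows "E (mat d d (\<lambda>(p, q). \<Sum>t\<in>T. C t * F t p q)) $$ (i, j)
    = (\<Sum>t\<in>T. C t * E (mat d d (\<lambda>(p, q). F t p q)) $$ (i, j))"
  using T
proof (induction T rule: finite_induct)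
  case empty
  \<comment> \<open>The zero matrix is written as a multiple by the scalar 0, so that homogeneity
    sends it to zero.\<close>
  have m: "mat d d (\<lambda>(p, q). \<Sum>t\<in>{}. C t * F t p q) = 0 \<cdot>\<^sub>m (0\<^sub>m d d :: complex mat)" by (intro eq_matI) auto
  have c: "E (0\<^sub>m d d) \<in> carrier_mat d' d'" "E (0 \<cdot>\<^sub>m 0\<^sub>m d d) = 0 \<cdot>\<^sub>m E (0\<^sub>m d d)"
    using E zero_carrier_mat[of d d] unfolding linear_op_map_def by blast+
  show ?case unfolding m c(2) using c(1) ij by simp
next
  case (insert t T)
  let ?F = "mat d d (\<lambda>(p, q). F t p q)" and ?S = "mat d d (\<lambda>(p, q). \<Sum>t\<in>T. C t * F t p q)"
  have m: "mat d d (\<lambda>(p, q). \<Sum>t\<in>insert t T. C t * F t p q) = C t \<cdot>\<^sub>m ?F + ?S"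
    using insert.hyps by (intro eq_matI) auto
  have c: "E ?F \<in> carrier_mat d' d'" "E ?S \<in> carrier_mat d' d'" "E (C t \<cdot>\<^sub>m ?F + ?S) = E (C t \<cdot>\<^sub>m ?F) + E ?S"
    "E (C t \<cdot>\<^sub>m ?F) = C t \<cdot>\<^sub>m E ?F"
    using E by (auto simp: linear_op_map_def)
  have "E (mat d d (\<lambda>(p, q). \<Sum>t\<in>insert t T. C t * F t p q)) $$ (i, j) = C t * E ?F $$ (i, j) + E ?S $$ (i, j)"
    unfolding m c(3,4) using c(1,2) ij by simp
  then show ?case unfolding insert.IH using insert.hyps by simp
qed

text \<open>The image of a rank one operator under id (x) F is positive, hence a sum of rank one
  operators.\<close>

lemma completely_positive_kraus:
  assumes F: "completely_positive d d' F"
  obtains w where "\<And>\<alpha> \<beta> i i'. i < d' \<Longrightarrow> i' < d' \<Longrightarrow>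
    F (mat d d (\<lambda>(p, q). (\<Sum>l<s. \<alpha> l * g l p) * cnj (\<Sum>l<s. \<beta> l * g l q))) $$ (i, i')
      = (\<Sum>t<s * d'. (\<Sum>l<s. \<alpha> l * w t l i) * cnj (\<Sum>l<s. \<beta> l * w t l i'))"
proof -
  have lin: "linear_op_map d d' F" using F by (simp add: completely_positive_def)
  \<comment> \<open>With an ancilla of dimension s, \<open>G\<close> is the rank one operator of the
    vector with blocks \<open>g l\<close>. One application of id \<otimes> F therefore yields the
    images of all pairs of blocks at once.\<close>
  define G where "G = mat (s * d) (s * d) (\<lambda>(x, y). g (x div d) (x mod d) * cnj (g (y div d) (y mod d)))"
  have "psd_on {..<s * d} (\<lambda>x y. G $$ (x, y))"
    by (rule psd_gram[where K = "{0 :: nat}" and w = "\<lambda>_ x. g (x div d) (x mod d)"]) (simp add: G_def)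
  then have "positive_op (s * d) G" by (simp add: positive_op_iff_psd_on G_def)
  then have "positive_op (s * d') (local_map s 1 d d' F G)" using F by (auto simp: completely_positive_def)
  then have psd: "psd_on {..<s * d'} (\<lambda>x y. local_map s 1 d d' F G $$ (x, y))" by (simp add: positive_op_iff_psd_on)
  obtain w where w: "\<And>x y. x \<in> {..<s * d'} \<Longrightarrow> y \<in> {..<s * d'} \<Longrightarrow>
    local_map s 1 d d' F G $$ (x, y) = (\<Sum>t<s * d'. w t x * cnj (w t y))"
    by (rule psd_gramE[OF finite_lessThan psd]) blast
  have wF: "F (mat d d (\<lambda>(p, q). g l p * cnj (g l' q))) $$ (i, i') = (\<Sum>t<s * d'. w t (l * d' + i) * cnj (w t (l' * d' + i')))"
    if l: "l < s" "i < d'" "l' < s" "i' < d'" for l i l' i'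
  proof -
    have x: "l * d' + i < s * d'" "l' * d' + i' < s * d'" using index_less l by auto
    have "mat d d (\<lambda>(p, q). G $$ (l * d + p, l' * d + q)) = mat d d (\<lambda>(p, q). g l p * cnj (g l' q))"
      using l by (intro eq_matI) (auto simp: G_def index_less)
    then have "local_map s 1 d d' F G $$ (l * d' + i, l' * d' + i') = F (mat d d (\<lambda>(p, q). g l p * cnj (g l' q))) $$ (i, i')"
      using x l by (simp add: local_map_def)
    then show ?thesis using w x by simp
  qed
  \<comment> \<open>The same \<open>w\<close> serves all coefficients \<open>\<alpha>\<close> and
    \<open>\<beta>\<close>. These will be entries of the factor belonging to the other party, on
    which \<open>F\<close> does not act.\<close>
  show thesis
  proof (rule that[of "\<lambda>t l i. w t (l * d' + i)"])
    fix \<alpha> \<beta> i i' assume i: "i < d'" "i' < d'"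
    let ?w = "\<lambda>t l. w t (l * d' + i)" and ?w' = "\<lambda>t l. w t (l * d' + i')"
    have m: "mat d d (\<lambda>(p, q). (\<Sum>l<s. \<alpha> l * g l p) * cnj (\<Sum>l<s. \<beta> l * g l q))
      = mat d d (\<lambda>(p, q). \<Sum>t\<in>{..<s} \<times> {..<s}. (\<alpha> (fst t) * cnj (\<beta> (snd t))) * (g (fst t) p * cnj (g (snd t) q)))"
      by (intro eq_matI) (auto simp: sum_product sum.cartesian_product' mult_ac)
    have "F (mat d d (\<lambda>(p, q). (\<Sum>l<s. \<alpha> l * g l p) * cnj (\<Sum>l<s. \<beta> l * g l q))) $$ (i, i')
      = (\<Sum>t\<in>{..<s} \<times> {..<s}. (\<alpha> (fst t) * cnj (\<beta> (snd t))) * F (mat d d (\<lambda>(p, q). g (fst t) p * cnj (g (snd t) q))) $$ (i, i'))"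
      unfolding m using i by (intro linear_op_map_sum[OF lin]) auto
    also have "\<dots> = (\<Sum>l<s. \<Sum>l'<s. (\<alpha> l * cnj (\<beta> l')) * (\<Sum>t<s * d'. ?w t l * cnj (?w' t l')))"
      unfolding sum.cartesian_product' fst_conv snd_conv using i wF by (intro sum.cong refl) simp
    also have "\<dots> = (\<Sum>l<s. \<Sum>l'<s. \<Sum>t<s * d'. (\<alpha> l * ?w t l) * cnj (\<beta> l' * ?w' t l'))"
      unfolding sum_distrib_left complex_cnj_mult by (simp only: mult_ac)
    also have "\<dots> = (\<Sum>t<s * d'. \<Sum>l<s. \<Sum>l'<s. (\<alpha> l * ?w t l) * cnj (\<beta> l' * ?w' t l'))"
      by (subst (2) sum.swap, subst sum.swap) (rule refl)
    also have "\<dots> = (\<Sum>t<s * d'. (\<Sum>l<s. \<alpha> l * ?w t l) * cnj (\<Sum>l<s. \<beta> l * ?w' t l))"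
      unfolding cnj_sum sum_product ..
    finally show "F (mat d d (\<lambda>(p, q). (\<Sum>l<s. \<alpha> l * g l p) * cnj (\<Sum>l<s. \<beta> l * g l q))) $$ (i, i')
      = (\<Sum>t<s * d'. (\<Sum>l<s. \<alpha> l * ?w t l) * cnj (\<Sum>l<s. \<beta> l * ?w' t l))" .
  qed
qed

section \<open>Local maps of either party\<close>

lemma local_map_A_index:
  assumes "i < c" "j < b" "i' < c" "j' < b"
  shows "local_map 1 b a c F M $$ (i * b + j, i' * b + j')
    = F (mat a a (\<lambda>(p, q). M $$ (p * b + j, q * b + j'))) $$ (i, i')"
proof -
  have "i * b + j < c * b" "i' * b + j' < c * b" using index_less assms by auto
  then show ?thesis using assms by (simp add: local_map_def)
qed

lemma local_map_B_index:
  assumes "i < a" "j < c" "i' < a" "j' < c"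
  shows "local_map a 1 b c F M $$ (i * c + j, i' * c + j')
    = F (mat b b (\<lambda>(p, q). M $$ (i * b + p, i' * b + q))) $$ (j, j')"
proof -
  have "i * c + j < a * c" "i' * c + j' < a * c" using index_less assms by auto
  then show ?thesis using assms by (simp add: local_map_def)
qed

lemma local_map_carrier: "local_map l r d d' F M \<in> carrier_mat (l * d' * r) (l * d' * r)"
  by (simp add: local_map_def)

lemma local_map_block_less:
  fixes x l r d' :: nat
  assumes "x < l * d' * r"
  shows "x div r mod d' < d'" "p < d \<Longrightarrow> (x div (d' * r) * d + p) * r + x mod r < l * d * r"
proof -
  have r: "r > 0" "d' > 0" using assms by (auto intro: gr0I)
  then show "x div r mod d' < d'" by simp
  assume "p < d"
  moreover have "x div (d' * r) < l" using assms by (simp add: less_mult_imp_div_less mult.assoc)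
  ultimately show "(x div (d' * r) * d + p) * r + x mod r < l * d * r" using r by (intro index_less) auto
qed

lemma local_map_zero:
  assumes F: "linear_op_map d d' F"
  shows "local_map l r d d' F (0\<^sub>m (l * d * r) (l * d * r)) = 0\<^sub>m (l * d' * r) (l * d' * r)"
proof (rule eq_matI)
  fix x y assume "x < dim_row (0\<^sub>m (l * d' * r) (l * d' * r))" "y < dim_col (0\<^sub>m (l * d' * r) (l * d' * r))"
  then have xy: "x < l * d' * r" "y < l * d' * r" by auto
  note b = local_map_block_less[OF xy(1)] local_map_block_less[OF xy(2)]
  have "mat d d (\<lambda>(p, q). 0\<^sub>m (l * d * r) (l * d * r) $$ ((x div (d' * r) * d + p) * r + x mod r,
      (y div (d' * r) * d + q) * r + y mod r)) = mat d d (\<lambda>(p, q). \<Sum>t\<in>{}. 0 * (0 :: complex))"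
    using b by (intro eq_matI) auto
  then show "local_map l r d d' F (0\<^sub>m (l * d * r) (l * d * r)) $$ (x, y) = 0\<^sub>m (l * d' * r) (l * d' * r) $$ (x, y)"
    using xy b linear_op_map_sum[OF F finite.emptyI, of "x div r mod d'" "y div r mod d'" "\<lambda>_. 0" "\<lambda>_ _ _. 0"]
    by (simp add: local_map_def)
qed (simp_all add: local_map_def)

lemma local_map_add:
  assumes F: "linear_op_map d d' F"
    and M: "M \<in> carrier_mat (l * d * r) (l * d * r)" and N: "N \<in> carrier_mat (l * d * r) (l * d * r)"
  shows "local_map l r d d' F (M + N) = local_map l r d d' F M + local_map l r d d' F N"
proof (rule eq_matI)
  fix x y assume "x < dim_row (local_map l r d d' F M + local_map l r d d' F N)"
    "y < dim_col (local_map l r d d' F M + local_map l r d d' F N)"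
  then have xy: "x < l * d' * r" "y < l * d' * r" by (auto simp: local_map_def)
  note b = local_map_block_less[OF xy(1)] local_map_block_less[OF xy(2)]
  define blk where "blk M = mat d d (\<lambda>(p, q). M $$ ((x div (d' * r) * d + p) * r + x mod r,
      (y div (d' * r) * d + q) * r + y mod r))" for M :: "complex mat"
  have "blk (M + N) = blk M + blk N"
    unfolding blk_def using b M N by (intro eq_matI) auto
  moreover have "F (blk M + blk N) = F (blk M) + F (blk N)" "F (blk M) \<in> carrier_mat d' d'" "F (blk N) \<in> carrier_mat d' d'"
    using F by (auto simp: linear_op_map_def blk_def)
  ultimately show "local_map l r d d' F (M + N) $$ (x, y) = (local_map l r d d' F M + local_map l r d d' F N) $$ (x, y)"
    using xy b by (simp add: local_map_def flip: blk_def)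
qed (simp_all add: local_map_def)

text \<open>The dimensions are given by equations so that one induction covers both parties, whose
  spaces are \<open>1 * a * b\<close> and \<open>a * b * 1\<close> in the notation of
  \<open>local_map\<close>.\<close>

lemma local_map_low_rank:
  assumes F: "linear_op_map d d' F" and dim: "l * d * r = a * b" "l * d' * r = a' * b'"
    and pure: "\<And>\<psi>. schmidt_rank_le s a b \<psi> \<Longrightarrow> low_rank_mixture s a' b' (local_map l r d d' F (pure_mat a b \<psi>))"
    and M: "low_rank_mixture s a b M"
  shows "low_rank_mixture s a' b' (local_map l r d d' F M)"
  using M
proof (induction rule: low_rank_mixture.induct)
  case zero
  show ?case using local_map_zero[OF F, of l r] by (simp add: dim low_rank_mixture.zero)
next
  case (add_pure M \<psi>)
  have "local_map l r d d' F (M + pure_mat a b \<psi>) = local_map l r d d' F M + local_map l r d d' F (pure_mat a b \<psi>)"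
    using low_rank_mixture_carrier[OF add_pure.hyps(1)] by (intro local_map_add[OF F]) (simp_all add: dim)
  then show ?case using low_rank_mixture_add[OF pure[OF add_pure.hyps(2)] add_pure.IH] by simp
qed

text \<open>If the coefficients are the product L R, then \<open>F\<close> sees only the columns of
  L. Each vector of its decomposition has a new left factor and the old R, hence still factors
  through dimension s.\<close>

lemma local_map_A_low_rank:
  assumes F: "completely_positive a c F" and M: "low_rank_mixture s a b M"
  shows "low_rank_mixture s c b (local_map 1 b a c F M)"
proof (rule local_map_low_rank[OF _ _ _ _ M])
  fix \<psi> assume "schmidt_rank_le s a b \<psi>"
  then obtain L R where LR: "\<And>i j. i < a \<Longrightarrow> j < b \<Longrightarrow> \<psi> i j = (\<Sum>l<s. L i l * R l j)"
    unfolding schmidt_rank_le_def by blast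
  obtain w where w: "\<And>\<alpha> \<beta> i i'. i < c \<Longrightarrow> i' < c \<Longrightarrow>
    F (mat a a (\<lambda>(p, q). (\<Sum>l<s. \<alpha> l * L p l) * cnj (\<Sum>l<s. \<beta> l * L q l))) $$ (i, i')
      = (\<Sum>t<s * c. (\<Sum>l<s. \<alpha> l * w t l i) * cnj (\<Sum>l<s. \<beta> l * w t l i'))"
    by (rule completely_positive_kraus[OF F, where s = s and g = "\<lambda>l p. L p l"]) blast
  show "low_rank_mixture s c b (local_map 1 b a c F (pure_mat a b \<psi>))"
  proof (rule low_rank_mixture_gram)
    show "schmidt_rank_le s c b (\<lambda>i j. \<Sum>l<s. R l j * w t l i)" for t
      unfolding schmidt_rank_le_def by (intro exI[of _ "\<lambda>i l. w t l i"] exI[of _ R]) (simp add: mult.commute)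
    fix i j i' j' assume ij: "i < c" "j < b" "i' < c" "j' < b"
    have "mat a a (\<lambda>(p, q). pure_mat a b \<psi> $$ (p * b + j, q * b + j'))
      = mat a a (\<lambda>(p, q). (\<Sum>l<s. R l j * L p l) * cnj (\<Sum>l<s. R l j' * L q l))"
      using ij by (intro eq_matI) (auto simp: pure_mat_index LR mult.commute[of "L _ _"])
    then show "local_map 1 b a c F (pure_mat a b \<psi>) $$ (i * b + j, i' * b + j')
      = (\<Sum>t<s * c. (\<Sum>l<s. R l j * w t l i) * cnj (\<Sum>l<s. R l j' * w t l i'))"
      unfolding local_map_A_index[OF ij] using w[OF ij(1,3)] by simp
  qed (use local_map_carrier[of 1 b a c F] in auto)
qed (use F in \<open>auto simp: completely_positive_def\<close>)

lemma local_map_B_low_rank: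
  assumes F: "completely_positive b c F" and M: "low_rank_mixture s a b M"
  shows "low_rank_mixture s a c (local_map a 1 b c F M)"
proof (rule local_map_low_rank[OF _ _ _ _ M])
  fix \<psi> assume "schmidt_rank_le s a b \<psi>"
  then obtain L R where LR: "\<And>i j. i < a \<Longrightarrow> j < b \<Longrightarrow> \<psi> i j = (\<Sum>l<s. L i l * R l j)"
    unfolding schmidt_rank_le_def by blast
  obtain w where w: "\<And>\<alpha> \<beta> i i'. i < c \<Longrightarrow> i' < c \<Longrightarrow>
    F (mat b b (\<lambda>(p, q). (\<Sum>l<s. \<alpha> l * R l p) * cnj (\<Sum>l<s. \<beta> l * R l q))) $$ (i, i')
      = (\<Sum>t<s * c. (\<Sum>l<s. \<alpha> l * w t l i) * cnj (\<Sum>l<s. \<beta> l * w t l i'))"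
    by (rule completely_positive_kraus[OF F, where s = s and g = R]) blast
  show "low_rank_mixture s a c (local_map a 1 b c F (pure_mat a b \<psi>))"
  proof (rule low_rank_mixture_gram)
    show "schmidt_rank_le s a c (\<lambda>i j. \<Sum>l<s. L i l * w t l j)" for t
      unfolding schmidt_rank_le_def by (intro exI[of _ L] exI[of _ "w t"]) simp
    fix i j i' j' assume ij: "i < a" "j < c" "i' < a" "j' < c"
    have "mat b b (\<lambda>(p, q). pure_mat a b \<psi> $$ (i * b + p, i' * b + q))
      = mat b b (\<lambda>(p, q). (\<Sum>l<s. L i l * R l p) * cnj (\<Sum>l<s. L i' l * R l q))"
      using ij by (intro eq_matI) (auto simp: pure_mat_index LR)
    then show "local_map a 1 b c F (pure_mat a b \<psi>) $$ (i * c + j, i' * c + j')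
      = (\<Sum>t<s * c. (\<Sum>l<s. L i l * w t l j) * cnj (\<Sum>l<s. L i' l * w t l j'))"
      unfolding local_map_B_index[OF ij] using w[OF ij(2,4)] by simp
  qed (use local_map_carrier[of a 1 b c F] in auto)
qed (use F in \<open>auto simp: completely_positive_def\<close>)

lemma mat_sum_low_rank:
  assumes "\<And>x. x < m \<Longrightarrow> low_rank_mixture s a b (F x)"
  shows "low_rank_mixture s a b (mat_sum (a * b) m F)"
  using assms
proof (induction m)
  case 0
  have "mat_sum (a * b) 0 F = 0\<^sub>m (a * b) (a * b)" by (intro eq_matI) (auto simp: mat_sum_def)
  then show ?case by (simp add: low_rank_mixture.zero)
next
  case (Suc m)
  have "mat_sum (a * b) (Suc m) F = mat_sum (a * b) m F + F m"
    using low_rank_mixture_carrier[OF Suc.prems[of m]] by (intro eq_matI) (auto simp: mat_sum_def)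
  then show ?case using low_rank_mixture_add[OF Suc.prems[of m] Suc.IH] Suc.prems by simp
qed

text \<open>Every branch of the protocol is a local completely positive map followed by a
  subprotocol, and summing over outcomes joins ensembles. The bound s is that of the input, whatever
  the local dimensions become.\<close>

theorem locc_low_rank:
  assumes "locc a b a' b' T" "low_rank_mixture s a b M"
  shows "low_rank_mixture s a' b' (T M)"
  using assms
proof (induction arbitrary: M rule: locc.induct)
  case (locc_id a b)
  then show ?case .
next
  case (locc_A a c m E b a' b' T)
  show ?case
  proof (rule mat_sum_low_rank)
    fix x assume x: "x < m"
    then have "completely_positive a c (E x)" using locc_A.hyps by (simp add: instrument_def)
    from locc_A.IH[OF x local_map_A_low_rank[OF this locc_A.prems]]
    show "low_rank_mixture s a' b' (T x (local_map 1 b a c (E x) M))" .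
  qed
next
  case (locc_B b c m E a a' b' T)
  show ?case
  proof (rule mat_sum_low_rank)
    fix x assume x: "x < m"
    then have "completely_positive b c (E x)" using locc_B.hyps by (simp add: instrument_def)
    from locc_B.IH[OF x local_map_B_low_rank[OF this locc_B.prems]]
    show "low_rank_mixture s a' b' (T x (local_map a 1 b c (E x) M))" .
  qed
qed

lemma max_entangled_low_rank: "low_rank_mixture s s s (projector (max_entangled_vec s))"
proof (rule low_rank_mixture_gram[where T = "{0 :: nat}" and \<psi> = "\<lambda>_ i j. if i = j then of_real (1 / sqrt (real s)) else 0"])
  show "projector (max_entangled_vec s) \<in> carrier_mat (s * s) (s * s)"
    by (simp add: projector_def max_entangled_vec_def)
  show "schmidt_rank_le s s s (\<lambda>i j. if i = j then of_real (1 / sqrt (real s)) else 0)"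
    unfolding schmidt_rank_le_def
  proof (intro exI allI impI)
    fix i j assume "i < s" "j < s"
    then show "(if i = j then of_real (1 / sqrt (real s)) else 0)
      = (\<Sum>l<s. (if i = l then 1 else 0) * (if l = j then complex_of_real (1 / sqrt (real s)) else 0))"
      by (simp add: if_distrib[of "\<lambda>x. x * _"] cong: if_cong)
  qed
  fix i j i' j' assume "i < s" "j < s" "i' < s" "j' < s"
  then show "projector (max_entangled_vec s) $$ (i * s + j, i' * s + j')
    = (\<Sum>t\<in>{0 :: nat}. (if i = j then of_real (1 / sqrt (real s)) else 0) * cnj (if i' = j' then of_real (1 / sqrt (real s)) else 0))"
    by (simp add: projector_def max_entangled_vec_def index_less)
qed simp

lemma low_rank_mixtureE:
  assumes "low_rank_mixture s a b M"
  obtains m :: nat and \<psi> where "\<And>k. k < m \<Longrightarrow> schmidt_rank_le s a b (\<psi> k)"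
    "\<And>i j i' j'. i < a \<Longrightarrow> j < b \<Longrightarrow> i' < a \<Longrightarrow> j' < b \<Longrightarrow>
      M $$ (i * b + j, i' * b + j') = (\<Sum>k<m. \<psi> k i j * cnj (\<psi> k i' j'))"
proof -
  have "\<exists>(m :: nat) \<psi>. (\<forall>k<m. schmidt_rank_le s a b (\<psi> k)) \<and> (\<forall>i<a. \<forall>j<b. \<forall>i'<a. \<forall>j'<b.
      M $$ (i * b + j, i' * b + j') = (\<Sum>k<m. \<psi> k i j * cnj (\<psi> k i' j')))"
    using assms
  proof (induction rule: low_rank_mixture.induct)
    case zero
    then show ?case by (intro exI[of _ 0]) (auto simp: index_less)
  next
    case (add_pure M \<psi>)
    note Mc = low_rank_mixture_carrier[OF add_pure.hyps(1)]
    obtain m :: nat and \<phi> where *: "\<forall>k<m. schmidt_rank_le s a b (\<phi> k)" "\<forall>i<a. \<forall>j<b. \<forall>i'<a. \<forall>j'<b.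
      M $$ (i * b + j, i' * b + j') = (\<Sum>k<m. \<phi> k i j * cnj (\<phi> k i' j'))"
      using add_pure.IH by blast
    have "(M + pure_mat a b \<psi>) $$ (i * b + j, i' * b + j') = (\<Sum>k<Suc m. (\<phi>(m := \<psi>)) k i j * cnj ((\<phi>(m := \<psi>)) k i' j'))"
      if ij: "i < a" "j < b" "i' < a" "j' < b" for i j i' j'
    proof -
      have "(M + pure_mat a b \<psi>) $$ (i * b + j, i' * b + j') = M $$ (i * b + j, i' * b + j') + \<psi> i j * cnj (\<psi> i' j')"
        unfolding pure_mat_index[OF ij, symmetric] using Mc index_less[OF ij(1,2)] index_less[OF ij(3,4)]
        by (intro index_add_mat) (auto simp: pure_mat_def)
      then show ?thesis using *(2) ij by simp
    qed
    moreover have "\<forall>k<Suc m. schmidt_rank_le s a b ((\<phi>(m := \<psi>)) k)"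
      using *(1) add_pure.hyps(2) by (auto simp: less_Suc_eq)
    ultimately show ?case by blast
  qed
  then show thesis using that by blast
qed


section \<open>Ensembles of dominated operators\<close>

lemma sesq_sum:
  "sesq I (\<lambda>i. \<Sum>j\<in>J. f j * x j i) M (\<lambda>i. \<Sum>l\<in>J. g l * x l i)
    = (\<Sum>j\<in>J. \<Sum>l\<in>J. cnj (f j) * sesq I (x j) M (x l) * g l)"
  unfolding sesq_sum_right unfolding sesq_eq_ip ip_sum_left sum_distrib_left
  by (subst sum.swap) (simp only: mult_ac)

text \<open>If R <= X then R = S C S* and X = S S* with C diagonal and 0 <= C <= 1; replacing
  psi = S U by S sqrt(C) U turns a decomposition of X into one of R. The squared distance is
  tr S (1 - sqrt C)^2 S* and (1 - sqrt c)^2 <= 1 - c.\<close>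

lemma dominated_decomposition:
  fixes \<psi> :: "'k \<Rightarrow> 'i \<Rightarrow> complex"
  assumes fin: "finite I"
    and X: "spectral_on I I x lam X" "complete_family I I x" "\<And>j. j \<in> I \<Longrightarrow> 0 < lam j"
    and R: "psd_on I R" and XR: "psd_on I (\<lambda>i j. X i j - R i j)"
    and \<psi>: "\<And>i j. i \<in> I \<Longrightarrow> j \<in> I \<Longrightarrow> X i j = (\<Sum>k\<in>K. \<psi> k i * cnj (\<psi> k j))"
  obtains \<phi> :: "'k \<Rightarrow> 'i \<Rightarrow> complex" where
    "\<And>i j. i \<in> I \<Longrightarrow> j \<in> I \<Longrightarrow> R i j = (\<Sum>k\<in>K. \<phi> k i * cnj (\<phi> k j))"
    "(\<Sum>k\<in>K. \<Sum>i\<in>I. (cmod (\<phi> k i - \<psi> k i))\<^sup>2) \<le> Re (\<Sum>i\<in>I. X i i) - Re (\<Sum>i\<in>I. R i i)"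
proof -
  define \<mu> where "\<mu> j = complex_of_real (sqrt (lam j))" for j
  have \<mu>0: "\<mu> j \<noteq> 0" and \<mu>2: "\<mu> j * \<mu> j = of_real (lam j)" and \<mu>c: "cnj (\<mu> j) = \<mu> j" if "j \<in> I" for j
    using X(3)[OF that] by (auto simp: \<mu>_def of_real_mult[symmetric] simp del: of_real_mult)
  have \<mu>c': "cnj (\<mu> j) = \<mu> j" for j by (simp add: \<mu>_def)
  \<comment> \<open>In the eigenbasis of X this is the matrix of \<open>X^(-1/2) R X^(-1/2)\<close>;
    by domination its spectrum lies between 0 and 1.\<close>
  define C where "C j l = sesq I (x j) R (x l) / (\<mu> j * \<mu> l)" for j l
  have "hermitian_on I C"
    unfolding C_def by (intro hermitian_onI) (simp add: cnj_sesq[OF psd_onD(1)[OF R]] \<mu>c' mult.commute)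
  from spectral_theorem[OF fin this] obtain y c where y: "spectral_on I I y c C" "complete_family I I y" .
  note yo = spectral_onD(2)[OF y(1)]
  \<comment> \<open>The eigenvectors of \<open>C\<close>, carried over to the original space, are
    mapped by \<open>X^(1/2)\<close> to \<open>s\<close> and by \<open>X^(-1/2)\<close> to
    \<open>t\<close>. The two families are dual, and \<open>t\<close> diagonalises both X and
    R.\<close>
  define s where "s m i = (\<Sum>j\<in>I. (\<mu> j * y m j) * x j i)" for m i
  define t where "t m i = (\<Sum>j\<in>I. (y m j / \<mu> j) * x j i)" for m i
  have d: "(\<Sum>m\<in>I. s m i * cnj (t m i')) = (if i = i' then 1 else 0)" if i: "i \<in> I" "i' \<in> I" for i i'
  proof -
    have "(\<Sum>m\<in>I. s m i * cnj (t m i')) = (\<Sum>m\<in>I. \<Sum>j\<in>I. \<Sum>l\<in>I. (y m j * cnj (y m l)) * (\<mu> j / \<mu> l * x j i * cnj (x l i')))"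
      unfolding s_def t_def by (simp add: sum_product \<mu>c' mult_ac)
    also have "\<dots> = (\<Sum>j\<in>I. \<Sum>l\<in>I. \<Sum>m\<in>I. (y m j * cnj (y m l)) * (\<mu> j / \<mu> l * x j i * cnj (x l i')))"
      by (subst sum.swap) (intro sum.cong[OF refl] sum.swap)
    also have "\<dots> = (\<Sum>j\<in>I. \<Sum>l\<in>I. if j = l then x j i * cnj (x l i') else 0)"
    proof (intro sum.cong refl)
      fix j l assume jl: "j \<in> I" "l \<in> I"
      have yy: "(\<Sum>m\<in>I. y m j * cnj (y m l)) = (if j = l then 1 else 0)"
        using y(2) jl by (simp add: complete_family_def)
      show "(\<Sum>m\<in>I. (y m j * cnj (y m l)) * (\<mu> j / \<mu> l * x j i * cnj (x l i'))) = (if j = l then x j i * cnj (x l i') else 0)"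
        unfolding sum_distrib_right[symmetric] yy using \<mu>0[OF jl(1)] by (cases "j = l") auto
    qed
    also have "\<dots> = (\<Sum>j\<in>I. x j i * cnj (x j i'))" using fin by (intro sum.cong refl) simp
    also have "\<dots> = (if i = i' then 1 else 0)" using X(2) i by (simp add: complete_family_def)
    finally show ?thesis .
  qed
  have xo: "ip I (x j) (x l) = (if j = l then 1 else 0)" if "j \<in> I" "l \<in> I" for j l
    using spectral_onD(2)[OF X(1)] that by (rule orthonormal_ip)
  have tX: "sesq I (t m) X (t m') = (if m = m' then 1 else 0)" if m: "m \<in> I" "m' \<in> I" for m m'
  proof -
    have "sesq I (t m) X (t m') = (\<Sum>j\<in>I. \<Sum>l\<in>I. cnj (y m j / \<mu> j) * sesq I (x j) X (x l) * (y m' l / \<mu> l))"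
      unfolding t_def by (rule sesq_sum)
    also have "\<dots> = (\<Sum>j\<in>I. \<Sum>l\<in>I. if j = l then cnj (y m j) * y m' j else 0)"
    proof (intro sum.cong refl)
      fix j l assume jl: "j \<in> I" "l \<in> I"
      have "sesq I (x j) X (x l) = (if j = l then \<mu> j * \<mu> j else 0)"
        unfolding spectral_eigen(1)[OF X(1) jl(1)] xo[OF jl] \<mu>2[OF jl(1)] by simp
      then show "cnj (y m j / \<mu> j) * sesq I (x j) X (x l) * (y m' l / \<mu> l) = (if j = l then cnj (y m j) * y m' j else 0)"
        using \<mu>0[OF jl(1)] by (cases "j = l") (auto simp: \<mu>c')
    qed
    also have "\<dots> = ip I (y m) (y m')" using fin unfolding ip_def by (intro sum.cong refl) simp
    finally show ?thesis using orthonormal_ip[OF yo m] by simp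
  qed
  have tR: "sesq I (t m) R (t m') = (if m = m' then of_real (c m) else 0)" if m: "m \<in> I" "m' \<in> I" for m m'
  proof -
    have "sesq I (t m) R (t m') = (\<Sum>j\<in>I. \<Sum>l\<in>I. cnj (y m j / \<mu> j) * sesq I (x j) R (x l) * (y m' l / \<mu> l))"
      unfolding t_def by (rule sesq_sum)
    also have "\<dots> = sesq I (y m) C (y m')"
      unfolding sesq_def[of I "y m"] C_def by (simp add: \<mu>c' mult_ac)
    also have "\<dots> = (if m = m' then of_real (c m) else 0)"
      unfolding spectral_eigen(1)[OF y(1) m(1)] orthonormal_ip[OF yo m] by simp
    finally show ?thesis .
  qed
  have c: "0 \<le> c m" "c m \<le> 1" if m: "m \<in> I" for m
  proof -
    show "0 \<le> c m" using psd_onD(2)[OF R, of "t m"] tR[OF m m] by simp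
    have "sesq I (t m) (\<lambda>i j. X i j - R i j) (t m) = sesq I (t m) X (t m) - sesq I (t m) R (t m)"
      unfolding sesq_def by (simp add: right_diff_distrib left_diff_distrib sum_subtractf)
    then show "c m \<le> 1" using psd_onD(2)[OF XR, of "t m"] tR[OF m m] tX[OF m m] by simp
  qed
  \<comment> \<open>The coordinates of the ensemble with respect to \<open>s\<close>. The rows of
    \<open>U\<close> are orthonormal because \<open>t\<close> is orthonormal for the form of X;
    \<open>K\<close> may be larger than \<open>I\<close>, which makes \<open>U\<close> a
    coisometry.\<close>
  define U where "U m k = ip I (t m) (\<psi> k)" for m k
  have UU: "(\<Sum>k\<in>K. U m k * cnj (U m' k)) = (if m = m' then 1 else 0)" if m: "m \<in> I" "m' \<in> I" for m m'
    unfolding U_def cnj_ip using sesq_gram[OF \<psi>, where f = "t m" and g = "t m'"] tX[OF m] by simp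
  \<comment> \<open>This is applied with the roots of \<open>c\<close> to recover R, and with the
    roots minus 1 to compute the squared distance.\<close>
  have comb: "(\<Sum>k\<in>K. (\<Sum>m\<in>I. of_real (f m) * U m k * s m i) * cnj (\<Sum>m\<in>I. of_real (f m) * U m k * s m i'))
    = (\<Sum>m\<in>I. of_real ((f m)\<^sup>2) * s m i * cnj (s m i'))" for f :: "'i \<Rightarrow> real" and i i'
  proof -
    have "(\<Sum>k\<in>K. (\<Sum>m\<in>I. of_real (f m) * U m k * s m i) * cnj (\<Sum>m\<in>I. of_real (f m) * U m k * s m i'))
      = (\<Sum>k\<in>K. \<Sum>m\<in>I. \<Sum>m'\<in>I. (U m k * cnj (U m' k)) * (of_real (f m) * of_real (f m') * s m i * cnj (s m' i')))"
      by (simp add: sum_product mult_ac)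
    also have "\<dots> = (\<Sum>m\<in>I. \<Sum>m'\<in>I. \<Sum>k\<in>K. (U m k * cnj (U m' k)) * (of_real (f m) * of_real (f m') * s m i * cnj (s m' i')))"
      by (subst sum.swap) (intro sum.cong[OF refl] sum.swap)
    also have "\<dots> = (\<Sum>m\<in>I. \<Sum>m'\<in>I. if m = m' then of_real (f m) * of_real (f m') * s m i * cnj (s m' i') else 0)"
      by (intro sum.cong refl) (simp add: sum_distrib_right[symmetric] UU)
    also have "\<dots> = (\<Sum>m\<in>I. of_real ((f m)\<^sup>2) * s m i * cnj (s m i'))"
      using fin by (intro sum.cong refl) (simp add: power2_eq_square)
    finally show ?thesis .
  qed
  define \<phi> where "\<phi> k i = (\<Sum>m\<in>I. of_real (sqrt (c m)) * U m k * s m i)" for k i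
  have Rs: "R i j = (\<Sum>m\<in>I. of_real (c m) * s m i * cnj (s m j))" if ij: "i \<in> I" "j \<in> I" for i j
  proof -
    have "R i j = (\<Sum>m\<in>I. \<Sum>m'\<in>I. sesq I (t m) R (t m') * s m i * cnj (s m' j))"
      by (rule biorthogonal_kernel_expand[OF fin d ij])
    also have "\<dots> = (\<Sum>m\<in>I. \<Sum>m'\<in>I. if m = m' then of_real (c m) * s m i * cnj (s m' j) else 0)"
      by (intro sum.cong refl) (simp add: tR)
    finally show ?thesis using fin by simp
  qed
  have Xs: "X i j = (\<Sum>m\<in>I. s m i * cnj (s m j))" if ij: "i \<in> I" "j \<in> I" for i j
  proof -
    have "X i j = (\<Sum>m\<in>I. \<Sum>m'\<in>I. sesq I (t m) X (t m') * s m i * cnj (s m' j))"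
      by (rule biorthogonal_kernel_expand[OF fin d ij])
    also have "\<dots> = (\<Sum>m\<in>I. \<Sum>m'\<in>I. if m = m' then s m i * cnj (s m' j) else 0)"
      by (intro sum.cong refl) (simp add: tX)
    finally show ?thesis using fin by simp
  qed
  show thesis
  proof (rule that[of \<phi>])
    fix i j assume ij: "i \<in> I" "j \<in> I"
    show "R i j = (\<Sum>k\<in>K. \<phi> k i * cnj (\<phi> k j))"
      unfolding \<phi>_def comb Rs[OF ij] using c by (intro sum.cong refl) simp
  next
    define f where "f m = sqrt (c m) - 1" for m
    define S where "S m = (\<Sum>i\<in>I. (cmod (s m i))\<^sup>2)" for m
    have diff: "\<phi> k i - \<psi> k i = (\<Sum>m\<in>I. of_real (f m) * U m k * s m i)" if "i \<in> I" for k i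
      using biorthogonal_expand[OF fin d that, of "\<psi> k"] unfolding \<phi>_def f_def U_def
      by (simp add: algebra_simps sum_subtractf)
    have "complex_of_real (\<Sum>k\<in>K. \<Sum>i\<in>I. (cmod (\<phi> k i - \<psi> k i))\<^sup>2) = (\<Sum>i\<in>I. \<Sum>k\<in>K. (\<phi> k i - \<psi> k i) * cnj (\<phi> k i - \<psi> k i))"
      unfolding mult_cnj_self by (subst sum.swap) simp
    also have "\<dots> = (\<Sum>i\<in>I. \<Sum>m\<in>I. of_real ((f m)\<^sup>2) * s m i * cnj (s m i))"
    proof (intro sum.cong[OF refl])
      fix i assume i: "i \<in> I"
      show "(\<Sum>k\<in>K. (\<phi> k i - \<psi> k i) * cnj (\<phi> k i - \<psi> k i)) = (\<Sum>m\<in>I. of_real ((f m)\<^sup>2) * s m i * cnj (s m i))"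
        unfolding diff[OF i] comb ..
    qed
    also have "\<dots> = of_real (\<Sum>m\<in>I. (f m)\<^sup>2 * S m)"
      unfolding mult.assoc mult_cnj_self S_def by (subst sum.swap) (simp add: sum_distrib_left)
    finally have "(\<Sum>k\<in>K. \<Sum>i\<in>I. (cmod (\<phi> k i - \<psi> k i))\<^sup>2) = (\<Sum>m\<in>I. (f m)\<^sup>2 * S m)"
      using of_real_eq_iff by blast
    also have "\<dots> \<le> (\<Sum>m\<in>I. (1 - c m) * S m)"
    proof (intro sum_mono mult_right_mono)
      fix m assume m: "m \<in> I"
      have "c m \<le> sqrt (c m)" using c[OF m] by (metis mult_left_le real_sqrt_ge_0_iff real_sqrt_le_1_iff real_sqrt_mult_self abs_of_nonneg)
      moreover have "(f m)\<^sup>2 = 1 - 2 * sqrt (c m) + c m"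
        unfolding f_def using c[OF m] by (simp add: power2_diff)
      ultimately show "(f m)\<^sup>2 \<le> 1 - c m" by simp
    qed (simp add: S_def sum_nonneg)
    also have "\<dots> = Re (\<Sum>i\<in>I. X i i) - Re (\<Sum>i\<in>I. R i i)"
    proof -
      have "(\<Sum>i\<in>I. X i i) = of_real (\<Sum>m\<in>I. S m)"
      proof -
        have "(\<Sum>i\<in>I. X i i) = (\<Sum>i\<in>I. \<Sum>m\<in>I. s m i * cnj (s m i))" by (simp add: Xs)
        then show ?thesis unfolding mult_cnj_self S_def by (subst sum.swap) simp
      qed
      moreover have "(\<Sum>i\<in>I. R i i) = of_real (\<Sum>m\<in>I. c m * S m)"
      proof -
        have "(\<Sum>i\<in>I. R i i) = (\<Sum>i\<in>I. \<Sum>m\<in>I. of_real (c m) * (s m i * cnj (s m i)))" by (simp add: Rs mult.assoc)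
        also have "\<dots> = (\<Sum>m\<in>I. \<Sum>i\<in>I. of_real (c m) * (s m i * cnj (s m i)))" by (rule sum.swap)
        finally show ?thesis unfolding mult_cnj_self S_def by (simp add: sum_distrib_left)
      qed
      ultimately show ?thesis by (simp add: left_diff_distrib sum_subtractf del: of_real_sum)
    qed
    finally show "(\<Sum>k\<in>K. \<Sum>i\<in>I. (cmod (\<phi> k i - \<psi> k i))\<^sup>2) \<le> Re (\<Sum>i\<in>I. X i i) - Re (\<Sum>i\<in>I. R i i)" .
  qed
qed

section \<open>Entropy of vectors close to low Schmidt rank\<close>

text \<open>The inequality \<open>ln y \<le> y - 1\<close> at y = q x / e. Summed over weights e of
  total q and numbers x of total at most 1, the right-hand sides are at most 0.\<close>

lemma gibbs_term:
  fixes e q x :: real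
  assumes "0 \<le> e" "0 < q" "0 < x"
  shows "eta e + e * log 2 q + e * log 2 x \<le> (q * x - e) / ln 2"
proof (cases "e = 0")
  case False
  then have e: "e > 0" using assms by simp
  have "ln (q * x / e) \<le> q * x / e - 1" using assms e by (intro ln_le_minus_one) simp
  then have "e * ln (q * x / e) \<le> q * x - e" using e by (simp add: field_simps)
  moreover have "ln (q * x / e) = ln q + ln x - ln e" using assms e by (simp add: ln_mult ln_div)
  ultimately have "e * (ln q + ln x - ln e) / ln 2 \<le> (q * x - e) / ln 2" by (simp add: divide_right_mono)
  moreover have "eta e + e * log 2 q + e * log 2 x = e * (ln q + ln x - ln e) / ln 2"
    unfolding eta_def log_def by (simp add: diff_divide_distrib add_divide_distrib algebra_simps)
  ultimately show ?thesis by simp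
qed (use assms in simp)

text \<open>Gibbs' inequality against the weights p k / (2 s) + (1 - p k) / (2 a).\<close>

lemma entropy_weight_bound:
  fixes e p :: "'k \<Rightarrow> real"
  assumes "finite K" and e: "\<And>k. k \<in> K \<Longrightarrow> 0 \<le> e k" and p: "\<And>k. k \<in> K \<Longrightarrow> 0 \<le> p k" "\<And>k. k \<in> K \<Longrightarrow> p k \<le> 1"
    and s: "1 \<le> s" "(\<Sum>k\<in>K. p k) \<le> s" and a: "card K = a" "1 \<le> a"
  defines "q \<equiv> \<Sum>k\<in>K. e k"
  shows "(\<Sum>k\<in>K. eta (e k)) \<le> eta q + q * (1 + log 2 s) + (\<Sum>k\<in>K. e k * (1 - p k)) * log 2 (real a)"
proof (cases "q = 0")
  case True
  then have "\<forall>k\<in>K. e k = 0" using e assms(1) by (simp add: q_def sum_nonneg_eq_0_iff)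
  then show ?thesis using True by simp
next
  case False
  then have q: "q > 0" using e by (simp add: q_def sum_nonneg order_less_le)
  have a0: "real a \<ge> 1" using a(2) by simp
  have s0: "log 2 s \<ge> 0" using s(1) by simp
  define \<tau> where "\<tau> k = p k / (2 * s) + (1 - p k) / (2 * real a)" for k
  have bnd: "eta (e k) \<le> - e k * log 2 q + e k + e k * p k * log 2 s + e k * (1 - p k) * log 2 (real a)
      + (q * \<tau> k - e k) / ln 2" if k: "k \<in> K" for k
  proof -
    have 1: "eta (e k) + e k * log 2 q + e k * log 2 (1 / (2 * s)) \<le> (q * (1 / (2 * s)) - e k) / ln 2"
      using e[OF k] q s(1) by (intro gibbs_term) auto
    have 2: "eta (e k) + e k * log 2 q + e k * log 2 (1 / (2 * real a)) \<le> (q * (1 / (2 * real a)) - e k) / ln 2"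
      using e[OF k] q a0 by (intro gibbs_term) auto
    have l: "log 2 (1 / (2 * x)) = - 1 - log 2 x" if "x \<ge> 1" for x :: real
      using that by (simp add: log_divide log_mult)
    \<comment> \<open>Two inequalities of Gibbs type are averaged with weights \<open>p k\<close>
      and \<open>1 - p k\<close>, which leaves the logarithms of the two constant weights separate.
      The factors 2 in these weights produce the extra bit in \<open>1 + log 2 s\<close>.\<close>
    have "p k * (eta (e k) + e k * log 2 q + e k * log 2 (1 / (2 * s)))
      + (1 - p k) * (eta (e k) + e k * log 2 q + e k * log 2 (1 / (2 * real a)))
      \<le> p k * ((q * (1 / (2 * s)) - e k) / ln 2) + (1 - p k) * ((q * (1 / (2 * real a)) - e k) / ln 2)"
      using p[OF k] by (intro add_mono mult_left_mono 1 2) auto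
    also have "\<dots> = (q * \<tau> k - e k) / ln 2"
      unfolding \<tau>_def using s(1) a0 by (simp add: field_simps)
    finally show ?thesis unfolding l[OF s(1)] l[OF a0] by (simp add: algebra_simps)
  qed
  \<comment> \<open>Each of the two parts contributes at most 1 / 2: the \<open>p k\<close> sum to
    at most \<open>s\<close>, their complements to at most \<open>a\<close>.\<close>
  have "(\<Sum>k\<in>K. \<tau> k) \<le> 1"
  proof -
    have "(\<Sum>k\<in>K. \<tau> k) = (\<Sum>k\<in>K. p k) / (2 * s) + (real a - (\<Sum>k\<in>K. p k)) / (2 * real a)"
      unfolding \<tau>_def using a(1) by (simp add: sum.distrib sum_divide_distrib[symmetric] sum_subtractf)
    moreover have "(\<Sum>k\<in>K. p k) / (2 * s) \<le> 1 / 2" using s by (simp add: field_simps)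
    moreover have "(real a - (\<Sum>k\<in>K. p k)) / (2 * real a) \<le> 1 / 2"
      using a0 p(1) by (simp add: field_simps sum_nonneg)
    ultimately show ?thesis by linarith
  qed
  then have "q * (\<Sum>k\<in>K. \<tau> k) \<le> q" using q by (simp add: mult_left_le)
  then have neg: "(q * (\<Sum>k\<in>K. \<tau> k) - q) / ln 2 \<le> 0"
    by (simp add: divide_nonpos_pos)
  have "(\<Sum>k\<in>K. eta (e k)) \<le> (\<Sum>k\<in>K. - e k * log 2 q + e k + e k * p k * log 2 s + e k * (1 - p k) * log 2 (real a)
      + (q * \<tau> k - e k) / ln 2)"
    by (intro sum_mono bnd)
  also have "\<dots> = - q * log 2 q + q + (\<Sum>k\<in>K. e k * p k) * log 2 s + (\<Sum>k\<in>K. e k * (1 - p k)) * log 2 (real a)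
      + (q * (\<Sum>k\<in>K. \<tau> k) - q) / ln 2"
    by (simp add: sum.distrib sum_subtractf sum_negf sum_divide_distrib[symmetric]
        sum_distrib_left[symmetric] sum_distrib_right[symmetric] q_def[symmetric])
  also have "\<dots> \<le> - q * log 2 q + q + q * log 2 s + (\<Sum>k\<in>K. e k * (1 - p k)) * log 2 (real a)"
  proof -
    have "(\<Sum>k\<in>K. e k * p k) \<le> q" unfolding q_def using e p by (intro sum_mono) (simp add: mult_left_le)
    then have "(\<Sum>k\<in>K. e k * p k) * log 2 s \<le> q * log 2 s" using s0 by (rule mult_right_mono)
    then show ?thesis using neg by simp
  qed
  finally show ?thesis by (simp add: eta_def algebra_simps)
qed

text \<open>The left factors of \<open>\<chi>\<close> span a subspace of dimension at most s. The
  weight of \<open>\<phi>\<close> inside it costs about log s; the weight outside is also that of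
  \<open>\<phi> - \<chi>\<close> outside, hence at most \<open>\<delta>\<close>, and costs log a.
  The term \<open>eta q\<close> is there because \<open>\<phi>\<close> is not normalised.\<close>

lemma schmidt_entropy_bound:
  fixes \<phi> \<chi> :: "nat \<Rightarrow> nat \<Rightarrow> complex"
  assumes s: "0 < s" and a: "0 < a" and \<chi>: "schmidt_rank_le s a b \<chi>"
  defines "q \<equiv> \<Sum>i<a. \<Sum>j<b. (cmod (\<phi> i j))\<^sup>2" and "\<delta> \<equiv> \<Sum>i<a. \<Sum>j<b. (cmod (\<phi> i j - \<chi> i j))\<^sup>2"
  shows "ent {..<a} (\<lambda>i i'. \<Sum>j<b. \<phi> i j * cnj (\<phi> i' j)) \<le> eta q + q * (1 + log 2 (real s)) + \<delta> * log 2 (real a)"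
proof -
  let ?N = "\<lambda>i i'. \<Sum>j<b. \<phi> i j * cnj (\<phi> i' j)" and ?I = "{..<a}"
  have N: "psd_on ?I ?N" by (rule psd_gram) (rule refl)
  obtain u e where u: "spectral_on ?I ?I u e ?N" "complete_family ?I ?I u"
    using spectral_theorem[OF _ psd_onD(1)[OF N]] by auto
  obtain L R where LR: "\<And>i j. i < a \<Longrightarrow> j < b \<Longrightarrow> \<chi> i j = (\<Sum>l<s. L i l * R l j)"
    using \<chi> unfolding schmidt_rank_le_def by blast
  have "orthonormal ?I {..<0 :: nat} (\<lambda>_ _. 0)" by (simp add: orthonormal_def)
  \<comment> \<open>Gram-Schmidt from the empty family gives an orthonormal basis of the span of the
    columns of \<open>L\<close>, of size at most s.\<close>
  from orthonormal_extend[OF _ this, of "map (\<lambda>l i. L i l) [0..<s]"]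
  obtain r w where r: "r \<le> s" and w: "orthonormal ?I {..<r} w"
    and wL: "\<And>l i. l < s \<Longrightarrow> i < a \<Longrightarrow> L i l = (\<Sum>k<r. ip ?I (w k) (\<lambda>i. L i l) * w k i)" by auto
  obtain w' where w': "orthonormal ?I ?I w'" "complete_family ?I ?I w'" "\<forall>k<r. w' k = w k"
    using orthonormal_completion[OF _ w] by auto
  have ra: "r \<le> a" using orthonormal_completion[OF _ w] by auto
  \<comment> \<open>The squared length of the projection of the eigenvector \<open>u k\<close> to
    that span.\<close>
  define p where "p k = (\<Sum>t<r. (cmod (ip ?I (w' t) (u k)))\<^sup>2)" for k
  have un: "(\<Sum>t<a. (cmod (ip ?I (w' t) (u k)))\<^sup>2) = 1" if "k < a" for k
    using parseval_norm[OF _ w'(2), of "u k"] orthonormal_norm[OF spectral_onD(2)[OF u(1)], of k] that by simp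
  have p0: "0 \<le> p k" for k unfolding p_def by (simp add: sum_nonneg)
  have p1: "p k \<le> 1" if "k < a" for k
    unfolding p_def un[OF that, symmetric] using ra by (intro sum_mono2) auto
  have "(\<Sum>k<a. p k) = (\<Sum>t<r. \<Sum>k<a. (cmod (ip ?I (u k) (w' t)))\<^sup>2)"
    unfolding p_def by (subst sum.swap) (simp add: cmod_ip_commute[of ?I "w' t" for t])
  also have "\<dots> = (\<Sum>t<r. 1)"
    using parseval_norm[OF _ u(2)] orthonormal_norm[OF w'(1)] ra by (intro sum.cong refl) (simp flip: parseval_norm)
  finally have ps: "(\<Sum>k<a. p k) \<le> real s" using r by simp
  have e0: "0 \<le> e k" if "k < a" for k using psd_spectral_nonneg[OF N u(1)] that by simp
  have q: "(\<Sum>k<a. e k) = q"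
  proof -
    have "complex_of_real (\<Sum>k<a. e k) = (\<Sum>i<a. ?N i i)" using spectral_trace[OF u(1)] by simp
    also have "\<dots> = of_real q" unfolding mult_cnj_self q_def by simp
    finally show ?thesis using of_real_eq_iff by blast
  qed
  have "(\<Sum>k<a. e k * (1 - p k)) = (\<Sum>t\<in>{r..<a}. \<Sum>k<a. e k * (cmod (ip ?I (u k) (w' t)))\<^sup>2)"
  proof -
    have "1 - p k = (\<Sum>t\<in>{r..<a}. (cmod (ip ?I (u k) (w' t)))\<^sup>2)" if "k < a" for k
    proof -
      have S: "{..<r} \<union> {r..<a} = {..<a}" using ra by auto
      have "(\<Sum>t<a. (cmod (ip ?I (w' t) (u k)))\<^sup>2) = p k + (\<Sum>t\<in>{r..<a}. (cmod (ip ?I (w' t) (u k)))\<^sup>2)"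
        unfolding p_def by (subst sum.union_disjoint[symmetric]) (auto simp: S)
      then show ?thesis unfolding un[OF that] by (simp add: cmod_ip_commute[of ?I "w' t" for t])
    qed
    then have "(\<Sum>k<a. e k * (1 - p k)) = (\<Sum>k<a. \<Sum>t\<in>{r..<a}. e k * (cmod (ip ?I (u k) (w' t)))\<^sup>2)"
      by (simp add: sum_distrib_left)
    then show ?thesis by (simp add: sum.swap[of _ "{r..<a}"])
  qed
  also have "\<dots> = (\<Sum>t\<in>{r..<a}. \<Sum>j<b. (cmod (ip ?I (w' t) (\<lambda>i. \<phi> i j)))\<^sup>2)"
  proof (rule sum.cong[OF refl])
    fix t
    have "complex_of_real (\<Sum>k<a. e k * (cmod (ip ?I (u k) (w' t)))\<^sup>2) = sesq ?I (w' t) ?N (w' t)"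
      using spectral_sesq_self[OF u(1)] by simp
    also have "\<dots> = (\<Sum>j<b. ip ?I (w' t) (\<lambda>i. \<phi> i j) * ip ?I (\<lambda>i. \<phi> i j) (w' t))"
      by (rule sesq_gram) (rule refl)
    also have "\<dots> = of_real (\<Sum>j<b. (cmod (ip ?I (w' t) (\<lambda>i. \<phi> i j)))\<^sup>2)"
      unfolding of_real_sum mult_cnj_self[symmetric] cnj_ip ..
    finally show "(\<Sum>k<a. e k * (cmod (ip ?I (u k) (w' t)))\<^sup>2) = (\<Sum>j<b. (cmod (ip ?I (w' t) (\<lambda>i. \<phi> i j)))\<^sup>2)"
      using of_real_eq_iff by blast
  qed
  \<comment> \<open>For \<open>t \<ge> r\<close> the vector \<open>w' t\<close> is orthogonal to
    every column of \<open>L\<close>, hence to every column of \<open>\<chi>\<close>, which may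
    therefore be subtracted.\<close>
  also have "\<dots> = (\<Sum>t\<in>{r..<a}. \<Sum>j<b. (cmod (ip ?I (w' t) (\<lambda>i. \<phi> i j - \<chi> i j)))\<^sup>2)"
  proof (intro sum.cong refl)
    fix t j assume t: "t \<in> {r..<a}" and j: "j \<in> {..<b}"
    have L0: "ip ?I (w' t) (\<lambda>i. L i l) = 0" if l: "l < s" for l
    proof -
      have "ip ?I (w' t) (\<lambda>i. L i l) = ip ?I (w' t) (\<lambda>i. \<Sum>k<r. ip ?I (w k) (\<lambda>i. L i l) * w k i)"
        using wL[OF l] by (intro ip_cong) auto
      also have "\<dots> = (\<Sum>k<r. ip ?I (w k) (\<lambda>i. L i l) * ip ?I (w' t) (w' k))"
        unfolding ip_sum_right using w'(3) by simp
      also have "\<dots> = 0"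
        using t ra by (intro sum.neutral) (auto simp: orthonormal_ip[OF w'(1)])
      finally show ?thesis .
    qed
    have "ip ?I (w' t) (\<lambda>i. \<chi> i j) = ip ?I (w' t) (\<lambda>i. \<Sum>l<s. R l j * L i l)"
      using j LR by (intro ip_cong) (auto simp: mult.commute)
    also have "\<dots> = 0" unfolding ip_sum_right using L0 by simp
    finally have "ip ?I (w' t) (\<lambda>i. \<chi> i j) = 0" .
    then show "(cmod (ip ?I (w' t) (\<lambda>i. \<phi> i j)))\<^sup>2 = (cmod (ip ?I (w' t) (\<lambda>i. \<phi> i j - \<chi> i j)))\<^sup>2"
      by (simp add: ip_def right_diff_distrib sum_subtractf)
  qed
  also have "\<dots> \<le> (\<Sum>t<a. \<Sum>j<b. (cmod (ip ?I (w' t) (\<lambda>i. \<phi> i j - \<chi> i j)))\<^sup>2)"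
    by (intro sum_mono2) (auto intro: sum_nonneg)
  also have "\<dots> = (\<Sum>j<b. \<Sum>i<a. (cmod (\<phi> i j - \<chi> i j))\<^sup>2)"
    using parseval_norm[OF _ w'(2)] by (subst sum.swap) simp
  also have "\<dots> = \<delta>" unfolding \<delta>_def by (rule sum.swap)
  finally have \<delta>: "(\<Sum>k<a. e k * (1 - p k)) \<le> \<delta>" .
  have "ent ?I ?N = (\<Sum>k<a. eta (e k))" using ent_eq[OF _ u(1)] by simp
  also have "\<dots> \<le> eta q + q * (1 + log 2 (real s)) + (\<Sum>k<a. e k * (1 - p k)) * log 2 (real a)"
    unfolding q[symmetric] using e0 p0 p1 ps s a by (intro entropy_weight_bound) auto
  also have "\<dots> \<le> eta q + q * (1 + log 2 (real s)) + \<delta> * log 2 (real a)"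
    using \<delta> a by (simp add: mult_right_mono)
  finally show ?thesis .
qed


section \<open>Ensemble extensions and the entanglement cost\<close>

lemma block_hermitian:
  assumes "\<And>a. a \<in> A \<Longrightarrow> hermitian_on I (N a)"
  shows "hermitian_on (A \<times> I) (\<lambda>(a, i) (a', i'). if a = a' then N a i i' else 0)"
proof (rule hermitian_onI)
  fix x y assume "x \<in> A \<times> I" "y \<in> A \<times> I"
  then obtain a i a' i' where xy: "x = (a, i)" "y = (a', i')" "a \<in> A" "i \<in> I" "i' \<in> I" by auto
  show "(case y of (a, i) \<Rightarrow> \<lambda>(a', i'). if a = a' then N a i i' else 0) x
    = cnj ((case x of (a, i) \<Rightarrow> \<lambda>(a', i'). if a = a' then N a i i' else 0) y)"
    using hermitian_onD[OF assms[OF xy(3)] xy(4,5)] unfolding xy by auto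
qed

lemma ent_block:
  assumes fin: "finite A" "finite I" and h: "\<And>a. a \<in> A \<Longrightarrow> hermitian_on I (N a)"
  shows "ent (A \<times> I) (\<lambda>(a, i) (a', i'). if a = a' then N a i i' else 0) = (\<Sum>a\<in>A. ent I (N a))"
proof -
  have "\<forall>a\<in>A. \<exists>p. spectral_on I I (fst p) (snd p) (N a)"
  proof
    fix a assume "a \<in> A"
    from spectral_theorem[OF fin(2) h[OF this]] show "\<exists>p. spectral_on I I (fst p) (snd p) (N a)"
      by (metis fst_conv snd_conv)
  qed
  then obtain p where p: "\<And>a. a \<in> A \<Longrightarrow> spectral_on I I (fst (p a)) (snd (p a)) (N a)" by (metis bchoice)
  have "ent (A \<times> I) (\<lambda>(a, i) (a', i'). if a = a' then N a i i' else 0) = (\<Sum>(a, k)\<in>A \<times> I. eta (snd (p a) k))"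
    using ent_eq[OF _ spectral_block[OF fin(1) p]] fin by (simp add: split_beta)
  also have "\<dots> = (\<Sum>a\<in>A. \<Sum>k\<in>I. eta (snd (p a) k))" by (simp only: sum.cartesian_product' prod.case)
  also have "\<dots> = (\<Sum>a\<in>A. ent I (N a))" by (intro sum.cong refl) (simp add: ent_eq[OF fin(2) p])
  finally show ?thesis .
qed

lemma ent_rank_one:
  assumes fin: "finite I"
  shows "ent I (\<lambda>x y. f x * cnj (f y)) = eta (\<Sum>x\<in>I. (cmod (f x))\<^sup>2)"
proof (cases "(\<Sum>x\<in>I. (cmod (f x))\<^sup>2) = 0")
  case True
  then have "\<forall>x\<in>I. f x = 0" using fin by (simp add: sum_nonneg_eq_0_iff)
  then have "ent I (\<lambda>x y. f x * cnj (f y)) = ent I (\<lambda>x y. 0)" by (intro ent_cong) simp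
  then show ?thesis using True fin by (simp add: ent_zero)
next
  case False
  define q where "q = (\<Sum>x\<in>I. (cmod (f x))\<^sup>2)"
  have q: "q > 0" using False unfolding q_def by (metis less_eq_real_def sum_nonneg zero_le_power2)
  define c where "c = complex_of_real (1 / sqrt q)"
  have cc: "cnj c = c" "c * c * of_real q = 1"
    using q unfolding c_def of_real_mult[symmetric] by (simp_all add: field_simps flip: of_real_mult)
  have "ip I (\<lambda>x. c * f x) (\<lambda>x. c * f x) = c * c * ip I f f"
    unfolding ip_def by (simp add: sum_distrib_left cc(1) mult_ac)
  then have "ip I (\<lambda>x. c * f x) (\<lambda>x. c * f x) = 1" using cc(2) by (simp add: ip_self q_def)
  moreover have "of_real q * (c * f x) * cnj (c * f y) = f x * cnj (f y)" for x y
    using cc by (simp add: mult_ac)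
  ultimately have "spectral_on I {()} (\<lambda>_ x. c * f x) (\<lambda>_. q) (\<lambda>x y. f x * cnj (f y))"
    by (simp add: spectral_on_def orthonormal_def)
  from ent_eq[OF fin this] show ?thesis by (simp add: q_def)
qed

definition cq_kernel :: "('k \<Rightarrow> nat \<Rightarrow> nat \<Rightarrow> complex) \<Rightarrow> nat \<times> nat \<times> 'k \<Rightarrow> nat \<times> nat \<times> 'k \<Rightarrow> complex" where
  "cq_kernel \<phi> = (\<lambda>(i, j, k) (i', j', k'). if k = k' then \<phi> k i j * cnj (\<phi> k i' j') else 0)"

lemma cq_kernel_psd:
  assumes "finite K"
  shows "psd_on (A \<times> B \<times> K) (cq_kernel \<phi>)"
proof (rule psd_gram[where K = K and w = "\<lambda>l (i, j, k). if k = l then \<phi> l i j else 0"])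
  fix x y assume "x \<in> A \<times> B \<times> K" "y \<in> A \<times> B \<times> K"
  then obtain i j k i' j' k' where xy: "x = (i, j, k)" "y = (i', j', k')" "k \<in> K" by auto
  have "(\<Sum>l\<in>K. (case x of (i, j, k) \<Rightarrow> if k = l then \<phi> l i j else 0) * cnj (case y of (i, j, k) \<Rightarrow> if k = l then \<phi> l i j else 0))
    = (\<Sum>l\<in>K. if k = l then (if k' = l then \<phi> l i j * cnj (\<phi> l i' j') else 0) else 0)"
    unfolding xy by (intro sum.cong refl) auto
  also have "\<dots> = cq_kernel \<phi> x y" unfolding xy cq_kernel_def using assms xy(3) by auto
  finally show "cq_kernel \<phi> x y = (\<Sum>l\<in>K. (case x of (i, j, k) \<Rightarrow> if k = l then \<phi> l i j else 0)
    * cnj (case y of (i, j, k) \<Rightarrow> if k = l then \<phi> l i j else 0))" by simp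
qed

text \<open>Given the record, the state of AB is pure, so the entropy of the whole equals that of
  the register. This is the origin of the two \<open>eta\<close> terms.\<close>

lemma cq_kernel_cmi:
  fixes \<phi> :: "'k \<Rightarrow> nat \<Rightarrow> nat \<Rightarrow> complex" and a b :: nat
  assumes fin: "finite K"
  defines "q \<equiv> \<lambda>k. \<Sum>i<a. \<Sum>j<b. (cmod (\<phi> k i j))\<^sup>2"
  shows "cmi {..<a} {..<b} K (cq_kernel \<phi>) = (\<Sum>k\<in>K. ent {..<a} (\<lambda>i i'. \<Sum>j<b. \<phi> k i j * cnj (\<phi> k i' j))
    + ent {..<b} (\<lambda>j j'. \<Sum>i<a. \<phi> k i j * cnj (\<phi> k i j')) - 2 * eta (q k))"
proof -
  let ?A = "{..<a}" and ?B = "{..<b}"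
  define N where "N = (\<lambda>k i i'. \<Sum>j<b. \<phi> k i j * cnj (\<phi> k i' j))"
  define N' where "N' = (\<lambda>k j j'. \<Sum>i<a. \<phi> k i j * cnj (\<phi> k i j'))"
  have h: "hermitian_on ?A (N k)" "hermitian_on ?B (N' k)" for k
    unfolding N_def N'_def by (intro hermitian_onI; simp add: mult.commute)+
  have sw: "ent (X \<times> K) (\<lambda>(i, k) (i', k'). if k = k' then F k i i' else 0) = (\<Sum>k\<in>K. ent X (F k))"
    if X: "finite X" and F: "\<And>k. hermitian_on X (F k)" for X :: "nat set" and F
  proof -
    let ?G = "\<lambda>(k, i) (k', i'). if k = k' then F k i i' else 0"
    have b: "bij_betw (\<lambda>(i, k). (k, i)) (X \<times> K) (K \<times> X)"
      by (rule bij_betwI[where g = "\<lambda>(k, i). (i, k)"]) auto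
    have "ent (X \<times> K) (\<lambda>(i, k) (i', k'). if k = k' then F k i i' else 0) = ent (K \<times> X) ?G"
      using fin X F by (intro ent_reindex[OF b] block_hermitian) auto
    also have "\<dots> = (\<Sum>k\<in>K. ent X (F k))" using fin X F by (intro ent_block) auto
    finally show ?thesis .
  qed
  have "ent (?A \<times> K) (trace_mid ?B (cq_kernel \<phi>)) = ent (?A \<times> K) (\<lambda>(i, k) (i', k'). if k = k' then N k i i' else 0)"
    by (intro ent_cong) (auto simp: trace_mid_def cq_kernel_def N_def)
  then have e1: "ent (?A \<times> K) (trace_mid ?B (cq_kernel \<phi>)) = (\<Sum>k\<in>K. ent ?A (N k))" using sw[OF _ h(1)] by simp
  have tf: "trace_fst ?A (cq_kernel \<phi>) (j, k) (j', k') = (if k = k' then N' k j j' else 0)" for j k j' k'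
    by (auto simp: trace_fst_def cq_kernel_def N'_def)
  have "ent (?B \<times> K) (trace_fst ?A (cq_kernel \<phi>)) = ent (?B \<times> K) (\<lambda>(i, k) (i', k'). if k = k' then N' k i i' else 0)"
    by (intro ent_cong) (auto simp: tf)
  then have e2: "ent (?B \<times> K) (trace_fst ?A (cq_kernel \<phi>)) = (\<Sum>k\<in>K. ent ?B (N' k))" using sw[OF _ h(2)] by simp
  have qc: "(\<Sum>j<b. N' k j j) = of_real (q k)" for k
    unfolding N'_def q_def mult_cnj_self by (subst sum.swap) simp
  have e3: "ent K (trace_fst ?B (trace_fst ?A (cq_kernel \<phi>))) = (\<Sum>k\<in>K. eta (q k))"
  proof (rule ent_eq[OF fin])
    have "trace_fst ?B (trace_fst ?A (cq_kernel \<phi>)) k k' = (\<Sum>l\<in>K. of_real (q l) * (if k = l then 1 else 0) * cnj (if k' = l then 1 else 0))"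
      if "k \<in> K" "k' \<in> K" for k k'
    proof -
      have "(\<Sum>l\<in>K. of_real (q l) * (if k = l then 1 else 0) * cnj (if k' = l then 1 else 0))
        = (\<Sum>l\<in>K. if k = l then (if k' = l then complex_of_real (q l) else 0) else 0)"
        by (intro sum.cong refl) auto
      also have "\<dots> = (if k = k' then of_real (q k) else 0)" using fin that by auto
      finally show ?thesis unfolding trace_fst_def[of ?B] tf using qc[of k] by auto
    qed
    moreover have "orthonormal K K (\<lambda>l k. if k = l then 1 else 0)"
      unfolding orthonormal_def ip_def
    proof (intro ballI)
      fix k l assume "k \<in> K" "l \<in> K"
      have "(\<Sum>i\<in>K. cnj (if i = k then 1 else 0) * (if i = l then 1 else 0)) = (\<Sum>i\<in>K. if i = k then (if i = l then 1 else 0) else 0 :: complex)"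
        by (intro sum.cong refl) auto
      then show "(\<Sum>i\<in>K. cnj (if i = k then 1 else 0) * (if i = l then 1 else 0)) = (if k = l then 1 else 0 :: complex)"
        using fin \<open>k \<in> K\<close> by simp
    qed
    ultimately show "spectral_on K K (\<lambda>l k. if k = l then 1 else 0) q (trace_fst ?B (trace_fst ?A (cq_kernel \<phi>)))"
      using fin unfolding spectral_on_def by blast
  qed
  have e4: "ent (?A \<times> ?B \<times> K) (cq_kernel \<phi>) = (\<Sum>k\<in>K. eta (q k))"
  proof -
    let ?P = "\<lambda>k x y. (\<lambda>(i, j). \<phi> k i j) x * cnj ((\<lambda>(i, j). \<phi> k i j) y)"
    let ?G = "\<lambda>(k, x) (k', y). if k = k' then ?P k x y else 0"
    have b: "bij_betw (\<lambda>(i, j, k). (k, (i, j))) (?A \<times> ?B \<times> K) (K \<times> (?A \<times> ?B))"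
      by (rule bij_betwI[where g = "\<lambda>(k, (i, j)). (i, j, k)"]) auto
    have P: "hermitian_on (?A \<times> ?B) (?P k)" for k by (intro hermitian_onI) simp
    have "ent (?A \<times> ?B \<times> K) (cq_kernel \<phi>) = ent (K \<times> (?A \<times> ?B)) ?G"
      using fin by (intro ent_reindex[OF b] block_hermitian P) (auto simp: cq_kernel_def)
    also have "\<dots> = (\<Sum>k\<in>K. ent (?A \<times> ?B) (?P k))" using fin P by (intro ent_block) auto
    also have "\<dots> = (\<Sum>k\<in>K. eta (q k))"
      unfolding q_def by (intro sum.cong refl) (simp add: ent_rank_one sum.cartesian_product')
    finally show ?thesis .
  qed
  show ?thesis unfolding cmi_def e1 e2 e3 e4
    by (simp add: N_def N'_def sum.distrib sum_subtractf sum_distrib_left[symmetric])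
qed

text \<open>The bounds for the two marginals contribute \<open>eta (q k)\<close> each, which cancels
  exactly against the term subtracted. What is left is linear in the squared norms and distances, so
  the number of vectors is irrelevant.\<close>

lemma cq_kernel_cmi_le:
  fixes \<phi> \<chi> :: "'k \<Rightarrow> nat \<Rightarrow> nat \<Rightarrow> complex"
  assumes fin: "finite K" and s: "0 < s" and ab: "0 < a" "0 < b"
    and \<chi>: "\<And>k. k \<in> K \<Longrightarrow> schmidt_rank_le s a b (\<chi> k)"
  shows "cmi {..<a} {..<b} K (cq_kernel \<phi>)
    \<le> 2 * (1 + log 2 (real s)) * (\<Sum>k\<in>K. \<Sum>i<a. \<Sum>j<b. (cmod (\<phi> k i j))\<^sup>2)
      + (log 2 (real a) + log 2 (real b)) * (\<Sum>k\<in>K. \<Sum>i<a. \<Sum>j<b. (cmod (\<phi> k i j - \<chi> k i j))\<^sup>2)"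
proof -
  define q where "q k = (\<Sum>i<a. \<Sum>j<b. (cmod (\<phi> k i j))\<^sup>2)" for k
  define \<delta> where "\<delta> k = (\<Sum>i<a. \<Sum>j<b. (cmod (\<phi> k i j - \<chi> k i j))\<^sup>2)" for k
  have "cmi {..<a} {..<b} K (cq_kernel \<phi>)
    \<le> (\<Sum>k\<in>K. 2 * (1 + log 2 (real s)) * q k + (log 2 (real a) + log 2 (real b)) * \<delta> k)"
    unfolding cq_kernel_cmi[OF fin]
  proof (rule sum_mono)
    fix k assume k: "k \<in> K"
    have A: "ent {..<a} (\<lambda>i i'. \<Sum>j<b. \<phi> k i j * cnj (\<phi> k i' j)) \<le> eta (q k) + q k * (1 + log 2 (real s)) + \<delta> k * log 2 (real a)"
      unfolding q_def \<delta>_def by (rule schmidt_entropy_bound[OF s ab(1) \<chi>[OF k]])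
    \<comment> \<open>Transposing the coefficient matrix exchanges the parties.\<close>
    have "schmidt_rank_le s b a (\<lambda>j i. \<chi> k i j)"
    proof -
      obtain L R where "\<forall>i<a. \<forall>j<b. \<chi> k i j = (\<Sum>l<s. L i l * R l j)"
        using \<chi>[OF k] unfolding schmidt_rank_le_def by blast
      then show ?thesis unfolding schmidt_rank_le_def
        by (intro exI[of _ "\<lambda>j l. R l j"] exI[of _ "\<lambda>l i. L i l"]) (simp add: mult.commute)
    qed
    have qs: "(\<Sum>j<b. \<Sum>i<a. (cmod (\<phi> k i j))\<^sup>2) = q k" unfolding q_def by (rule sum.swap)
    have ds: "(\<Sum>j<b. \<Sum>i<a. (cmod (\<phi> k i j - \<chi> k i j))\<^sup>2) = \<delta> k" unfolding \<delta>_def by (rule sum.swap)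
    from schmidt_entropy_bound[OF s ab(2) \<open>schmidt_rank_le s b a (\<lambda>j i. \<chi> k i j)\<close>, of "\<lambda>j i. \<phi> k i j"]
    have B: "ent {..<b} (\<lambda>j j'. \<Sum>i<a. \<phi> k i j * cnj (\<phi> k i j')) \<le> eta (q k) + q k * (1 + log 2 (real s)) + \<delta> k * log 2 (real b)"
      unfolding qs ds .
    show "ent {..<a} (\<lambda>i i'. \<Sum>j<b. \<phi> k i j * cnj (\<phi> k i' j))
      + ent {..<b} (\<lambda>j j'. \<Sum>i<a. \<phi> k i j * cnj (\<phi> k i j')) - 2 * eta (\<Sum>i<a. \<Sum>j<b. (cmod (\<phi> k i j))\<^sup>2)
      \<le> 2 * (1 + log 2 (real s)) * q k + (log 2 (real a) + log 2 (real b)) * \<delta> k"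
      using A B unfolding q_def[symmetric] by (simp add: algebra_simps)
  qed
  then show ?thesis unfolding q_def \<delta>_def by (simp add: sum.distrib sum_distrib_left)
qed

section \<open>Positivity of tensor powers\<close>

lemma psd_tensor:
  assumes fin: "finite I" "finite J" and M: "psd_on I M" and N: "psd_on J N"
  shows "psd_on (I \<times> J) (\<lambda>(i, j) (i', j'). M i i' * N j j')"
proof -
  obtain v where v: "\<And>i i'. i \<in> I \<Longrightarrow> i' \<in> I \<Longrightarrow> M i i' = (\<Sum>k\<in>I. v k i * cnj (v k i'))"
    by (rule psd_gramE[OF fin(1) M]) blast
  obtain w where w: "\<And>i i'. i \<in> J \<Longrightarrow> i' \<in> J \<Longrightarrow> N i i' = (\<Sum>k\<in>J. w k i * cnj (w k i'))"
    by (rule psd_gramE[OF fin(2) N]) blast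
  show ?thesis
  proof (rule psd_gram[where K = "I \<times> J" and w = "\<lambda>(k, l) (i, j). v k i * w l j"])
    fix x y assume "x \<in> I \<times> J" "y \<in> I \<times> J"
    then obtain i j i' j' where xy: "x = (i, j)" "y = (i', j')" "i \<in> I" "j \<in> J" "i' \<in> I" "j' \<in> J" by auto
    show "(case x of (i, j) \<Rightarrow> \<lambda>(i', j'). M i i' * N j j') y
      = (\<Sum>k\<in>I \<times> J. (case k of (k, l) \<Rightarrow> \<lambda>(i, j). v k i * w l j) x * cnj ((case k of (k, l) \<Rightarrow> \<lambda>(i, j). v k i * w l j) y))"
      unfolding xy prod.case sum.cartesian_product' v[OF xy(3,5)] w[OF xy(4,6)] sum_product complex_cnj_mult
      by (simp only: mult_ac)
  qed
qed

lemma power_kernel_psd: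
  assumes \<rho>: "positive_op (a * b) \<rho>"
  shows "psd_on ({..<a ^ n} \<times> {..<b ^ n}) (\<lambda>(x, y) (x', y'). power_kernel a b n \<rho> x y x' y')"
proof (induction n)
  case 0
  show ?case
    by (rule psd_gram[where K = "{0 :: nat}" and w = "\<lambda>_ _. 1"]) (auto simp: power_kernel_def)
next
  case (Suc n)
  have \<rho>': "psd_on {..<a * b} (\<lambda>x y. \<rho> $$ (x, y))" using \<rho> by (simp add: positive_op_iff_psd_on)
  define h where "h = (\<lambda>(x, y). ((x mod a ^ n, y mod b ^ n), x div a ^ n * b + y div b ^ n))"
  note P = psd_tensor[OF _ _ Suc.IH \<rho>']
  have pos: "a ^ n > 0" "x div a ^ n < a" if "x < a ^ Suc n" for x a :: nat
  proof -
    show "a ^ n > 0" using that by (cases "a = 0") auto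
    show "x div a ^ n < a" using that by (simp add: less_mult_imp_div_less)
  qed
  show ?case
  proof (rule psd_comap[OF _ P, where h = h])
    show "h ` ({..<a ^ Suc n} \<times> {..<b ^ Suc n}) \<subseteq> ({..<a ^ n} \<times> {..<b ^ n}) \<times> {..<a * b}"
      using pos by (auto simp: h_def index_less simp del: power_Suc)
    fix u v assume "u \<in> {..<a ^ Suc n} \<times> {..<b ^ Suc n}" "v \<in> {..<a ^ Suc n} \<times> {..<b ^ Suc n}"
    then obtain x y x' y' where uv: "u = (x, y)" "v = (x', y')" and
      b: "x < a ^ Suc n" "y < b ^ Suc n" "x' < a ^ Suc n" "y' < b ^ Suc n" by auto
    have "power_kernel a b (Suc n) \<rho> (x div a ^ n * a ^ n + x mod a ^ n) (y div b ^ n * b ^ n + y mod b ^ n)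
        (x' div a ^ n * a ^ n + x' mod a ^ n) (y' div b ^ n * b ^ n + y' mod b ^ n)
      = power_kernel a b n \<rho> (x mod a ^ n) (y mod b ^ n) (x' mod a ^ n) (y' mod b ^ n)
        * \<rho> $$ (x div a ^ n * b + y div b ^ n, x' div a ^ n * b + y' div b ^ n)"
      using pos[OF b(1)] pos[OF b(2)] pos[OF b(3)] pos[OF b(4)] by (intro power_kernel_Suc) auto
    then show "(case u of (x, y) \<Rightarrow> \<lambda>(x', y'). power_kernel a b (Suc n) \<rho> x y x' y') v
      = (case h u of (i, j) \<Rightarrow> \<lambda>(i', j'). (case i of (x, y) \<Rightarrow> \<lambda>(x', y'). power_kernel a b n \<rho> x y x' y') i' * \<rho> $$ (j, j')) (h v)"
      unfolding uv h_def div_mult_mod_eq by simp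
  qed auto
qed

lemma bipartite_power_index:
  assumes "x < a ^ n" "y < b ^ n" "x' < a ^ n" "y' < b ^ n"
  shows "bipartite_power a b n \<rho> $$ (x * b ^ n + y, x' * b ^ n + y') = power_kernel a b n \<rho> x y x' y'"
proof -
  have "b ^ n \<noteq> 0" using assms(2) by (metis not_less0)
  then have "(u * b ^ n + v) div b ^ n = u" "(u * b ^ n + v) mod b ^ n = v" if "v < b ^ n" for u v
    using that by auto
  then show ?thesis using assms index_less[OF assms(1,2)] index_less[OF assms(3,4)]
    by (simp add: bipartite_power_def copy_index_def power_kernel_def)
qed

lemma bipartite_power_psd:
  assumes "positive_op (a * b) \<rho>"
  shows "psd_on {..<a ^ n * b ^ n} (\<lambda>x y. bipartite_power a b n \<rho> $$ (x, y))"
proof (rule psd_comap[OF _ power_kernel_psd[OF assms, of n], where h = "\<lambda>x. (x div b ^ n, x mod b ^ n)"])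
  have b: "b ^ n > 0" "x div b ^ n < a ^ n" if "x < a ^ n * b ^ n" for x
  proof -
    show "b ^ n > 0" using that by (cases "b ^ n = 0") auto
    show "x div b ^ n < a ^ n" using that by (simp add: less_mult_imp_div_less)
  qed
  then show "(\<lambda>x. (x div b ^ n, x mod b ^ n)) ` {..<a ^ n * b ^ n} \<subseteq> {..<a ^ n} \<times> {..<b ^ n}" by auto
  fix x y assume "x \<in> {..<a ^ n * b ^ n}" "y \<in> {..<a ^ n * b ^ n}"
  then show "bipartite_power a b n \<rho> $$ (x, y) = (case (x div b ^ n, x mod b ^ n) of (x, y) \<Rightarrow>
    \<lambda>(x', y'). power_kernel a b n \<rho> x y x' y') (y div b ^ n, y mod b ^ n)"
    using bipartite_power_index[of "x div b ^ n" a n "x mod b ^ n" b "y div b ^ n" "y mod b ^ n" \<rho>] b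
    unfolding div_mult_mod_eq by simp
qed simp

section \<open>The bound for a fixed number of copies\<close>

lemma cmod_power2_le_double: "(cmod u)\<^sup>2 \<le> 2 * (cmod (u - v))\<^sup>2 + 2 * (cmod v)\<^sup>2"
proof -
  have "cmod u \<le> cmod (u - v) + cmod v" using norm_triangle_ineq[of "u - v" v] by simp
  then have "(cmod u)\<^sup>2 \<le> (cmod (u - v) + cmod v)\<^sup>2" by (intro power_mono) auto
  also have "\<dots> \<le> 2 * (cmod (u - v))\<^sup>2 + 2 * (cmod v)\<^sup>2"
    using zero_le_power2[of "cmod (u - v) - cmod v"] by (simp add: power2_eq_square algebra_simps)
  finally show ?thesis .
qed

lemma state_dim_pos: "state d \<rho> \<Longrightarrow> d > 0"
  unfolding state_def positive_op_def mat_trace_def by (rule ccontr) auto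

text \<open>W is a mixture of vectors of Schmidt rank at most s. Adding to it the absolute value of its
  difference D to the n-th power of \<rho>, and a small multiple of the identity, gives an operator that
  dominates this power; the additional vectors of its ensemble are compared with 0.\<close>

lemma squashed_power_bound:
  assumes \<rho>: "state (a * b) \<rho>" and c: "ereal (c / 2) \<le> squashed_entanglement a b \<rho>"
    and W: "low_rank_mixture s (a ^ n) (b ^ n) W" and s: "0 < s" and \<theta>: "0 < \<theta>"
  defines "\<epsilon> \<equiv> trace_norm (W - bipartite_power a b n \<rho>)"
  shows "real n * c \<le> 2 * (1 + log 2 (real s))
    + (6 * \<epsilon> + 4 * \<theta>) * (log 2 (real (a ^ n)) + log 2 (real (b ^ n)))"
proof -
  have pos: "positive_op (a * b) \<rho>" and \<rho>c: "\<rho> \<in> carrier_mat (a * b) (a * b)" and tr: "mat_trace \<rho> = 1"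
    using \<rho> by (auto simp: state_def positive_op_def)
  have "a > 0" "b > 0" using state_dim_pos[OF \<rho>] by auto
  define A where "A = a ^ n"
  define B where "B = b ^ n"
  have AB: "A > 0" "B > 0" using \<open>a > 0\<close> \<open>b > 0\<close> by (auto simp: A_def B_def)
  let ?I = "{..<A * B}"
  define P where "P = bipartite_power a b n \<rho>"
  have Pc: "P \<in> carrier_mat (A * B) (A * B)" by (simp add: P_def bipartite_power_def A_def B_def)
  have Ppsd: "psd_on ?I (\<lambda>x y. P $$ (x, y))" unfolding P_def A_def B_def by (rule bipartite_power_psd[OF pos])
  have Pi: "P $$ (i * B + j, i' * B + j') = power_kernel a b n \<rho> i j i' j'"
    if "i < A" "j < B" "i' < A" "j' < B" for i j i' j'
    using bipartite_power_index[of i a n j b i' j' \<rho>] that by (simp add: A_def B_def P_def)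
  note W' = W[folded A_def B_def]
  note Wc = low_rank_mixture_carrier[OF W']
  obtain m :: nat and \<psi> where \<psi>: "\<And>k. k < m \<Longrightarrow> schmidt_rank_le s A B (\<psi> k)"
    and W\<psi>: "\<And>i j i' j'. i < A \<Longrightarrow> j < B \<Longrightarrow> i' < A \<Longrightarrow> j' < B \<Longrightarrow>
      W $$ (i * B + j, i' * B + j') = (\<Sum>k<m. \<psi> k i j * cnj (\<psi> k i' j'))"
    by (rule low_rank_mixtureE[OF W']) blast
  have W\<psi>': "W $$ (x, y) = (\<Sum>k<m. \<psi> k (x div B) (x mod B) * cnj (\<psi> k (y div B) (y mod B)))" if "x \<in> ?I" "y \<in> ?I" for x y
    using W\<psi>[of "x div B" "x mod B" "y div B" "y mod B"] that AB by (simp add: less_mult_imp_div_less)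
  have Wpsd: "psd_on ?I (\<lambda>x y. W $$ (x, y))"
    by (rule psd_gram[where K = "{..<m}" and w = "\<lambda>k x. \<psi> k (x div B) (x mod B)"]) (rule W\<psi>')
  define D where "D = W - P"
  have Dc: "D \<in> carrier_mat (A * B) (A * B)" unfolding D_def by (rule minus_carrier_mat[OF Pc])
  have Di: "D $$ (x, y) = W $$ (x, y) - P $$ (x, y)" if "x \<in> ?I" "y \<in> ?I" for x y
    using that Wc Pc by (simp add: D_def)
  have "hermitian_on ?I (\<lambda>x y. D $$ (x, y))"
  proof (rule hermitian_onI)
    fix x y assume xy: "x \<in> ?I" "y \<in> ?I"
    show "D $$ (y, x) = cnj (D $$ (x, y))"
      unfolding Di[OF xy] Di[OF xy(2,1)] hermitian_onD[OF psd_onD(1)[OF Wpsd] xy] hermitian_onD[OF psd_onD(1)[OF Ppsd] xy] by simp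
  qed
  from spectral_theorem[OF _ this] obtain z dl where
    z: "spectral_on ?I ?I z dl (\<lambda>x y. D $$ (x, y))" "complete_family ?I ?I z" by auto
  have \<epsilon>: "\<epsilon> = (\<Sum>k\<in>?I. \<bar>dl k\<bar>)"
    unfolding \<epsilon>_def P_def[symmetric] D_def[symmetric] by (rule trace_norm_spectral[OF Dc z(1)])
  \<comment> \<open>\<open>G\<close> is the absolute value of \<open>D\<close>, in the eigenbasis of
    \<open>D\<close>.\<close>
  define G where "G x y = (\<Sum>k\<in>?I. of_real \<bar>dl k\<bar> * z k x * cnj (z k y))" for x y
  have G: "spectral_on ?I ?I z (\<lambda>k. \<bar>dl k\<bar>) G" using z(1) by (simp add: spectral_on_def G_def)
  have Gpsd: "psd_on ?I G" by (rule psd_spectral[OF G]) simp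
  \<comment> \<open>The added multiple of the identity has trace \<open>\<theta>\<close>; it makes
    \<open>X\<close> invertible, as \<open>dominated_decomposition\<close> requires.\<close>
  define h where "h = \<theta> / real (A * B)"
  have h: "h > 0" and hI: "real (A * B) * h = \<theta>" using \<theta> AB by (auto simp: h_def)
  define Q where "Q x y = G x y + (if x = y then complex_of_real h else 0)" for x y
  have Q: "spectral_on ?I ?I z (\<lambda>k. \<bar>dl k\<bar> + h) Q" unfolding Q_def by (rule spectral_shift[OF G z(2)])
  have Qpsd: "psd_on ?I Q" by (rule psd_spectral[OF Q]) (use h in simp)
  obtain w where w: "\<And>x y. x \<in> ?I \<Longrightarrow> y \<in> ?I \<Longrightarrow> Q x y = (\<Sum>k\<in>?I. w k x * cnj (w k y))"
    by (rule psd_gramE[OF _ Qpsd]) auto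
  define Y where "Y x y = W $$ (x, y) + G x y" for x y
  have Ypsd: "psd_on ?I Y"
  proof -
    have "psd_on ?I (\<lambda>x y. \<Sum>t\<in>{True, False}. (if t then (\<lambda>x y. W $$ (x, y)) else G) x y)"
      using Wpsd Gpsd by (intro psd_sum) auto
    then show ?thesis by (rule psd_cong) (simp add: Y_def)
  qed
  obtain xs lam where xs: "spectral_on ?I ?I xs lam Y" "complete_family ?I ?I xs"
    using spectral_theorem[OF _ psd_onD(1)[OF Ypsd]] by auto
  define X where "X x y = Y x y + (if x = y then complex_of_real h else 0)" for x y
  have X: "spectral_on ?I ?I xs (\<lambda>k. lam k + h) X" unfolding X_def by (rule spectral_shift[OF xs])
  have lam: "0 < lam k + h" if "k \<in> ?I" for k using psd_spectral_nonneg[OF Ypsd xs(1) that] h by simp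
  have XQ: "X x y = W $$ (x, y) + Q x y" for x y by (simp add: X_def Y_def Q_def)
  have XP: "spectral_on ?I ?I z (\<lambda>k. (dl k + \<bar>dl k\<bar>) + h) (\<lambda>x y. X x y - P $$ (x, y))"
  proof -
    have "D $$ (x, y) + G x y = (\<Sum>k\<in>?I. of_real (dl k + \<bar>dl k\<bar>) * z k x * cnj (z k y))"
      if xy: "x \<in> ?I" "y \<in> ?I" for x y
      unfolding spectral_onD(3)[OF z(1) xy] G_def by (simp add: sum.distrib distrib_right)
    then have "spectral_on ?I ?I z (\<lambda>k. dl k + \<bar>dl k\<bar>) (\<lambda>x y. D $$ (x, y) + G x y)"
      using spectral_onD(1,2)[OF z(1)] unfolding spectral_on_def by blast
    from spectral_shift[OF this z(2), of h] show ?thesis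
      by (rule spectral_cong) (simp add: X_def Y_def Di)
  qed
  have XPpsd: "psd_on ?I (\<lambda>x y. X x y - P $$ (x, y))" by (rule psd_spectral[OF XP]) (use h in simp)
  \<comment> \<open>An ensemble of \<open>X\<close>: the low rank vectors of \<open>W\<close> on the
    left, Gram vectors of the correction \<open>Q\<close> on the right.\<close>
  define \<Psi> where "\<Psi> k x = (case k of Inl k \<Rightarrow> \<psi> k (x div B) (x mod B) | Inr t \<Rightarrow> w t x)" for k :: "nat + nat" and x
  let ?K = "{..<m} <+> ?I"
  have X\<Psi>: "X x y = (\<Sum>k\<in>?K. \<Psi> k x * cnj (\<Psi> k y))" if xy: "x \<in> ?I" "y \<in> ?I" for x y
    unfolding XQ W\<psi>'[OF xy] w[OF xy] by (simp add: sum.Plus \<Psi>_def)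
  obtain \<Phi> where \<Phi>: "\<And>x y. x \<in> ?I \<Longrightarrow> y \<in> ?I \<Longrightarrow> P $$ (x, y) = (\<Sum>k\<in>?K. \<Phi> k x * cnj (\<Phi> k y))"
    and \<Phi>d: "(\<Sum>k\<in>?K. \<Sum>x\<in>?I. (cmod (\<Phi> k x - \<Psi> k x))\<^sup>2) \<le> Re (\<Sum>x\<in>?I. X x x) - Re (\<Sum>x\<in>?I. P $$ (x, x))"
    by (rule dominated_decomposition[OF _ X xs(2) lam Ppsd XPpsd X\<Psi>]) auto
  \<comment> \<open>The excess of \<open>X\<close> over the power is the sum of \<open>D\<close>,
    its absolute value and \<open>h\<close> times the identity, of trace at most
    \<open>2 * \<epsilon> + \<theta>\<close>.\<close>
  have d1: "(\<Sum>k\<in>?K. \<Sum>x\<in>?I. (cmod (\<Phi> k x - \<Psi> k x))\<^sup>2) \<le> 2 * \<epsilon> + \<theta>"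
  proof -
    have "(\<Sum>x\<in>?I. X x x - P $$ (x, x)) = of_real (\<Sum>k\<in>?I. dl k + \<bar>dl k\<bar> + h)"
      by (rule spectral_trace[OF XP])
    then have "Re (\<Sum>x\<in>?I. X x x) - Re (\<Sum>x\<in>?I. P $$ (x, x)) = (\<Sum>k\<in>?I. dl k + \<bar>dl k\<bar> + h)"
      by (simp only: sum_subtractf Re_complex_of_real flip: minus_complex.simps(1))
    also have "\<dots> \<le> (\<Sum>k\<in>?I. 2 * \<bar>dl k\<bar> + h)" by (intro sum_mono) simp
    also have "\<dots> = 2 * \<epsilon> + \<theta>" unfolding \<epsilon> using hI by (simp add: sum.distrib sum_distrib_left)
    finally show ?thesis using \<Phi>d by simp
  qed
  have d2: "(\<Sum>t\<in>?I. \<Sum>x\<in>?I. (cmod (w t x))\<^sup>2) = \<epsilon> + \<theta>"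
  proof -
    have "complex_of_real (\<Sum>t\<in>?I. \<Sum>x\<in>?I. (cmod (w t x))\<^sup>2) = (\<Sum>x\<in>?I. Q x x)"
      unfolding of_real_sum mult_cnj_self[symmetric] by (subst sum.swap) (simp add: w)
    also have "\<dots> = of_real (\<Sum>k\<in>?I. \<bar>dl k\<bar> + h)" by (rule spectral_trace[OF Q])
    finally have "(\<Sum>t\<in>?I. \<Sum>x\<in>?I. (cmod (w t x))\<^sup>2) = (\<Sum>k\<in>?I. \<bar>dl k\<bar> + h)" using of_real_eq_iff by blast
    then show ?thesis unfolding \<epsilon> using hI by (simp add: sum.distrib)
  qed
  define \<phi> where "\<phi> k i j = \<Phi> k (i * B + j)" for k i j
  \<comment> \<open>The vectors of the correction have no rank bound, but small total norm by
    \<open>d2\<close>; they are compared with 0.\<close>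
  define \<chi> where "\<chi> k = (case k of Inl k \<Rightarrow> \<psi> k | Inr t \<Rightarrow> (\<lambda>i j. 0))" for k :: "nat + nat"
  have \<chi>: "schmidt_rank_le s A B (\<chi> k)" if "k \<in> ?K" for k
  proof -
    have "schmidt_rank_le s A B (\<lambda>i j. 0)" unfolding schmidt_rank_le_def by (intro exI[of _ "\<lambda>_ _. 0"]) simp
    then show ?thesis using that \<psi> by (auto simp: \<chi>_def)
  qed
  have ext: "(\<Sum>k\<in>?K. cq_kernel \<phi> (i, j, k) (i', j', k)) = power_kernel a b n \<rho> i j i' j'"
    if ij: "i < A" "j < B" "i' < A" "j' < B" for i j i' j'
    unfolding Pi[OF ij, symmetric] using \<Phi> index_less[OF ij(1,2)] index_less[OF ij(3,4)]
    by (simp add: cq_kernel_def \<phi>_def)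
  have fK: "finite ?K" by simp
  have "real n * c \<le> cmi {..<A} {..<B} ?K (cq_kernel \<phi>)"
    unfolding A_def B_def
    by (rule cmi_power_ge[OF \<rho> c]) (use cq_kernel_psd[OF fK] ext in \<open>auto simp: A_def B_def\<close>)
  also have "\<dots> \<le> 2 * (1 + log 2 (real s)) * (\<Sum>k\<in>?K. \<Sum>i<A. \<Sum>j<B. (cmod (\<phi> k i j))\<^sup>2)
      + (log 2 (real A) + log 2 (real B)) * (\<Sum>k\<in>?K. \<Sum>i<A. \<Sum>j<B. (cmod (\<phi> k i j - \<chi> k i j))\<^sup>2)"
    by (rule cq_kernel_cmi_le[OF fK s AB \<chi>])
  also have "(\<Sum>k\<in>?K. \<Sum>i<A. \<Sum>j<B. (cmod (\<phi> k i j))\<^sup>2) = 1"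
  proof -
    have "complex_of_real (\<Sum>k\<in>?K. \<Sum>i<A. \<Sum>j<B. (cmod (\<phi> k i j))\<^sup>2) = (\<Sum>k\<in>?K. \<Sum>i<A. \<Sum>j<B. cq_kernel \<phi> (i, j, k) (i, j, k))"
      unfolding of_real_sum mult_cnj_self[symmetric] by (simp add: cq_kernel_def)
    also have "\<dots> = (\<Sum>i<A. \<Sum>k\<in>?K. \<Sum>j<B. cq_kernel \<phi> (i, j, k) (i, j, k))" by (rule sum.swap)
    also have "\<dots> = (\<Sum>i<A. \<Sum>j<B. \<Sum>k\<in>?K. cq_kernel \<phi> (i, j, k) (i, j, k))" by (intro sum.cong[OF refl] sum.swap)
    also have "\<dots> = (\<Sum>i<A. \<Sum>j<B. power_kernel a b n \<rho> i j i j)" by (intro sum.cong refl ext) auto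
    also have "\<dots> = of_real 1" using power_kernel_trace[OF tr \<rho>c] by (simp add: A_def B_def)
    finally show ?thesis using of_real_eq_iff by blast
  qed
  \<comment> \<open>The constants come from 2 (2\<epsilon> + \<theta>) for the distance to
    \<open>\<Psi>\<close>, doubled by \<open>cmod_power2_le_double\<close>, and 2 (\<epsilon> +
    \<theta>) for the norm of the correction vectors.\<close>
  also have "2 * (1 + log 2 (real s)) * 1 + (log 2 (real A) + log 2 (real B)) * (\<Sum>k\<in>?K. \<Sum>i<A. \<Sum>j<B. (cmod (\<phi> k i j - \<chi> k i j))\<^sup>2)
    \<le> 2 * (1 + log 2 (real s)) + (log 2 (real A) + log 2 (real B)) * (6 * \<epsilon> + 4 * \<theta>)"
  proof -
    let ?d = "\<lambda>k. \<Sum>x\<in>?I. (cmod (\<Phi> k x - \<Psi> k x))\<^sup>2"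
    have d0: "?d k \<ge> 0" for k by (simp add: sum_nonneg)
    have l: "(\<Sum>i<A. \<Sum>j<B. (cmod (\<phi> (Inl k) i j - \<chi> (Inl k) i j))\<^sup>2) = ?d (Inl k)" for k
      unfolding sum_div_mod by (intro sum.cong refl) (simp add: \<phi>_def \<chi>_def \<Psi>_def)
    have r: "(\<Sum>i<A. \<Sum>j<B. (cmod (\<phi> (Inr t) i j - \<chi> (Inr t) i j))\<^sup>2) \<le> 2 * ?d (Inr t) + 2 * (\<Sum>x\<in>?I. (cmod (w t x))\<^sup>2)" for t
    proof -
      have "(\<Sum>i<A. \<Sum>j<B. (cmod (\<phi> (Inr t) i j - \<chi> (Inr t) i j))\<^sup>2) = (\<Sum>x\<in>?I. (cmod (\<Phi> (Inr t) x))\<^sup>2)"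
        unfolding sum_div_mod by (simp add: \<phi>_def \<chi>_def)
      also have "\<dots> \<le> (\<Sum>x\<in>?I. 2 * (cmod (\<Phi> (Inr t) x - \<Psi> (Inr t) x))\<^sup>2 + 2 * (cmod (w t x))\<^sup>2)"
        by (intro sum_mono) (simp add: \<Psi>_def cmod_power2_le_double)
      finally show ?thesis by (simp add: sum.distrib sum_distrib_left)
    qed
    have "(\<Sum>k\<in>?K. \<Sum>i<A. \<Sum>j<B. (cmod (\<phi> k i j - \<chi> k i j))\<^sup>2)
      = (\<Sum>k<m. ?d (Inl k)) + (\<Sum>t\<in>?I. \<Sum>i<A. \<Sum>j<B. (cmod (\<phi> (Inr t) i j - \<chi> (Inr t) i j))\<^sup>2)"
      by (simp add: sum.Plus l)
    also have "\<dots> \<le> 2 * (\<Sum>k<m. ?d (Inl k)) + (\<Sum>t\<in>?I. 2 * ?d (Inr t) + 2 * (\<Sum>x\<in>?I. (cmod (w t x))\<^sup>2))"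
      using sum_nonneg[of "{..<m}" "\<lambda>k. ?d (Inl k)"] d0 by (intro add_mono sum_mono r) auto
    also have "\<dots> = 2 * (\<Sum>k\<in>?K. ?d k) + 2 * (\<Sum>t\<in>?I. \<Sum>x\<in>?I. (cmod (w t x))\<^sup>2)"
      by (simp add: sum.Plus sum.distrib sum_distrib_left)
    also have "\<dots> \<le> 6 * \<epsilon> + 4 * \<theta>" using d1 unfolding d2 by simp
    finally have "(\<Sum>k\<in>?K. \<Sum>i<A. \<Sum>j<B. (cmod (\<phi> k i j - \<chi> k i j))\<^sup>2) \<le> 6 * \<epsilon> + 4 * \<theta>" .
    moreover have "0 \<le> log 2 (real A) + log 2 (real B)" using AB by (simp add: Suc_leI)
    ultimately show ?thesis by (simp add: mult_left_mono)
  qed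
  finally show ?thesis unfolding A_def B_def by (simp add: mult.commute)
qed

theorem corollary6:
  fixes dA dB :: nat and \<rho> :: "complex mat"
  assumes "state (dA * dB) \<rho>"
  shows "squashed_entanglement dA dB \<rho> \<le> entanglement_cost dA dB \<rho>"
  unfolding entanglement_cost_def
proof (intro Inf_greatest, clarify)
  fix s :: "nat \<Rightarrow> nat" and T
  assume sT: "\<forall>n. 0 < s n \<and> locc (s n) (s n) (dA ^ n) (dB ^ n) (T n)"
    and lim: "(\<lambda>n. trace_norm (T n (projector (max_entangled_vec (s n))) - bipartite_power dA dB n \<rho>)) \<longlonglongrightarrow> 0"
  let ?L = "limsup (\<lambda>n. ereal (log 2 (real (s n)) / real n))"
  define \<epsilon> where "\<epsilon> n = trace_norm (T n (projector (max_entangled_vec (s n))) - bipartite_power dA dB n \<rho>)" for n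
  define l where "l = log 2 (real dA) + log 2 (real dB)"
  have d: "dA > 0" "dB > 0" using state_dim_pos[OF assms] by auto
  then have l0: "l \<ge> 0" by (simp add: l_def Suc_leI)
  show "squashed_entanglement dA dB \<rho> \<le> ?L"
  proof (rule ccontr)
    assume "\<not> squashed_entanglement dA dB \<rho> \<le> ?L"
    \<comment> \<open>Two reals are placed strictly between the sides, which might be infinite:
      \<open>r0\<close> bounds the rates eventually, \<open>r1\<close> bounds squashed entanglement
      from below, and their gap absorbs the error.\<close>
    then obtain r1 where r1: "?L < ereal r1" "ereal r1 < squashed_entanglement dA dB \<rho>"
      by (meson ereal_dense2 not_le)
    obtain r0 where r0: "?L < ereal r0" "ereal r0 < ereal r1" using ereal_dense2[OF r1(1)] by blast
    \<comment> \<open>The remaining error \<open>2 * \<theta> * l\<close> is then at most half the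
      gap; \<open>l + 1\<close> avoids a division by 0 when both spaces have dimension 1.\<close>
    define \<theta> where "\<theta> = (r1 - r0) / (4 * (l + 1))"
    have \<theta>: "\<theta> > 0" using r0(2) l0 by (simp add: \<theta>_def)
    have "\<forall>\<^sub>F n in sequentially. ereal (log 2 (real (s n)) / real n) < ereal r0"
      by (rule Limsup_lessD[OF r0(1)])
    then have ev: "\<forall>\<^sub>F n in sequentially. r1 \<le> r0 + 1 / real n + (3 * \<epsilon> n + 2 * \<theta>) * l"
      using eventually_gt_at_top[of 0]
    proof eventually_elim
      case (elim n)
      have n: "real n > 0" using elim(2) by simp
      have W: "low_rank_mixture (s n) (dA ^ n) (dB ^ n) (T n (projector (max_entangled_vec (s n))))"
        using sT by (blast intro: locc_low_rank max_entangled_low_rank)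
      have c: "ereal (2 * r1 / 2) \<le> squashed_entanglement dA dB \<rho>" using r1(2) by simp
      have "real n * (2 * r1) \<le> 2 * (1 + log 2 (real (s n)))
        + (6 * \<epsilon> n + 4 * \<theta>) * (log 2 (real (dA ^ n)) + log 2 (real (dB ^ n)))"
        unfolding \<epsilon>_def using sT by (intro squashed_power_bound[OF assms c W _ \<theta>]) blast
      \<comment> \<open>The logarithm of the dimensions is linear in the number of copies, so the
        error per copy keeps the bounded factor \<open>l\<close>.\<close>
      also have "log 2 (real (dA ^ n)) + log 2 (real (dB ^ n)) = real n * l"
        using d by (simp add: l_def log_nat_power distrib_left)
      finally have "real n * (2 * r1) \<le> 2 * (1 + log 2 (real (s n))) + (6 * \<epsilon> n + 4 * \<theta>) * (real n * l)" .
      then have "real n * (2 * r1) / (2 * real n) \<le> (2 * (1 + log 2 (real (s n))) + (6 * \<epsilon> n + 4 * \<theta>) * (real n * l)) / (2 * real n)"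
        using n by (intro divide_right_mono) auto
      also have "\<dots> = 1 / real n + log 2 (real (s n)) / real n + (3 * \<epsilon> n + 2 * \<theta>) * l"
        using n by (simp add: field_simps)
      finally show ?case using elim n by simp
    qed
    \<comment> \<open>In the limit the additive bit and the trace norm error disappear, and only the
      regularisation error stays.\<close>
    have "(\<lambda>n. r0 + 1 / real n + (3 * \<epsilon> n + 2 * \<theta>) * l) \<longlonglongrightarrow> r0 + 0 + (3 * 0 + 2 * \<theta>) * l"
      using lim unfolding \<epsilon>_def[symmetric] by (intro tendsto_intros lim_1_over_n)
    then have "r1 \<le> r0 + 0 + (3 * 0 + 2 * \<theta>) * l"
      using ev by (rule tendsto_lowerbound) simp
    moreover have "2 * \<theta> * l < r1 - r0"
    proof -
      have "2 * \<theta> * l \<le> 2 * \<theta> * (l + 1)" using \<theta> by simp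
      also have "\<dots> = (r1 - r0) / 2" using l0 by (simp add: \<theta>_def field_simps)
      also have "\<dots> < r1 - r0" using r0(2) by simp
      finally show ?thesis .
    qed
    ultimately show False by simp
  qed
qed


end
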